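(* Let $n\ge 1$, let $A\subset\mathbb{C}P^n$ be a closed $\mathbb{Q}$-acyclic neighborhood, and let $f:(\mathbb{C}P^n,A)\to(\mathbb{C}P^n,A)$ be a continuous map of pairs. Let $a$ be the eigenvalue of the linear map $f^{\ast 2}:H^2(\mathbb{C}P^n;\mathbb{Q})\to H^2(\mathbb{C}P^n;\mathbb{Q})$ induced by $f:\mathbb{C}P^n\to\mathbb{C}P^n$, where $H^2(\mathbb{C}P^n;\mathbb{Q})\cong\mathbb{Q}$. Then $L(f^m,\mathbb{C}P^n,A)=0$ for all integers $m\ge 1$ if and only if $a=0$.
   Context: A neighborhood here is a neighborhood of some point (a subset with non-empty interior). A space $A$ is $\mathbb{Q}$-acyclic if it has the rational homology of a point: $H_0(A;\mathbb{Q})=\mathbb{Q}$ and $H_k(A;\mathbb{Q})=0$ for $k>0$. For a map of pairs $g:(X,A)\to(X,A)$ such that the groups $H_k(X,A;\mathbb{Q})$ are finite-dimensional and vanish for almost all $k$, the relative Lefschetz number is $L(g,X,A)=\sum_k(-1)^k\operatorname{tr}\big(g_{\ast k}:H_k(X,A;\mathbb{Q})\to H_k(X,A;\mathbb{Q})\big)$ (equivalently, defined using relative rational cohomology). $f^m$ is the $m$-th iterate of $f$. *)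

theory Defs
  imports "HOL-Homology.Homology" "Jordan_Normal_Form.VS_Connect"
begin

section \<open>Linear algebra over a field\<close>

text \<open>
  Vector spaces are records in the sense of the locale \<open>vectorspace\<close>, over the field
  \<^term>\<open>class_ring\<close> given by a type of class \<open>field\<close>.
\<close>

abbreviation rat_field :: "rat ring"
  where "rat_field \<equiv> class_ring"

definition rat_line :: "(rat, rat) module"
  where "rat_line =
    \<lparr>carrier = UNIV, mult = (*), one = 1, zero = 0, add = (+), smult = (*)\<rparr>"

text \<open>
  The map on cosets induced by \<^term>\<open>h\<close>, with values in the cosets of \<^term>\<open>W\<close> in
  \<^term>\<open>V\<close>. When \<^term>\<open>h\<close> respects the two subspaces, all sets in the union agree.
\<close>

definition coset_map :: "('k, 'b) module \<Rightarrow> 'b set \<Rightarrow> ('c \<Rightarrow> 'b) \<Rightarrow> 'c set \<Rightarrow> 'b set"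
  where "coset_map V W h S = (\<Union>x\<in>S. W +>\<^bsub>V\<^esub> h x)"

definition quotient_space :: "('k, 'b) module \<Rightarrow> 'b set \<Rightarrow> ('k, 'b set) module"
  where "quotient_space V W =
    \<lparr>carrier = a_rcosets\<^bsub>V\<^esub> W, mult = undefined, one = undefined,
     zero = W, add = (<+>\<^bsub>V\<^esub>), smult = (\<lambda>c. coset_map V W (\<lambda>x. c \<odot>\<^bsub>V\<^esub> x))\<rparr>"

definition isomorphic_spaces ::
    "'k ring \<Rightarrow> ('k, 'b) module \<Rightarrow> ('k, 'c) module \<Rightarrow> bool"
  where "isomorphic_spaces K V W \<longleftrightarrow>
    (\<exists>T. linear_map K V W T \<and> bij_betw T (carrier V) (carrier W))"

definition is_eigenvalue :: "('k, 'b) module \<Rightarrow> ('b \<Rightarrow> 'b) \<Rightarrow> 'k \<Rightarrow> bool"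
  where "is_eigenvalue V T a \<longleftrightarrow>
    (\<exists>v\<in>carrier V. v \<noteq> \<zero>\<^bsub>V\<^esub> \<and> T v = a \<odot>\<^bsub>V\<^esub> v)"

definition coordinates :: "(rat, 'b) module \<Rightarrow> 'b set \<Rightarrow> 'b \<Rightarrow> 'b \<Rightarrow> rat"
  where "coordinates V B v = (SOME c. v = module.lincomb V c B)"

text \<open>
  The trace of an endomorphism of a finite-dimensional space is the sum of the diagonal entries
  of its matrix in a basis; it does not depend on the basis. In infinite dimension it has the
  dummy value \<open>0\<close>.
\<close>

definition trace_on :: "(rat, 'b) module \<Rightarrow> ('b \<Rightarrow> 'b) \<Rightarrow> rat"
  where "trace_on V T =
    (if vectorspace.fin_dim rat_field V then
       let B = (SOME B. finite B \<and> vectorspace.basis rat_field V B)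
       in \<Sum>b\<in>B. coordinates V B (T b) b
     else 0)"


section \<open>Singular homology with rational coefficients\<close>

text \<open>
  This follows the integral theory of \<open>HOL-Homology\<close>: the same singular simplices, and relative
  homology as the quotient of relative cycles by relative boundaries, where both are sets of
  chains of \<^term>\<open>X\<close> containing the chains of \<^term>\<open>S\<close>.
\<close>

type_synonym 'a rat_chain = "((nat \<Rightarrow> real) \<Rightarrow> 'a) \<Rightarrow>\<^sub>0 rat"

definition rat_chain_space :: "nat \<Rightarrow> 'a topology \<Rightarrow> (rat, 'a rat_chain) module"
  where "rat_chain_space p X =
    \<lparr>carrier = {c. Poly_Mapping.keys c \<subseteq> singular_simplex_set p X},
     mult = undefined, one = undefined, zero = 0, add = (+),
     smult = (\<lambda>q. Poly_Mapping.map (\<lambda>r. q * r))\<rparr>"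

definition rat_boundary :: "nat \<Rightarrow> 'a rat_chain \<Rightarrow> 'a rat_chain"
  where "rat_boundary p c =
    (if p = 0 then 0 else
       \<Sum>\<sigma>\<in>Poly_Mapping.keys c. \<Sum>k\<le>p.
         Poly_Mapping.single (singular_face p k \<sigma>) ((-1) ^ k * Poly_Mapping.lookup c \<sigma>))"

definition rat_chain_map :: "nat \<Rightarrow> ('a \<Rightarrow> 'b) \<Rightarrow> 'a rat_chain \<Rightarrow> 'b rat_chain"
  where "rat_chain_map p f c =
    (\<Sum>\<sigma>\<in>Poly_Mapping.keys c.
       Poly_Mapping.single (simplex_map p f \<sigma>) (Poly_Mapping.lookup c \<sigma>))"

definition rat_relcycles :: "nat \<Rightarrow> 'a topology \<Rightarrow> 'a set \<Rightarrow> 'a rat_chain set"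
  where "rat_relcycles p X S =
    {c \<in> carrier (rat_chain_space p X).
       rat_boundary p c \<in> carrier (rat_chain_space (p - 1) (subtopology X S))}"

definition rat_relboundaries :: "nat \<Rightarrow> 'a topology \<Rightarrow> 'a set \<Rightarrow> 'a rat_chain set"
  where "rat_relboundaries p X S =
    {c. \<exists>d \<in> carrier (rat_chain_space (Suc p) X).
       rat_boundary (Suc p) d - c \<in> carrier (rat_chain_space p (subtopology X S))}"

abbreviation rat_relcycle_space ::
    "nat \<Rightarrow> 'a topology \<Rightarrow> 'a set \<Rightarrow> (rat, 'a rat_chain) module"
  where "rat_relcycle_space p X S \<equiv> (rat_chain_space p X)\<lparr>carrier := rat_relcycles p X S\<rparr>"

definition rat_homology :: "nat \<Rightarrow> 'a topology \<Rightarrow> 'a set \<Rightarrow> (rat, 'a rat_chain set) module"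
  where "rat_homology p X S =
    quotient_space (rat_relcycle_space p X S) (rat_relboundaries p X S)"

definition rat_hom_induced ::
    "nat \<Rightarrow> 'a topology \<Rightarrow> 'a set \<Rightarrow> 'b topology \<Rightarrow> 'b set \<Rightarrow> ('a \<Rightarrow> 'b)
      \<Rightarrow> 'a rat_chain set \<Rightarrow> 'b rat_chain set"
  where "rat_hom_induced p X S Y T f =
    coset_map (rat_relcycle_space p Y T) (rat_relboundaries p Y T) (rat_chain_map p f)"

definition rat_acyclic :: "'a topology \<Rightarrow> bool"
  where "rat_acyclic X \<longleftrightarrow>
    isomorphic_spaces rat_field (rat_homology 0 X {}) rat_line \<and>
    (\<forall>k>0. carrier (rat_homology k X {}) = {\<zero>\<^bsub>rat_homology k X {}\<^esub>})"

text \<open>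
  Only degrees with nonzero homology contribute. The number is meaningful when there are finitely
  many of them and all the spaces are finite-dimensional.
\<close>

definition lefschetz_number :: "'a topology \<Rightarrow> 'a set \<Rightarrow> ('a \<Rightarrow> 'a) \<Rightarrow> rat"
  where "lefschetz_number X S g =
    (\<Sum>k | carrier (rat_homology k X S) \<noteq> {\<zero>\<^bsub>rat_homology k X S\<^esub>}.
       (-1) ^ k * trace_on (rat_homology k X S) (rat_hom_induced k X S X S g))"


section \<open>Singular cohomology with rational coefficients\<close>

text \<open>A cochain is given by its values on singular simplices, extensionally.\<close>

abbreviation rat_cochain_space ::
    "nat \<Rightarrow> 'a topology \<Rightarrow> (rat, ((nat \<Rightarrow> real) \<Rightarrow> 'a) \<Rightarrow> rat) module"
  where "rat_cochain_space p X \<equiv> ring.func_space rat_field (singular_simplex_set p X)"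

definition rat_coboundary ::
    "nat \<Rightarrow> 'a topology \<Rightarrow> (((nat \<Rightarrow> real) \<Rightarrow> 'a) \<Rightarrow> rat) \<Rightarrow> ((nat \<Rightarrow> real) \<Rightarrow> 'a) \<Rightarrow> rat"
  where "rat_coboundary p X \<phi> =
    (\<lambda>\<sigma>\<in>singular_simplex_set (Suc p) X.
       \<Sum>k\<le>Suc p. (-1) ^ k * \<phi> (singular_face (Suc p) k \<sigma>))"

definition rat_cocycles :: "nat \<Rightarrow> 'a topology \<Rightarrow> (((nat \<Rightarrow> real) \<Rightarrow> 'a) \<Rightarrow> rat) set"
  where "rat_cocycles p X =
    {\<phi> \<in> carrier (rat_cochain_space p X).
       rat_coboundary p X \<phi> = \<zero>\<^bsub>rat_cochain_space (Suc p) X\<^esub>}"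

definition rat_coboundaries :: "nat \<Rightarrow> 'a topology \<Rightarrow> (((nat \<Rightarrow> real) \<Rightarrow> 'a) \<Rightarrow> rat) set"
  where "rat_coboundaries p X =
    (if p = 0 then {\<zero>\<^bsub>rat_cochain_space p X\<^esub>}
     else rat_coboundary (p - 1) X ` carrier (rat_cochain_space (p - 1) X))"

abbreviation rat_cocycle_space ::
    "nat \<Rightarrow> 'a topology \<Rightarrow> (rat, ((nat \<Rightarrow> real) \<Rightarrow> 'a) \<Rightarrow> rat) module"
  where "rat_cocycle_space p X \<equiv> (rat_cochain_space p X)\<lparr>carrier := rat_cocycles p X\<rparr>"

definition rat_cohomology ::
    "nat \<Rightarrow> 'a topology \<Rightarrow> (rat, (((nat \<Rightarrow> real) \<Rightarrow> 'a) \<Rightarrow> rat) set) module"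
  where "rat_cohomology p X = quotient_space (rat_cocycle_space p X) (rat_coboundaries p X)"

definition rat_cochain_map ::
    "nat \<Rightarrow> 'a topology \<Rightarrow> ('a \<Rightarrow> 'b) \<Rightarrow> (((nat \<Rightarrow> real) \<Rightarrow> 'b) \<Rightarrow> rat)
      \<Rightarrow> ((nat \<Rightarrow> real) \<Rightarrow> 'a) \<Rightarrow> rat"
  where "rat_cochain_map p X f \<phi> = (\<lambda>\<sigma>\<in>singular_simplex_set p X. \<phi> (simplex_map p f \<sigma>))"

text \<open>The contravariant map \<open>H\<^sup>p Y \<rightarrow> H\<^sup>p X\<close> induced by \<open>f : X \<rightarrow> Y\<close>; it depends on
  \<open>Y\<close> only through its argument.\<close>

definition rat_cohom_induced ::
    "nat \<Rightarrow> 'a topology \<Rightarrow> ('a \<Rightarrow> 'b)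
      \<Rightarrow> (((nat \<Rightarrow> real) \<Rightarrow> 'b) \<Rightarrow> rat) set \<Rightarrow> (((nat \<Rightarrow> real) \<Rightarrow> 'a) \<Rightarrow> rat) set"
  where "rat_cohom_induced p X f =
    coset_map (rat_cocycle_space p X) (rat_coboundaries p X) (rat_cochain_map p X f)"


section \<open>Complex projective space\<close>

text \<open>
  \<open>\<complex>\<^sup>n\<^sup>+\<^sup>1 - {0}\<close>, with vectors as sequences vanishing beyond index \<^term>\<open>n\<close>
  (compare \<^const>\<open>Euclidean_space\<close>).
\<close>

definition punctured_complex_space :: "nat \<Rightarrow> (nat \<Rightarrow> complex) topology"
  where "punctured_complex_space n =
    subtopology (product_topology (\<lambda>_. euclidean) UNIV)
      {z. (\<forall>i>n. z i = 0) \<and> z \<noteq> (\<lambda>_. 0)}"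

definition projective_class :: "(nat \<Rightarrow> complex) \<Rightarrow> (nat \<Rightarrow> complex) set"
  where "projective_class z = {w. \<exists>c. c \<noteq> 0 \<and> w = (\<lambda>i. c * z i)}"

definition complex_projective_space :: "nat \<Rightarrow> (nat \<Rightarrow> complex) set topology"
  where "complex_projective_space n = topology (\<lambda>U.
    U \<subseteq> projective_class ` topspace (punctured_complex_space n) \<and>
    openin (punctured_complex_space n)
      {z \<in> topspace (punctured_complex_space n). projective_class z \<in> U})"

lemma openin_complex_projective_space:
  "openin (complex_projective_space n) U \<longleftrightarrow>
    U \<subseteq> projective_class ` topspace (punctured_complex_space n) \<and>
    openin (punctured_complex_space n)
      {z \<in> topspace (punctured_complex_space n). projective_class z \<in> U}"
proof -
  let ?P = "punctured_complex_space n"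
  let ?V = "\<lambda>U. {z \<in> topspace ?P. projective_class z \<in> U}"
  have "istopology (\<lambda>U. U \<subseteq> projective_class ` topspace ?P \<and> openin ?P (?V U))"
    unfolding istopology_def
  proof (intro conjI allI impI, goal_cases)
    case (2 S T)
    have "?V (S \<inter> T) = ?V S \<inter> ?V T"
      by blast
    with 2 show ?case
      by (simp add: openin_Int)
  next
    case (4 \<K>)
    have "?V (\<Union>\<K>) = \<Union>(?V ` \<K>)"
      by blast
    moreover have "openin ?P (\<Union>(?V ` \<K>))"
      by (rule openin_Union) (use 4 in auto)
    ultimately show ?case
      using 4 by auto
  qed blast+
  then show ?thesis
    by (simp add: complex_projective_space_def topology_inverse')
qed

lemma topspace_complex_projective_space:
  "topspace (complex_projective_space n) =
    projective_class ` topspace (punctured_complex_space n)"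
proof -
  have eq: "{z \<in> topspace (punctured_complex_space n).
      projective_class z \<in> projective_class ` topspace (punctured_complex_space n)}
    = topspace (punctured_complex_space n)"
    by blast
  have "openin (complex_projective_space n)
      (projective_class ` topspace (punctured_complex_space n))"
    unfolding openin_complex_projective_space by (simp only: eq openin_topspace subset_refl simp_thms)
  then show ?thesis
    by (meson openin_complex_projective_space openin_subset openin_topspace subset_antisym)
qed

lemma quotient_map_projective_class:
  "quotient_map (punctured_complex_space n) (complex_projective_space n) projective_class"
  by (auto simp: quotient_map_def topspace_complex_projective_space
      openin_complex_projective_space)

end

theory Submission
  imports Defs "HOL-Analysis.Analysis"
begin

text \<open>
  Since \<open>A\<close> is acyclic, \<open>H\<^sub>k(\<complex>P\<^sup>n, A)\<close> agrees with \<open>H\<^sub>k(\<complex>P\<^sup>n)\<close> for \<open>k > 0\<close> and vanishes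
  for \<open>k = 0\<close>. It has rank at most one, and is nonzero only in even degrees, so
  \<open>L(f\<^sup>m, \<complex>P\<^sup>n, A)\<close> is the sum of the powers \<open>\<lambda>\<^sub>k\<^sup>m\<close> of the rational eigenvalues \<open>\<lambda>\<^sub>k\<close> in degrees \<open>2k\<close>. If
  it vanishes for \<open>m = 2\<close>, all \<open>\<lambda>\<^sub>k\<close> are zero, and \<open>\<lambda>\<^sub>1 = a\<close> by evaluation of cohomology on homology.

  Conversely, instead of the cup product we use that \<open>f\<close> factors through the total space of
  \<open>S\<^sup>2\<^sup>n\<^sup>+\<^sup>1 \<rightarrow> \<complex>P\<^sup>n\<close> if \<open>a = 0\<close>. On the sphere, \<open>f\<close> lifts to a map \<open>S\<close>, and
  \<open>S(e\<^sup>2\<^sup>\<pi>\<^sup>i\<^sup>t z) = exp(h(t,z)) S(z)\<close>. The number \<open>h(1,z) / 2\<pi>i\<close> is the value of an obstruction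
  cocycle on the image under \<open>f\<close> of a two-cycle, hence zero if \<open>f\<close> is trivial on second homology.
  Then averaging \<open>h\<close> over the circle makes the lift invariant. As the sphere has no homology in
  degrees \<open>1, \<dots>, 2n\<close>, the map induced by \<open>f\<close> is zero there.
\<close>

section \<open>Lifting maps and homotopies to the punctured complex space\<close>

text \<open>Classically the cohomology ring Q[x]/(x^(n+1)) makes the action in degree 2k the k-th
  power of a. For the vanishing of these powers a lift suffices: the circle bundle pulled back along
  f has class a x, so it is trivial if a = 0, and a section of it is a lift of f.

  The lift is built by hand. Two lifts of one map differ by a nonvanishing complex function, so
  lifting is governed by continuous logarithms, and these can be glued, averaged and extended,
  unlike nonvanishing functions. The obstruction is assembled from differences of logarithms at the
  ends of paths. It takes values in the complex numbers, so it can be evaluated directly on rational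
  cycles.

  Integral homology of projective space enters as the upper bound \<open>rank_le_1\<close>. This
  property passes along injections and surjections of groups, which fits an induction by exact
  sequences, and clearing denominators carries it to rational coefficients. Rational homology is
  handled on the level of chains, as statements about cycles and boundaries, and is translated to
  quotient spaces and traces at the end.\<close>

lemma uniform_steps:
  fixes G :: "real \<times> 'b::metric_space \<Rightarrow> 'c::metric_space"
  assumes "compact K" and G: "continuous_on ({0..1} \<times> K) G" and "e > 0"
  shows "\<exists>N>0. \<forall>j<N. \<forall>x\<in>K. dist (G (real (Suc j) / real N, x)) (G (real j / real N, x)) < e"
proof -
  \<comment> \<open>Compactness gives one modulus of continuity for all points of K, so a single
    subdivision of the time interval allows an induction over time with continuous dependence on the
    point.\<close>
  have "uniformly_continuous_on ({0..1} \<times> K) G"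
    by (intro compact_uniformly_continuous G compact_Times assms) simp
  then obtain d where d: "d > 0"
    and dist: "\<And>p q. p \<in> {0..1} \<times> K \<Longrightarrow> q \<in> {0..1} \<times> K \<Longrightarrow> dist q p < d \<Longrightarrow> dist (G q) (G p) < e"
    unfolding uniformly_continuous_on_def using \<open>e > 0\<close> by metis
  obtain m where m: "1 / real (Suc m) < d"
    using nat_approx_posE[OF d] by blast
  show ?thesis
  proof (intro exI[of _ "Suc m"] conjI allI impI ballI)
    fix j x assume jx: "j < Suc m" "x \<in> K"
    have "real (Suc j) / real (Suc m) - real j / real (Suc m) = 1 / real (Suc m)"
      by (simp add: field_simps)
    then have "dist (real (Suc j) / real (Suc m), x) (real j / real (Suc m), x) = 1 / real (Suc m)"
      by (simp add: dist_Pair_Pair dist_real_def)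
    with m jx show "dist (G (real (Suc j) / real (Suc m), x)) (G (real j / real (Suc m), x)) < e"
      by (intro dist) auto
  qed simp
qed

text \<open>For compact K this says that every map to the circle is null-homotopic, that is, the
  first Cech cohomology with integer coefficients vanishes.\<close>

definition loggable :: "'b::metric_space set \<Rightarrow> bool"
  where "loggable K \<longleftrightarrow> (\<forall>g. continuous_on K g \<and> (\<forall>x\<in>K. g x \<noteq> (0::complex)) \<longrightarrow>
    (\<exists>h. continuous_on K h \<and> (\<forall>x\<in>K. g x = exp (h x))))"

text \<open>The subdivision is finer than the minimum of |G|. So the ratio of the values at
  consecutive times has distance less than 1 from 1, lies in the right half plane, and its principal
  logarithm can be added to the logarithm found so far.\<close>

lemma homotopy_log:
  fixes G :: "real \<times> 'b::metric_space \<Rightarrow> complex"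
  assumes "compact K" and G: "continuous_on ({0..1} \<times> K) G"
    and nz: "\<And>t x. t \<in> {0..1} \<Longrightarrow> x \<in> K \<Longrightarrow> G (t, x) \<noteq> 0"
    and h0: "continuous_on K h0" "\<And>x. x \<in> K \<Longrightarrow> G (0, x) = exp (h0 x)"
  obtains h where "continuous_on K h" "\<And>x. x \<in> K \<Longrightarrow> G (1, x) = exp (h x)"
proof (cases "K = {}")
  case True
  then show ?thesis using that[of "\<lambda>_. 0"] by auto
next
  case False
  have "compact ({0..1::real} \<times> K)" "{0..1::real} \<times> K \<noteq> {}"
    using False assms(1) by (auto intro: compact_Times)
  then obtain p where p: "p \<in> {0..1} \<times> K" "\<And>q. q \<in> {0..1} \<times> K \<Longrightarrow> norm (G p) \<le> norm (G q)"
    using continuous_attains_inf[OF _ _ continuous_on_norm[OF G]] by blast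
  have "norm (G p) > 0"
    using p(1) nz by (cases p) auto
  from uniform_steps[OF assms(1) G this] obtain N :: nat where N: "N > 0 \<and>
    (\<forall>j<N. \<forall>x\<in>K. dist (G (real (Suc j) / real N, x)) (G (real j / real N, x)) < norm (G p))" ..
  have "\<exists>h. continuous_on K h \<and> (\<forall>x\<in>K. G (real j / real N, x) = exp (h x))" if "j \<le> N" for j
    using that
  proof (induction j)
    case 0
    then show ?case using h0 by auto
  next
    case (Suc j)
    then obtain h where h: "continuous_on K h" "\<And>x. x \<in> K \<Longrightarrow> G (real j / real N, x) = exp (h x)"
      by auto
    let ?r = "\<lambda>x. G (real (Suc j) / real N, x) / G (real j / real N, x)"
    have mem: "real (Suc j) / real N \<in> {0..1}" "real j / real N \<in> {0..1}"
      using Suc.prems N by (auto simp: field_simps)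
    have cont: "continuous_on K (\<lambda>x. G (t, x))" if "t \<in> {0..1}" for t
      by (rule continuous_on_compose2[OF G]) (use that in \<open>auto intro!: continuous_intros\<close>)
    have half: "?r x \<notin> \<real>\<^sub>\<le>\<^sub>0" if "x \<in> K" for x
    proof -
      have nz': "G (real j / real N, x) \<noteq> 0" using nz mem that by blast
      have "norm (?r x - 1) = dist (G (real (Suc j) / real N, x)) (G (real j / real N, x)) / norm (G (real j / real N, x))"
        using nz' by (simp add: dist_norm norm_divide[symmetric] diff_divide_distrib)
      also have "\<dots> < 1"
      proof -
        have "dist (G (real (Suc j) / real N, x)) (G (real j / real N, x)) < norm (G p)"
          using conjunct2[OF N] Suc.prems that by (simp del: of_nat_Suc)
        also have "\<dots> \<le> norm (G (real j / real N, x))"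
          using p(2)[of "(real j / real N, x)"] that mem by auto
        finally show ?thesis using nz' by simp
      qed
      finally have "norm (?r x - 1) < 1" .
      moreover have "1 - Re (?r x) \<le> norm (?r x - 1)"
        using complex_Re_le_cmod[of "1 - ?r x"] by (simp add: norm_minus_commute)
      ultimately have "Re (?r x) > 0" by linarith
      then show ?thesis by (auto simp: complex_nonpos_Reals_iff)
    qed
    let ?h = "\<lambda>x. h x + Ln (?r x)"
    have "continuous_on K ?h"
      by (intro continuous_intros h cont mem) (use half nz mem in auto)
    moreover have "G (real (Suc j) / real N, x) = exp (?h x)" if "x \<in> K" for x
      using nz mem that h(2)[OF that] by (simp add: exp_add)
    ultimately show ?case by blast
  qed
  from this[of N] that N show ?thesis by auto
qed

text \<open>The difference is continuous with values in 2 pi i Z. Distinct values are at least 2 pi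
  apart, so it is constant on a connected set.\<close>

lemma exp_eq_imp_diff_const:
  fixes f g :: "'b::topological_space \<Rightarrow> complex"
  assumes S: "connected S" and fg: "continuous_on S f" "continuous_on S g"
    and eq: "\<And>x. x \<in> S \<Longrightarrow> exp (f x) = exp (g x)"
  obtains c where "exp c = 1" "\<And>x. x \<in> S \<Longrightarrow> f x = g x + c"
proof (cases "S = {}")
  case True
  then show ?thesis using that[of 0] by auto
next
  case False
  have ex: "\<exists>k::int. f x - g x = complex_of_real (2 * real_of_int k * pi) * \<i>" if "x \<in> S" for x
  proof -
    obtain k :: int where k: "f x = g x + complex_of_real (real_of_int (2 * k) * pi) * \<i>"
      using eq[OF \<open>x \<in> S\<close>] unfolding exp_eq by blast
    from k show ?thesis by (intro exI[of _ k]) simp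
  qed
  have "(\<lambda>x. f x - g x) constant_on S"
  proof (rule continuous_discrete_range_constant[OF S])
    show "continuous_on S (\<lambda>x. f x - g x)" by (intro continuous_intros fg)
    fix x assume x: "x \<in> S"
    obtain k where k: "f x - g x = complex_of_real (2 * real_of_int k * pi) * \<i>" using ex[OF x] by blast
    have "2 * pi \<le> norm ((f y - g y) - (f x - g x))" if y: "y \<in> S" "f y - g y \<noteq> f x - g x" for y
    proof -
      obtain l where l: "f y - g y = complex_of_real (2 * real_of_int l * pi) * \<i>" using ex[OF y(1)] by blast
      have "l \<noteq> k" using k l y(2) by auto
      then have *: "1 \<le> \<bar>real_of_int (l - k)\<bar>" by linarith
      have "(f y - g y) - (f x - g x) = complex_of_real (2 * pi * real_of_int (l - k)) * \<i>"
        unfolding k l by (simp add: algebra_simps)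
      then have "norm ((f y - g y) - (f x - g x)) = 2 * pi * \<bar>real_of_int (l - k)\<bar>"
        by (simp only: norm_mult norm_of_real norm_ii abs_mult) simp
      with * show ?thesis by simp
    qed
    then show "\<exists>e>0. \<forall>y. y \<in> S \<and> f y - g y \<noteq> f x - g x \<longrightarrow> e \<le> norm (f y - g y - (f x - g x))"
      by (intro exI[of _ "2 * pi"]) auto
  qed
  then obtain c where c: "\<And>x. x \<in> S \<Longrightarrow> f x - g x = c"
    unfolding constant_on_def by blast
  obtain x where x: "x \<in> S" using False by blast
  have "exp c = exp (f x) / exp (g x)" using c[OF x] by (metis exp_diff)
  then have "exp c = 1" using eq[OF x] by simp
  then show ?thesis using that c by (metis add.commute diff_add_cancel)
qed

text \<open>A Mayer-Vietoris argument in degree one: the two logarithms differ by one constant on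
  the connected intersection, and adding it on L makes them match without changing the
  exponential.\<close>

lemma loggable_Un:
  fixes K L :: "'b::metric_space set"
  assumes K: "loggable K" "closed K" and L: "loggable L" "closed L" and conn: "connected (K \<inter> L)"
  shows "loggable (K \<union> L)"
  unfolding loggable_def
proof (intro allI impI, elim conjE)
  fix g :: "'b \<Rightarrow> complex"
  assume g: "continuous_on (K \<union> L) g" and nz: "\<forall>x\<in>K \<union> L. g x \<noteq> 0"
  obtain h where h: "continuous_on K h" "\<And>x. x \<in> K \<Longrightarrow> g x = exp (h x)"
    using K(1) g nz unfolding loggable_def by (metis Un_iff continuous_on_subset sup_ge1)
  obtain k where k: "continuous_on L k" "\<And>x. x \<in> L \<Longrightarrow> g x = exp (k x)"
    using L(1) g nz unfolding loggable_def by (metis Un_iff continuous_on_subset sup_ge2)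
  obtain c where c: "exp c = 1" "\<And>x. x \<in> K \<inter> L \<Longrightarrow> h x = k x + c"
  proof (rule exp_eq_imp_diff_const[OF conn, of h k])
    show "continuous_on (K \<inter> L) h" "continuous_on (K \<inter> L) k"
      using h k by (auto intro: continuous_on_subset)
  next
    show "exp (h x) = exp (k x)" if "x \<in> K \<inter> L" for x
      using h(2)[of x] k(2)[of x] that by simp
  qed blast
  let ?u = "\<lambda>x. if x \<in> K then h x else k x + c"
  have "continuous_on (K \<union> L) ?u"
    by (rule continuous_on_cases) (use c h k K L in \<open>auto intro!: continuous_intros\<close>)
  moreover have "\<forall>x\<in>K \<union> L. g x = exp (?u x)"
    using h k c by (auto simp: exp_add)
  ultimately show "\<exists>u. continuous_on (K \<union> L) u \<and> (\<forall>x\<in>K \<union> L. g x = exp (u x))" by blast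
qed

text \<open>The homotopy runs from the constant map to the identity, because logarithms and lifts
  are known for constants and are then transported to time 1. The membership of a is conditional
  because the empty space counts as contractible.\<close>

lemma contractible_setE:
  fixes K :: "'b::topological_space set"
  assumes "contractible_space (top_of_set K)"
  obtains H a where "continuous_on ({0..1::real} \<times> K) H" "H ` ({0..1} \<times> K) \<subseteq> K"
    "\<And>x. x \<in> K \<Longrightarrow> H (0, x) = a" "\<And>x. x \<in> K \<Longrightarrow> H (1, x) = x" "K \<noteq> {} \<Longrightarrow> a \<in> K"
proof -
  obtain a where a: "homotopic_with (\<lambda>x. True) (top_of_set K) (top_of_set K) id (\<lambda>x. a)"
    using assms unfolding contractible_space_def by blast
  then have "homotopic_with (\<lambda>x. True) (top_of_set K) (top_of_set K) (\<lambda>x. a) id"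
    by (rule homotopic_with_symD)
  then obtain H where H: "continuous_map (prod_topology (top_of_set {0..1::real}) (top_of_set K)) (top_of_set K) H"
    "\<And>x. H (0, x) = a" "\<And>x. H (1, x) = x"
    unfolding homotopic_with_def by auto
  have "prod_topology (top_of_set {0..1::real}) (top_of_set K) = top_of_set ({0..1} \<times> K)"
    by (simp add: subtopology_Times[symmetric] euclidean_product_topology del: subtopology_Times)
  with H(1) have "continuous_on ({0..1} \<times> K) H \<and> H ` ({0..1} \<times> K) \<subseteq> K"
    by (simp add: image_subset_iff_funcset)
  with H show thesis
    by (intro that[of H a]) (force simp: image_subset_iff)+
qed

lemma contractible_setI:
  fixes K :: "'b::topological_space set"
  assumes "continuous_on ({0..1::real} \<times> K) H" "H ` ({0..1} \<times> K) \<subseteq> K"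
    "\<And>x. x \<in> K \<Longrightarrow> H (0, x) = x" "\<And>x. x \<in> K \<Longrightarrow> H (1, x) = a"
  shows "contractible_space (top_of_set K)"
proof -
  have "homotopic_with_canon (\<lambda>x. True) K K id (\<lambda>x. a)"
    using assms by (subst homotopic_with) (auto intro!: exI[of _ H])
  then show ?thesis unfolding contractible_space_def by blast
qed

text \<open>Composed with the contraction, g starts at the constant g a, which has the logarithm
  \<open>Ln (g a)\<close>, and ends at g itself.\<close>

lemma loggable_contractible:
  assumes "compact K" "contractible_space (top_of_set K)"
  shows "loggable K"
  unfolding loggable_def
proof (intro allI impI, elim conjE)
  fix g :: "'a \<Rightarrow> complex"
  assume g: "continuous_on K g" and nz: "\<forall>x\<in>K. g x \<noteq> 0"
  obtain H a where H: "continuous_on ({0..1::real} \<times> K) H" "H ` ({0..1} \<times> K) \<subseteq> K"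
    "\<And>x. x \<in> K \<Longrightarrow> H (0, x) = a" "\<And>x. x \<in> K \<Longrightarrow> H (1, x) = x" "K \<noteq> {} \<Longrightarrow> a \<in> K"
    using contractible_setE[OF assms(2)] by metis
  obtain h where "continuous_on K h" "\<And>x. x \<in> K \<Longrightarrow> (g \<circ> H) (1, x) = exp (h x)"
  proof (rule homotopy_log[OF assms(1), of "g \<circ> H" "\<lambda>_. Ln (g a)"])
    show "continuous_on ({0..1} \<times> K) (g \<circ> H)"
      using H(1,2) g by (meson continuous_on_compose continuous_on_subset)
    show "(g \<circ> H) (t, x) \<noteq> 0" if "t \<in> {0..1}" "x \<in> K" for t x
      using H(2) nz that by (auto simp: image_subset_iff)
    show "(g \<circ> H) (0, x) = exp (Ln (g a))" if "x \<in> K" for x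
    proof -
      have "g a \<noteq> 0" using H(5) nz that by blast
      then show ?thesis using H(3)[OF that] by simp
    qed
  qed auto
  with H(4) show "\<exists>h. continuous_on K h \<and> (\<forall>x\<in>K. g x = exp (h x))" by auto
qed

section \<open>Lines in complex space and the orthogonal projections onto them\<close>

definition pset :: "nat \<Rightarrow> (nat \<Rightarrow> complex) set"
  where "pset n = {z. (\<forall>i>n. z i = 0) \<and> z \<noteq> (\<lambda>_. 0)}"

lemma punctured_complex_space_eq: "punctured_complex_space n = top_of_set (pset n)"
  by (simp add: punctured_complex_space_def pset_def euclidean_product_topology)

lemma topspace_CP: "topspace (complex_projective_space n) = projective_class ` pset n"
  by (simp add: topspace_complex_projective_space punctured_complex_space_eq)

lemma quotient_map_CP: "quotient_map (top_of_set (pset n)) (complex_projective_space n) projective_class"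
  using quotient_map_projective_class[of n] by (simp add: punctured_complex_space_eq)

lemma continuous_map_projective_class:
  "continuous_map (top_of_set (pset n)) (complex_projective_space n) projective_class"
  by (rule quotient_imp_continuous_map[OF quotient_map_CP])

lemma projective_class_scale:
  assumes "c \<noteq> 0" shows "projective_class (\<lambda>i. c * z i) = projective_class z"
proof -
  have "\<exists>d. d \<noteq> 0 \<and> (\<lambda>i. e * z i) = (\<lambda>i. d * (c * z i))" if "e \<noteq> 0" for e
    using that assms by (intro exI[of _ "e / c"]) auto
  moreover have "\<exists>d. d \<noteq> 0 \<and> (\<lambda>i. e * (c * z i)) = (\<lambda>i. d * z i)" if "e \<noteq> 0" for e
    using that assms by (intro exI[of _ "e * c"]) (auto simp: mult.assoc)
  ultimately show ?thesis unfolding projective_class_def by fastforce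
qed

lemma projective_class_self: "z \<in> projective_class z"
  unfolding projective_class_def by (auto intro!: exI[of _ 1])

lemma projective_class_eqD:
  assumes "projective_class z = projective_class w"
  obtains c where "c \<noteq> 0" "z = (\<lambda>i. c * w i)"
proof -
  have "z \<in> projective_class w" using assms projective_class_self by blast
  then show thesis using that unfolding projective_class_def by auto
qed

lemma pset_scale: "z \<in> pset n \<Longrightarrow> c \<noteq> 0 \<Longrightarrow> (\<lambda>i. c * z i) \<in> pset n"
  unfolding pset_def by (auto simp: fun_eq_iff)

definition nrm2 :: "nat \<Rightarrow> (nat \<Rightarrow> complex) \<Rightarrow> real"
  where "nrm2 n z = (\<Sum>k\<le>n. (cmod (z k))\<^sup>2)"

definition cip :: "nat \<Rightarrow> (nat \<Rightarrow> complex) \<Rightarrow> (nat \<Rightarrow> complex) \<Rightarrow> complex"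
  where "cip n v u = (\<Sum>k\<le>n. v k * cnj (u k))"

lemma nrm2_pos: assumes "z \<in> pset n" shows "nrm2 n z > 0"
proof -
  obtain i where i: "z i \<noteq> 0" using assms by (auto simp: pset_def fun_eq_iff)
  then have "i \<le> n" using assms by (metis (mono_tags, lifting) linorder_not_less mem_Collect_eq pset_def)
  then show ?thesis unfolding nrm2_def using i by (intro sum_pos2[of _ i]) auto
qed

lemma cip_self: "cip n z z = of_real (nrm2 n z)"
  unfolding cip_def nrm2_def of_real_sum by (intro sum.cong refl) (simp only: complex_norm_square)

lemma nrm2_scale: "nrm2 n (\<lambda>i. c * z i) = (cmod c)\<^sup>2 * nrm2 n z"
  unfolding nrm2_def by (simp add: norm_mult power_mult_distrib sum_distrib_left)

lemma cip_scale_left: "cip n (\<lambda>i. c * z i) w = c * cip n z w"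
  unfolding cip_def by (simp add: sum_distrib_left mult.assoc)

lemma continuous_on_nrm2 [continuous_intros]:
  assumes "continuous_on S f" shows "continuous_on S (\<lambda>x. nrm2 n (f x))"
  unfolding nrm2_def by (intro continuous_intros continuous_on_product_then_coordinatewise[OF assms])

lemma continuous_on_cip [continuous_intros]:
  assumes "continuous_on S f" "continuous_on S g" shows "continuous_on S (\<lambda>x. cip n (f x) (g x))"
  unfolding cip_def
  by (intro continuous_intros continuous_on_product_then_coordinatewise[OF assms(1)] continuous_on_product_then_coordinatewise[OF assms(2)])

text \<open>An entry of the matrix of the orthogonal projection onto the line L. It is invariant
  under scaling of the representative, so the choice is harmless and gives continuous functions on
  the whole projective space.\<close>

definition proj_entry :: "nat \<Rightarrow> nat \<Rightarrow> nat \<Rightarrow> (nat \<Rightarrow> complex) set \<Rightarrow> complex"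
  where "proj_entry n i j L =
    (let z = (SOME z. z \<in> L) in z i * cnj (z j) / of_real (nrm2 n z))"

lemma proj_entry_class:
  "proj_entry n i j (projective_class z) = z i * cnj (z j) / of_real (nrm2 n z)"
proof -
  define w where "w = (SOME w. w \<in> projective_class z)"
  have "w \<in> projective_class z"
    unfolding w_def by (rule someI[of _ z]) (rule projective_class_self)
  then obtain c where c: "c \<noteq> 0" "w = (\<lambda>i. c * z i)"
    unfolding projective_class_def by auto
  have "w i * cnj (w j) / of_real (nrm2 n w)
      = (c * cnj c) * (z i * cnj (z j)) / ((c * cnj c) * of_real (nrm2 n z))"
    unfolding c(2) nrm2_scale of_real_mult complex_norm_square by (simp add: mult_ac)
  also have "\<dots> = z i * cnj (z j) / of_real (nrm2 n z)"
    using c(1) by (subst mult_divide_mult_cancel_left) auto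
  finally show ?thesis unfolding proj_entry_def w_def[symmetric] by (simp add: Let_def)
qed

lemma continuous_map_proj_entry:
  "continuous_map (complex_projective_space n) euclidean (proj_entry n i j)"
proof -
  have "continuous_on (pset n) (\<lambda>z. z i * cnj (z j) / of_real (nrm2 n z))"
    by (intro continuous_intros continuous_on_product_then_coordinatewise[OF continuous_on_id]) (use nrm2_pos in fastforce)
  then have "continuous_map (top_of_set (pset n)) euclidean (proj_entry n i j \<circ> projective_class)"
    by (simp add: comp_def proj_entry_class)
  then show ?thesis
    using continuous_compose_quotient_map quotient_map_CP by blast
qed

definition proj_act :: "nat \<Rightarrow> (nat \<Rightarrow> complex) set \<Rightarrow> (nat \<Rightarrow> complex) \<Rightarrow> nat \<Rightarrow> complex"
  where "proj_act n L v = (\<lambda>i. \<Sum>j\<le>n. proj_entry n i j L * v j)"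

text \<open>The trace of the product of the projections onto L and M, which is the squared cosine of
  the angle between the lines: 1 for equal lines and 0 exactly for orthogonal ones.\<close>

definition overlap :: "nat \<Rightarrow> (nat \<Rightarrow> complex) set \<Rightarrow> (nat \<Rightarrow> complex) set \<Rightarrow> complex"
  where "overlap n L M = (\<Sum>i\<le>n. \<Sum>j\<le>n. proj_entry n i j L * proj_entry n j i M)"

lemma proj_act_class:
  "proj_act n (projective_class u) v = (\<lambda>i. (cip n v u / of_real (nrm2 n u)) * u i)"
  unfolding proj_act_def proj_entry_class cip_def
  by (simp add: sum_distrib_left sum_distrib_right sum_divide_distrib fun_eq_iff mult_ac)

lemma overlap_class:
  "overlap n (projective_class u) (projective_class v)
    = cip n v u * cip n u v / of_real (nrm2 n u * nrm2 n v)"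
proof -
  have "overlap n (projective_class u) (projective_class v)
      = (\<Sum>i\<le>n. \<Sum>j\<le>n. (u i * cnj (v i)) * (v j * cnj (u j)) / of_real (nrm2 n u * nrm2 n v))"
    unfolding overlap_def proj_entry_class by (intro sum.cong refl) (simp add: field_simps)
  also have "\<dots> = (\<Sum>i\<le>n. u i * cnj (v i)) * (\<Sum>j\<le>n. v j * cnj (u j)) / of_real (nrm2 n u * nrm2 n v)"
    by (simp add: sum_product sum_divide_distrib)
  finally show ?thesis unfolding cip_def by (simp add: mult.commute)
qed

lemma overlap_self: "u \<in> pset n \<Longrightarrow> overlap n (projective_class u) (projective_class u) = 1"
  using nrm2_pos[of u n] by (simp add: overlap_class cip_self)

text \<open>Projecting a lift along a path onto the line at the next of finitely many close times
  keeps it nonzero, because nearby lines are not orthogonal.\<close>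

lemma homotopy_lift:
  fixes H :: "real \<times> 'b::metric_space \<Rightarrow> (nat \<Rightarrow> complex) set"
  assumes K: "compact K"
    and H: "continuous_map (top_of_set ({0..1} \<times> K)) (complex_projective_space n) H"
    and s0: "continuous_on K s0" "s0 ` K \<subseteq> pset n" "\<And>x. x \<in> K \<Longrightarrow> projective_class (s0 x) = H (0, x)"
  obtains s where "continuous_on K s" "s ` K \<subseteq> pset n"
    "\<And>x. x \<in> K \<Longrightarrow> projective_class (s x) = H (1, x)"
proof -
  have entry: "continuous_on ({0..1} \<times> K) (\<lambda>p. proj_entry n i j (H p))" for i j
    using continuous_map_compose[OF H continuous_map_proj_entry[of n i j]] by (simp add: comp_def)
  have entry2: "continuous_on S (\<lambda>p. proj_entry n i j (H (a p, b p)))"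
    if "continuous_on S a" "continuous_on S b" "\<And>p. p \<in> S \<Longrightarrow> a p \<in> {0..1} \<and> b p \<in> K"
    for i j and S :: "'x::topological_space set" and a b
    by (rule continuous_on_compose2[OF entry]) (use that in \<open>auto intro!: continuous_intros\<close>)
  have Hin: "\<exists>u\<in>pset n. H (t, x) = projective_class u" if "t \<in> {0..1}" "x \<in> K" for t x
    using continuous_map_image_subset_topspace[OF H] that by (fastforce simp: topspace_CP)
  \<comment> \<open>The second time u belongs to the compact parameter space, so
    \<open>uniform_steps\<close> varies only the first time. Since the overlap is 1 when both times
    agree, a change by less than 1 keeps it nonzero.\<close>
  let ?G = "\<lambda>(t, u, x). overlap n (H (t, x)) (H (u, x))"
  have G: "continuous_on ({0..1} \<times> ({0..1} \<times> K)) ?G"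
    unfolding overlap_def split_beta
    by (intro continuous_intros entry2) auto
  have cK: "compact ({0..1::real} \<times> K)" using K by (intro compact_Times) auto
  have one: "0 < (1::real)" by simp
  obtain N :: nat where N: "N > 0 \<and> (\<forall>j<N. \<forall>y\<in>{0..1} \<times> K.
      dist (?G (real (Suc j) / real N, y)) (?G (real j / real N, y)) < 1)"
    using uniform_steps[OF cK G one] ..
  have "\<exists>s. continuous_on K s \<and> s ` K \<subseteq> pset n \<and> (\<forall>x\<in>K. projective_class (s x) = H (real j / real N, x))"
    if "j \<le> N" for j
    using that
  proof (induction j)
    case 0
    then show ?case using s0 by auto
  next
    case (Suc j)
    then obtain s where s: "continuous_on K s" "s ` K \<subseteq> pset n"
      "\<And>x. x \<in> K \<Longrightarrow> projective_class (s x) = H (real j / real N, x)"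
      by auto
    let ?t = "real (Suc j) / real N"
    have mem: "?t \<in> {0..1}" "real j / real N \<in> {0..1}"
      using Suc.prems N by (auto simp: field_simps)
    let ?s = "\<lambda>x. proj_act n (H (?t, x)) (s x)"
    have e: "continuous_on K (\<lambda>x. proj_entry n i j (H (?t, x)))" for i j
      by (rule entry2) (use mem(1) in \<open>auto intro!: continuous_intros\<close>)
    have "continuous_on K ?s"
      unfolding proj_act_def
      by (rule continuous_on_coordinatewise_then_product)
        (intro continuous_on_sum continuous_on_mult e continuous_on_product_then_coordinatewise[OF s(1)])
    moreover have "?s x \<in> pset n \<and> projective_class (?s x) = H (?t, x)" if x: "x \<in> K" for x
    proof -
      obtain u where u: "u \<in> pset n" "H (?t, x) = projective_class u" using Hin mem x by blast
      have sx: "s x \<in> pset n" using s x by auto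
      have "dist (?G (?t, real j / real N, x)) (?G (real j / real N, real j / real N, x)) < 1"
        using N Suc.prems mem x by auto
      then have "dist (overlap n (projective_class u) (projective_class (s x))) 1 < 1"
        using s(3)[OF x] u(2) overlap_self[OF sx] by simp
      then have "overlap n (projective_class u) (projective_class (s x)) \<noteq> 0" by auto
      then have "cip n (s x) u \<noteq> 0" unfolding overlap_class by auto
      then have "cip n (s x) u / of_real (nrm2 n u) \<noteq> 0" using nrm2_pos[OF u(1)] by simp
      then show ?thesis
        unfolding u(2) proj_act_class using u(1) pset_scale projective_class_scale by blast
    qed
    ultimately show ?case by blast
  qed
  from this[of N] that N show thesis by auto
qed

text \<open>The analogue of \<open>loggable\<close> one degree higher: the pullback of the
  tautological line bundle along any map to the projective space has a nowhere zero section.\<close>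

definition liftable :: "nat \<Rightarrow> 'b::metric_space set \<Rightarrow> bool"
  where "liftable n K \<longleftrightarrow> (\<forall>F. continuous_map (top_of_set K) (complex_projective_space n) F \<longrightarrow>
    (\<exists>s. continuous_on K s \<and> s ` K \<subseteq> pset n \<and> (\<forall>x\<in>K. projective_class (s x) = F x)))"

lemma liftable_contractible:
  assumes "compact K" "contractible_space (top_of_set K)"
  shows "liftable n K"
  unfolding liftable_def
proof (intro allI impI)
  fix F :: "'a \<Rightarrow> (nat \<Rightarrow> complex) set"
  assume F: "continuous_map (top_of_set K) (complex_projective_space n) F"
  obtain H a where H: "continuous_on ({0..1::real} \<times> K) H" "H ` ({0..1} \<times> K) \<subseteq> K"
    "\<And>x. x \<in> K \<Longrightarrow> H (0, x) = a" "\<And>x. x \<in> K \<Longrightarrow> H (1, x) = x" "K \<noteq> {} \<Longrightarrow> a \<in> K"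
    using contractible_setE[OF assms(2)] by metis
  show "\<exists>s. continuous_on K s \<and> s ` K \<subseteq> pset n \<and> (\<forall>x\<in>K. projective_class (s x) = F x)"
  proof (cases "K = {}")
    case False
    then have "F a \<in> projective_class ` pset n"
      using continuous_map_image_subset_topspace[OF F] H(5) by (auto simp: topspace_CP)
    then obtain u where u: "u \<in> pset n" "F a = projective_class u" by auto
    obtain s where "continuous_on K s" "s ` K \<subseteq> pset n"
      "\<And>x. x \<in> K \<Longrightarrow> projective_class (s x) = (F \<circ> H) (1, x)"
    proof (rule homotopy_lift[OF assms(1), of n "F \<circ> H" "\<lambda>_. u"])
      show "continuous_map (top_of_set ({0..1} \<times> K)) (complex_projective_space n) (F \<circ> H)"
      proof (rule continuous_map_compose[OF _ F])
        show "continuous_map (top_of_set ({0..1} \<times> K)) (top_of_set K) H"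
          using H(1,2) by (simp add: image_subset_iff_funcset)
      qed
    qed (use u H in auto)
    with H(4) show ?thesis by auto
  qed auto
qed

text \<open>The factor between proportional vectors is the quotient of \<open>cip\<close> by
  \<open>nrm2\<close>, which visibly depends continuously on the point. It is written as an
  exponential so that it can later be extended or averaged.\<close>

lemma lifts_differ:
  fixes a b :: "'b::metric_space \<Rightarrow> nat \<Rightarrow> complex"
  assumes K: "loggable K" and a: "continuous_on K a" "a ` K \<subseteq> pset n" and b: "continuous_on K b"
    and eq: "\<And>x. x \<in> K \<Longrightarrow> projective_class (b x) = projective_class (a x)"
  obtains h where "continuous_on K h" "\<And>x. x \<in> K \<Longrightarrow> b x = (\<lambda>i. exp (h x) * a x i)"
proof -
  let ?g = "\<lambda>x. cip n (b x) (a x) / of_real (nrm2 n (a x))"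
  have nz: "nrm2 n (a x) \<noteq> 0" if "x \<in> K" for x
    using a(2) that nrm2_pos[of "a x" n] by auto
  have g: "?g x \<noteq> 0 \<and> b x = (\<lambda>i. ?g x * a x i)" if x: "x \<in> K" for x
  proof -
    obtain c where c: "c \<noteq> 0" "b x = (\<lambda>i. c * a x i)" using projective_class_eqD[OF eq[OF x]] by blast
    then have "?g x = c" using nz[OF x] by (simp add: cip_scale_left cip_self)
    with c show ?thesis by simp
  qed
  have "continuous_on K ?g"
    by (intro continuous_on_divide continuous_on_cip continuous_on_of_real continuous_on_nrm2 a b)
      (use nz in auto)
  then obtain h where "continuous_on K h" "\<And>x. x \<in> K \<Longrightarrow> ?g x = exp (h x)"
    using K g unfolding loggable_def by blast
  then show thesis using that g by metis
qed

text \<open>A Mayer-Vietoris argument in degree two. On the intersection the lifts differ by exp h.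
  The function h, unlike a nonvanishing factor, always extends to L by Tietze, and dividing the
  second lift by the exponential of the extension makes the two agree.\<close>

lemma liftable_Un:
  fixes K L :: "'b::{metric_space,second_countable_topology} set"
  assumes K: "liftable n K" "closed K" and L: "liftable n L" "closed L" and KL: "loggable (K \<inter> L)"
  shows "liftable n (K \<union> L)"
  unfolding liftable_def
proof (intro allI impI)
  fix F :: "'b \<Rightarrow> (nat \<Rightarrow> complex) set"
  assume F: "continuous_map (top_of_set (K \<union> L)) (complex_projective_space n) F"
  have "continuous_map (top_of_set K) (complex_projective_space n) F"
    "continuous_map (top_of_set L) (complex_projective_space n) F"
    using F by (auto intro: continuous_map_from_subtopology_mono)
  then obtain s t where s: "continuous_on K s" "s ` K \<subseteq> pset n" "\<And>x. x \<in> K \<Longrightarrow> projective_class (s x) = F x"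
    and t: "continuous_on L t" "t ` L \<subseteq> pset n" "\<And>x. x \<in> L \<Longrightarrow> projective_class (t x) = F x"
    using K(1) L(1) unfolding liftable_def by metis
  have sc: "continuous_on (K \<inter> L) s" "continuous_on (K \<inter> L) t" "s ` (K \<inter> L) \<subseteq> pset n"
    using s t by (auto intro: continuous_on_subset)
  obtain h where h: "continuous_on (K \<inter> L) h" "\<And>x. x \<in> K \<inter> L \<Longrightarrow> t x = (\<lambda>i. exp (h x) * s x i)"
    by (rule lifts_differ[OF KL sc(1,3,2)]) (use s t in auto)
  have "closedin (top_of_set L) (K \<inter> L)"
    using K(2) L(2) by (simp add: closed_Int closed_subset)
  then obtain k where k: "continuous_on L k" "\<And>x. x \<in> K \<inter> L \<Longrightarrow> k x = h x"
    using Tietze_unbounded[OF h(1)] by blast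
  let ?u = "\<lambda>x. if x \<in> K then s x else (\<lambda>i. exp (- k x) * t x i)"
  have kt: "continuous_on L (\<lambda>x i. exp (- k x) * t x i)"
    by (intro continuous_on_coordinatewise_then_product continuous_intros k continuous_on_product_then_coordinatewise[OF t(1)])
  have agree: "s x = (\<lambda>i. exp (- k x) * t x i)" if x: "x \<in> K \<inter> L" for x
  proof -
    have "t x = (\<lambda>i. exp (k x) * s x i)" using h(2)[OF x] k(2)[OF x] by simp
    then show ?thesis by (simp add: exp_minus mult.assoc[symmetric])
  qed
  have "continuous_on (K \<union> L) ?u"
    by (rule continuous_on_cases) (use K L s kt agree in auto)
  moreover have "?u ` (K \<union> L) \<subseteq> pset n"
    using s t by (auto intro!: pset_scale)
  moreover have "\<forall>x\<in>K \<union> L. projective_class (?u x) = F x"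
    using s t by (auto simp: projective_class_scale)
  ultimately show "\<exists>u. continuous_on (K \<union> L) u \<and> u ` (K \<union> L) \<subseteq> pset n \<and>
      (\<forall>x\<in>K \<union> L. projective_class (u x) = F x)" by blast
qed

subsection \<open>The unit sphere\<close>

definition csphere :: "nat \<Rightarrow> (nat \<Rightarrow> complex) set"
  where "csphere n = {z. (\<forall>i>n. z i = 0) \<and> nrm2 n z = 1}"

lemma csphere_subset_pset: "csphere n \<subseteq> pset n"
  unfolding csphere_def pset_def nrm2_def by auto

lemma closed_coordinate: "closed A \<Longrightarrow> closed {z :: nat \<Rightarrow> complex. z i \<in> A}"
  using continuous_closed_preimage[OF continuous_on_product_then_coordinatewise[OF continuous_on_id, of UNIV i], of A]
  by (simp add: vimage_def)

lemma closed_csphere: "closed (csphere n)"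
proof -
  have "closed (\<Inter>i\<in>{n<..}. {z :: nat \<Rightarrow> complex. z i \<in> {0}})"
    by (intro closed_INT ballI closed_coordinate closed_singleton)
  moreover have "closed {z :: nat \<Rightarrow> complex. nrm2 n z = 1}"
    by (intro closed_Collect_eq continuous_on_nrm2 continuous_on_id continuous_on_const)
  moreover have "csphere n = (\<Inter>i\<in>{n<..}. {z. z i \<in> {0}}) \<inter> {z. nrm2 n z = 1}"
    unfolding csphere_def by auto
  ultimately show ?thesis by (simp only: closed_Int)
qed

text \<open>The ambient space is an infinite product, where boundedness and closedness do not imply
  compactness. The sphere is closed in a product of unit discs, which is compact by
  Tychonoff.\<close>

lemma compact_csphere: "compact (csphere n)"
proof -
  have "csphere n \<subseteq> PiE UNIV (\<lambda>_. cball 0 1)"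
  proof (intro subsetI PiE_I)
    fix z i assume z: "z \<in> csphere n"
    show "z i \<in> cball 0 1"
    proof (cases "i \<le> n")
      case True
      then have "(cmod (z i))\<^sup>2 \<le> nrm2 n z"
        unfolding nrm2_def by (intro member_le_sum) auto
      also have "\<dots> = 1" using z by (simp add: csphere_def)
      finally have "cmod (z i) \<le> 1" by (simp add: power2_le_imp_le abs_square_le_1)
      then show ?thesis by simp
    qed (use z in \<open>simp add: csphere_def\<close>)
  qed auto
  moreover have "compact (PiE UNIV (\<lambda>_. cball 0 1) :: (nat \<Rightarrow> complex) set)"
    using compactin_PiE[of "\<lambda>_. euclidean :: complex topology" UNIV "\<lambda>_. cball 0 1"]
    by (simp add: euclidean_product_topology)
  ultimately show ?thesis
    using closed_csphere by (metis compact_Int_closed inf.absorb_iff2)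
qed

definition nrmlz :: "nat \<Rightarrow> (nat \<Rightarrow> complex) \<Rightarrow> nat \<Rightarrow> complex"
  where "nrmlz n z = (\<lambda>i. of_real (1 / sqrt (nrm2 n z)) * z i)"

lemma nrmlz_in_csphere:
  assumes "z \<in> pset n" shows "nrmlz n z \<in> csphere n"
proof -
  have "nrm2 n (nrmlz n z) = (1 / sqrt (nrm2 n z))\<^sup>2 * nrm2 n z"
    unfolding nrmlz_def nrm2_scale norm_of_real power2_abs ..
  then show ?thesis
    using nrm2_pos[OF assms] assms by (simp add: csphere_def power_divide nrmlz_def pset_def)
qed

lemma nrmlz_csphere: "z \<in> csphere n \<Longrightarrow> nrmlz n z = z"
  by (simp add: nrmlz_def csphere_def)

lemma projective_class_nrmlz: "z \<in> pset n \<Longrightarrow> projective_class (nrmlz n z) = projective_class z"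
  unfolding nrmlz_def using nrm2_pos[of z n] by (intro projective_class_scale) simp

lemma continuous_on_nrmlz:
  assumes f: "continuous_on S f" and "f ` S \<subseteq> pset n"
  shows "continuous_on S (\<lambda>x. nrmlz n (f x))"
proof -
  have "nrm2 n (f x) \<noteq> 0" if "x \<in> S" for x
    using nrm2_pos assms(2) that by (metis image_subset_iff less_irrefl)
  then show ?thesis
    unfolding nrmlz_def
    by (intro continuous_on_coordinatewise_then_product continuous_on_mult continuous_on_of_real
        continuous_on_divide continuous_on_real_sqrt continuous_on_const continuous_on_nrm2 f
        continuous_on_product_then_coordinatewise[OF f]) auto
qed

text \<open>The contraction is along normalized segments to the pole \<open>c\<close>.\<close>

lemma contractible_cap:
  assumes add: "\<And>u v. u \<in> C \<Longrightarrow> v \<in> C \<Longrightarrow> u + v \<in> C"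
    and scale: "\<And>r u. 0 \<le> r \<Longrightarrow> u \<in> C \<Longrightarrow> of_real r * u \<in> C"
    and c: "c \<in> C" "- c \<notin> C" "cmod c = 1"
  shows "contractible_space (top_of_set {z \<in> csphere n. z n \<in> C})" (is "contractible_space (top_of_set ?K)")
proof -
  let ?w = "\<lambda>(t, z) i. of_real (1 - t) * z i + of_real t * (if i = n then c else 0)"
  have w: "?w (t, z) \<in> pset n" if t: "t \<in> {0..1}" and z: "z \<in> ?K" for t z
  proof -
    have "?w (t, z) \<noteq> (\<lambda>_. 0)"
    proof
      assume eq: "?w (t, z) = (\<lambda>_. 0)"
      show False
      proof (cases "t = 0")
        case True
        then have "z = (\<lambda>_. 0)" using eq by simp
        then show False using z csphere_subset_pset by (auto simp: pset_def)
      next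
        case False
        \<comment> \<open>If the segment from z to the pole met the origin, the last coordinate
          would exhibit -c as a nonnegative multiple of z n, hence as an element of the cone
          C.\<close>
        have "of_real (1 - t) * z n + of_real t * c = 0" using fun_cong[OF eq, of n] by simp
        then have "of_real t * - c = of_real (1 - t) * z n"
          by (metis add.commute add_eq_0_iff mult_minus_right)
        then have "- c = of_real ((1 - t) / t) * z n" using False by (simp add: field_simps)
        then show False using scale[of "(1 - t) / t" "z n"] t z c(2) by simp
      qed
    qed
    then show ?thesis using z by (auto simp: pset_def csphere_def)
  qed
  show ?thesis
  proof (rule contractible_setI[where a = "\<lambda>i. if i = n then c else 0"])
    have "continuous_on ({0..1} \<times> ?K) ?w"
    proof (rule continuous_on_coordinatewise_then_product)
      fix i
      have "continuous_on ({0..1::real} \<times> ?K) (\<lambda>p. snd p i)"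
        by (rule continuous_on_product_then_coordinatewise[OF continuous_on_snd[OF continuous_on_id]])
      then show "continuous_on ({0..1} \<times> ?K) (\<lambda>p. ?w p i)"
        unfolding split_beta by (intro continuous_intros)
    qed
    then show "continuous_on ({0..1} \<times> ?K) (\<lambda>p. nrmlz n (?w p))"
      by (rule continuous_on_nrmlz) (use w in auto)
    show "(\<lambda>p. nrmlz n (?w p)) ` ({0..1} \<times> ?K) \<subseteq> ?K"
    proof (rule image_subsetI)
      fix p assume "p \<in> {0..1::real} \<times> ?K"
      then obtain t z where p: "p = (t, z)" and t: "t \<in> {0..1}" and z: "z \<in> ?K" by blast
      then have wp: "?w (t, z) \<in> pset n" using w by blast
      have "?w (t, z) n \<in> C"
        using t z c by (simp del: of_real_diff add: scale add)
      then have "nrmlz n (?w (t, z)) n \<in> C"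
        unfolding nrmlz_def using nrm2_pos[OF wp] by (intro scale) simp_all
      then show "nrmlz n (?w p) \<in> ?K"
        using nrmlz_in_csphere[OF wp] unfolding p by blast
    qed
    show "nrmlz n (?w (0, z)) = z" if "z \<in> ?K" for z
      using that by (simp add: nrmlz_csphere)
    have "nrm2 n (\<lambda>i. if i = n then c else 0) = 1"
      using c(3) by (simp add: nrm2_def if_distrib[of cmod] if_distrib[of "\<lambda>x. x\<^sup>2"] cong: if_cong)
    then show "nrmlz n (?w (1, z)) = (\<lambda>i. if i = n then c else 0)" for z
      by (simp add: nrmlz_def cong: if_cong)
  qed
qed

text \<open>For c = 1 and c = -1 these are the halves cut off by the real part of the last
  coordinate. Their intersection is cut again by the imaginary part, with poles i and -i, in
  \<open>half_equator\<close>. Thus two real cuts lower the complex dimension by one.\<close>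

definition half_sphere :: "complex \<Rightarrow> nat \<Rightarrow> (nat \<Rightarrow> complex) set"
  where "half_sphere c n = {z \<in> csphere n. z n \<in> {u. 0 \<le> Re (cnj c * u)}}"

definition half_equator :: "complex \<Rightarrow> nat \<Rightarrow> (nat \<Rightarrow> complex) set"
  where "half_equator c n = {z \<in> csphere n. z n \<in> {u. Re u = 0 \<and> 0 \<le> Re (cnj c * u)}}"

lemma contractible_half_sphere:
  assumes "cmod c = 1" shows "contractible_space (top_of_set (half_sphere c n))"
  unfolding half_sphere_def
proof (rule contractible_cap[of _ c])
  have "cnj c * c = 1" using assms by (metis complex_norm_square mult.commute of_real_1 power_one)
  then show "c \<in> {u. 0 \<le> Re (cnj c * u)}" "- c \<notin> {u. 0 \<le> Re (cnj c * u)}"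
    by (simp_all del: complex_mult_cnj times_complex.sel add: mult_minus_right)
  show "of_real r * u \<in> {u. 0 \<le> Re (cnj c * u)}" if "0 \<le> r" "u \<in> {u. 0 \<le> Re (cnj c * u)}" for r u
  proof -
    have "Re (cnj c * (of_real r * u)) = r * Re (cnj c * u)" by (simp add: algebra_simps)
    then show ?thesis using that by simp
  qed
qed (use assms in \<open>auto simp: algebra_simps\<close>)

lemma contractible_half_equator:
  assumes "cmod c = 1" "Re c = 0" shows "contractible_space (top_of_set (half_equator c n))"
  unfolding half_equator_def
proof (rule contractible_cap[of _ c])
  have "cnj c * c = 1" using assms by (metis complex_norm_square mult.commute of_real_1 power_one)
  then show "c \<in> {u. Re u = 0 \<and> 0 \<le> Re (cnj c * u)}" "- c \<notin> {u. Re u = 0 \<and> 0 \<le> Re (cnj c * u)}"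
    using assms(2) by (simp_all del: complex_mult_cnj times_complex.sel add: mult_minus_right)
  show "of_real r * u \<in> {u. Re u = 0 \<and> 0 \<le> Re (cnj c * u)}"
    if "0 \<le> r" "u \<in> {u. Re u = 0 \<and> 0 \<le> Re (cnj c * u)}" for r u
  proof -
    have "Re (cnj c * (of_real r * u)) = r * Re (cnj c * u)" by (simp add: algebra_simps)
    moreover have "Re (of_real r * u) = r * Re u" by simp
    ultimately show ?thesis using that by (simp del: times_complex.sel)
  qed
qed (use assms in \<open>auto simp: algebra_simps\<close>)

lemma closed_half_sphere: "closed (half_sphere c n)"
proof -
  have "half_sphere c n = csphere n \<inter> {z. z n \<in> {u. 0 \<le> Re (cnj c * u)}}"
    by (auto simp: half_sphere_def)
  moreover have "closed {u. 0 \<le> Re (cnj c * u)}"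
    by (intro closed_Collect_le continuous_intros)
  ultimately show ?thesis by (simp only: closed_Int[OF closed_csphere closed_coordinate])
qed

lemma closed_half_equator: "closed (half_equator c n)"
proof -
  have "half_equator c n = csphere n \<inter> {z. z n \<in> {u. Re u = 0 \<and> 0 \<le> Re (cnj c * u)}}"
    by (auto simp: half_equator_def)
  moreover have "closed {u. Re u = 0 \<and> 0 \<le> Re (cnj c * u)}"
    by (intro closed_Collect_conj closed_Collect_le closed_Collect_eq continuous_intros)
  ultimately show ?thesis by (simp only: closed_Int[OF closed_csphere closed_coordinate])
qed

lemma compact_half_sphere: "compact (half_sphere c n)"
  using compact_Int_closed[OF compact_csphere closed_half_sphere, of n c n]
  by (metis (no_types, lifting) Int_absorb1 half_sphere_def mem_Collect_eq subsetI)

lemma compact_half_equator: "compact (half_equator c n)"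
  using compact_Int_closed[OF compact_csphere closed_half_equator, of n c n]
  by (metis (no_types, lifting) Int_absorb1 half_equator_def mem_Collect_eq subsetI)

lemma half_sphere_Un: "half_sphere 1 n \<union> half_sphere (- 1) n = csphere n"
  by (auto simp: half_sphere_def)

lemma half_sphere_Int: "half_sphere 1 n \<inter> half_sphere (- 1) n = half_equator \<i> n \<union> half_equator (- \<i>) n"
  by (auto simp: half_sphere_def half_equator_def)

lemma connected_csphere: "connected (csphere n)"
proof -
  have conn: "connected (half_sphere c n)" if "cmod c = 1" for c
    using contractible_imp_connected_space[OF contractible_half_sphere[OF that, of n]]
    by (simp add: connectedin_def flip: connectedin_iff_connected)
  have "(\<lambda>i. if i = n then \<i> else 0) \<in> half_sphere 1 n \<inter> half_sphere (- 1) n"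
    by (simp add: half_sphere_def csphere_def nrm2_def if_distrib[of cmod] if_distrib[of "\<lambda>x. x\<^sup>2"] cong: if_cong)
  then show ?thesis
    using connected_Un[of "half_sphere 1 n" "half_sphere (- 1) n"] conn half_sphere_Un by fastforce
qed

lemma half_equator_Int: "half_equator \<i> (Suc n) \<inter> half_equator (- \<i>) (Suc n) = csphere n"
proof -
  have "z \<in> csphere (Suc n) \<and> z (Suc n) = 0 \<longleftrightarrow> z \<in> csphere n" for z
  proof -
    have "(\<forall>i>n. z i = 0) \<longleftrightarrow> (\<forall>i>Suc n. z i = 0) \<and> z (Suc n) = 0"
      by (metis Suc_lessD Suc_lessI lessI)
    then show ?thesis unfolding csphere_def nrm2_def by auto
  qed
  moreover have "(Re u = 0 \<and> 0 \<le> Re (cnj \<i> * u)) \<and> Re u = 0 \<and> 0 \<le> Re (cnj (- \<i>) * u) \<longleftrightarrow> u = 0" for u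
    by (auto simp: complex_eq_iff)
  ultimately show ?thesis
    unfolding half_equator_def by blast
qed

text \<open>The sphere of dimension 2n + 3 is the union of two contractible halves meeting in a
  sphere of dimension 2n + 2. The latter is loggable, being the union of two contractible halves
  whose intersection, the sphere of dimension 2n + 1, is connected.\<close>

lemma liftable_csphere: "liftable m (csphere (Suc n))"
proof -
  have "loggable (half_equator \<i> (Suc n) \<union> half_equator (- \<i>) (Suc n))"
    by (intro loggable_Un loggable_contractible contractible_half_equator closed_half_equator
        compact_half_equator) (simp_all add: half_equator_Int connected_csphere)
  then have "liftable m (half_sphere 1 (Suc n) \<union> half_sphere (- 1) (Suc n))"
    by (intro liftable_Un liftable_contractible contractible_half_sphere closed_half_sphere
        compact_half_sphere) (simp_all add: half_sphere_Int)
  then show ?thesis by (simp add: half_sphere_Un)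
qed

subsection \<open>Lifts along the circle action\<close>

definition rot :: "real \<Rightarrow> (nat \<Rightarrow> complex) \<Rightarrow> nat \<Rightarrow> complex"
  where "rot t z = (\<lambda>i. cis (2 * pi * t) * z i)"

lemma rot_csphere [simp]: "z \<in> csphere n \<Longrightarrow> rot t z \<in> csphere n"
  by (simp add: csphere_def rot_def nrm2_scale)

lemma rot_rot: "rot s (rot t z) = rot (s + t) z"
  by (simp add: rot_def mult.assoc[symmetric] cis_mult distrib_left)

lemma rot_0 [simp]: "rot 0 z = z"
  by (simp add: rot_def)

lemma rot_1 [simp]: "rot 1 z = z"
  by (simp add: rot_def)

lemma projective_class_rot [simp]: "projective_class (rot t z) = projective_class z"
  unfolding rot_def by (rule projective_class_scale) simp

lemma continuous_on_rot:
  assumes a: "continuous_on S a" and b: "continuous_on S b"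
  shows "continuous_on S (\<lambda>x. rot (a x) (b x))"
  unfolding rot_def
  by (intro continuous_on_coordinatewise_then_product continuous_on_mult continuous_on_cis
      continuous_on_const a continuous_on_product_then_coordinatewise[OF b])

text \<open>The factor X t z by which S changes along an orbit is deformed to X 0 z = 1 by shrinking
  t, so it has a logarithm, which is then normalized to vanish at time 0. Times up to 2 leave room
  for the sum of two times in the unit interval.\<close>

lemma equivariant_log:
  assumes S: "continuous_on (csphere n) S" "S ` csphere n \<subseteq> pset m"
    and inv: "\<And>z t. z \<in> csphere n \<Longrightarrow> projective_class (S (rot t z)) = projective_class (S z)"
  obtains h where "continuous_on ({0..2} \<times> csphere n) h" "\<And>z. z \<in> csphere n \<Longrightarrow> h (0, z) = 0"
    "\<And>t z. t \<in> {0..2} \<Longrightarrow> z \<in> csphere n \<Longrightarrow> S (rot t z) = (\<lambda>i. exp (h (t, z)) * S z i)"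
proof -
  define X where "X = (\<lambda>t z. cip m (S (rot t z)) (S z) / of_real (nrm2 m (S z)))"
  have pos: "nrm2 m (S z) > 0" if "z \<in> csphere n" for z
    using S(2) that by (intro nrm2_pos) auto
  have nz: "nrm2 m (S z) \<noteq> 0" if "z \<in> csphere n" for z
    using pos[OF that] by simp
  have X: "X t z \<noteq> 0 \<and> S (rot t z) = (\<lambda>i. X t z * S z i)" if z: "z \<in> csphere n" for t z
  proof -
    obtain c where c: "c \<noteq> 0" "S (rot t z) = (\<lambda>i. c * S z i)"
      using projective_class_eqD[OF inv[OF z]] by blast
    then have "X t z = c" using pos[OF z] by (simp add: X_def cip_scale_left cip_self)
    with c show ?thesis by simp
  qed
  let ?K = "{0..2::real} \<times> csphere n"
  let ?G = "\<lambda>(s, t, z). X (s * t) z"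
  have 1: "continuous_on ({0..1} \<times> ?K) (\<lambda>p. S (snd (snd p)))"
    by (rule continuous_on_compose2[OF S(1)]) (auto intro!: continuous_on_snd continuous_on_id)
  have 2: "continuous_on ({0..1} \<times> ?K) (\<lambda>p. S (rot (fst p * fst (snd p)) (snd (snd p))))"
    by (rule continuous_on_compose2[OF S(1)])
      (auto intro!: continuous_on_rot continuous_on_mult continuous_on_fst continuous_on_snd continuous_on_id)
  have G: "continuous_on ({0..1} \<times> ?K) ?G"
    unfolding split_beta X_def
    by (intro continuous_on_divide continuous_on_cip continuous_on_of_real continuous_on_nrm2 1 2)
      (use nz in auto)
  have K: "compact ?K" by (intro compact_Times compact_csphere) simp
  obtain k where k: "continuous_on ?K k" "\<And>p. p \<in> ?K \<Longrightarrow> ?G (1, p) = exp (k p)"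
  proof (rule homotopy_log[OF K G, of "\<lambda>_. 0"])
    show "?G (t, p) \<noteq> 0" if "t \<in> {0..1}" "p \<in> ?K" for t p
      using X that by auto
    show "?G (0, p) = exp 0" if "p \<in> ?K" for p
      using that nz by (auto simp: X_def cip_self)
  qed (auto intro!: continuous_intros)
  have k0: "exp (k (0, z)) = 1" if "z \<in> csphere n" for z
    using k(2)[of "(0, z)"] that pos[OF that] by (simp add: X_def cip_self)
  show thesis
  proof (rule that[of "\<lambda>p. k p - k (0, snd p)"])
    have "continuous_on ?K (\<lambda>p. k (0, snd p))"
      by (rule continuous_on_compose2[OF k(1)])
        (auto intro!: continuous_on_Pair continuous_on_const continuous_on_snd continuous_on_id)
    then show "continuous_on ?K (\<lambda>p. k p - k (0, snd p))"
      by (intro continuous_intros k)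
    show "S (rot t z) = (\<lambda>i. exp (k (t, z) - k (0, snd (t, z))) * S z i)"
      if "t \<in> {0..2}" "z \<in> csphere n" for t z
      using X[OF that(2), of t] k(2)[of "(t, z)"] k0[OF that(2)] that by (simp add: exp_diff)
  qed simp
qed

lemma exp_eq_imp_eq:
  fixes f g :: "'b::topological_space \<Rightarrow> complex"
  assumes "connected S" "continuous_on S f" "continuous_on S g"
    and "\<And>x. x \<in> S \<Longrightarrow> exp (f x) = exp (g x)" and "a \<in> S" "f a = g a" "x \<in> S"
  shows "f x = g x"
proof -
  obtain c where c: "\<And>x. x \<in> S \<Longrightarrow> f x = g x + c"
    using exp_eq_imp_diff_const[OF assms(1-4)] by metis
  then show ?thesis using c[OF assms(5)] assms(6,7) by simp
qed

text \<open>If the logarithms along the circle orbits are periodic, their orbit averages turn a lift on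
  the sphere into one that is constant on orbits.\<close>

lemma factor_through_pset:
  assumes f: "continuous_map (complex_projective_space n) (complex_projective_space m) f"
    and S: "continuous_on (csphere n) S" "S ` csphere n \<subseteq> pset m"
      "\<And>z. z \<in> csphere n \<Longrightarrow> projective_class (S z) = f (projective_class z)"
    and h: "continuous_on ({0..2} \<times> csphere n) h" "\<And>z. z \<in> csphere n \<Longrightarrow> h (0, z) = 0"
      "\<And>t z. t \<in> {0..2} \<Longrightarrow> z \<in> csphere n \<Longrightarrow> S (rot t z) = (\<lambda>i. exp (h (t, z)) * S z i)"
    and per: "\<And>z. z \<in> csphere n \<Longrightarrow> h (1, z) = 0"
  obtains g where "continuous_map (complex_projective_space n) (top_of_set (pset m)) g"
    "\<And>L. L \<in> topspace (complex_projective_space n) \<Longrightarrow> projective_class (g L) = f L"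
proof -
  define H where "H = (\<lambda>z. integral {0..1} (\<lambda>t. h (t, z)))"
  define T where "T = (\<lambda>z i. exp (H z) * S z i)"
  have hz: "continuous_on A (\<lambda>t. h (a t, z))"
    if "continuous_on A a" "a ` A \<subseteq> {0..2}" "z \<in> csphere n" for A and a :: "real \<Rightarrow> real" and z
    by (rule continuous_on_compose2[OF h(1)]) (use that in \<open>auto intro!: continuous_intros\<close>)
  have Snz: "\<exists>i. S z i \<noteq> 0" if "z \<in> csphere n" for z
    using S(2) that by (fastforce simp: pset_def fun_eq_iff)
  have cocycle: "h (t, rot s z) = h (t + s, z) - h (s, z)"
    \<comment> \<open>As functions of t, both sides are logarithms of the same factor and vanish at
      t = 0, so they agree on the whole interval.\<close>
    if z: "z \<in> csphere n" and s: "s \<in> {0..1}" and t: "t \<in> {0..1}" for s t z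
  proof (rule exp_eq_imp_eq[of "{0..1::real}" "\<lambda>t. h (t, rot s z)" "\<lambda>t. h (t + s, z) - h (s, z)" 0])
    show "continuous_on {0..1} (\<lambda>t. h (t, rot s z))"
      using z by (intro hz) (auto intro!: continuous_intros)
    show "continuous_on {0..1} (\<lambda>t. h (t + s, z) - h (s, z))"
      using z s by (intro continuous_intros hz) (auto intro!: continuous_intros)
    show "exp (h (u, rot s z)) = exp (h (u + s, z) - h (s, z))" if u: "u \<in> {0..1}" for u
    proof -
      obtain i where i: "S z i \<noteq> 0" using Snz[OF z] by blast
      have "S (rot (u + s) z) i = S (rot u (rot s z)) i" by (simp add: rot_rot)
      also have "\<dots> = exp (h (u, rot s z)) * (exp (h (s, z)) * S z i)"
        using h(3)[of u "rot s z"] h(3)[of s z] u s z by simp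
      finally have "exp (h (u + s, z)) = exp (h (u, rot s z)) * exp (h (s, z))"
        using h(3)[of "u + s" z] u s z i by simp
      then show ?thesis by (simp add: exp_diff)
    qed
    show "h (0, rot s z) = h (0 + s, z) - h (s, z)" using h(2) z by simp
  qed (use t in auto)
  have shift: "h (t + 1, z) = h (t, z)" if "z \<in> csphere n" "t \<in> {0..1}" for t z
    using cocycle[of z 1 t] that per by simp
  \<comment> \<open>Integrating the cocycle identity over t gives an integral over [s, 1 + s], which
    by periodicity equals the one over [0, 1]. Hence exp H changes along the orbit by the inverse of
    the factor of S, and their product T is constant on orbits.\<close>
  have Hrot: "H (rot s z) = H z - h (s, z)" if z: "z \<in> csphere n" and s: "s \<in> {0..1}" for s z
  proof -
    let ?h = "\<lambda>t. h (t, z)"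
    have int: "?h integrable_on {a..b}" if "{a..b} \<subseteq> {0..2}" for a b
      by (rule integrable_continuous_real, rule hz) (use z that in \<open>auto intro!: continuous_intros\<close>)
    have "H (rot s z) = integral {0..1} (\<lambda>t. h (t + s, z) - h (s, z))"
      unfolding H_def by (rule integral_cong) (use cocycle z s in auto)
    also have "\<dots> = integral {0..1} (\<lambda>t. h (t + s, z)) - integral {0..1} (\<lambda>t::real. h (s, z))"
      by (rule integral_diff, rule integrable_continuous_real, rule hz)
        (use z s in \<open>auto intro!: continuous_intros\<close>)
    also have "integral {0..1} (\<lambda>t. h (t + s, z)) = integral {s..1 + s} ?h"
      using integral_shift_real_ivl[of s s "1 + s" ?h] by simp
    also have "\<dots> = integral {s..1} ?h + integral {1..1 + s} ?h"
      by (rule Henstock_Kurzweil_Integration.integral_combine[symmetric]) (use s int in auto)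
    also have "integral {1..1 + s} ?h = integral {0..s} (\<lambda>t. h (t + 1, z))"
      using integral_shift_real_ivl[of 1 1 "1 + s" ?h] by simp
    also have "\<dots> = integral {0..s} ?h"
      by (rule integral_cong) (use shift z s in auto)
    also have "integral {s..1} ?h + integral {0..s} ?h = H z"
      unfolding H_def using Henstock_Kurzweil_Integration.integral_combine[of 0 s 1 ?h] int[of 0 1] s by (simp add: add.commute)
    finally show ?thesis by simp
  qed
  have Hc: "continuous_on (csphere n) H"
  proof -
    have "continuous_on (csphere n \<times> cbox 0 1) (\<lambda>(z, t). h (t, z))"
      unfolding split_beta
      by (rule continuous_on_compose2[OF h(1)])
        (auto intro!: continuous_on_Pair continuous_on_fst continuous_on_snd continuous_on_id)
    then show ?thesis
      unfolding H_def using integral_continuous_on_param[of "csphere n" 0 1 "\<lambda>z t. h (t, z)"] by simp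
  qed
  have Tc: "continuous_on (csphere n) T"
    unfolding T_def
    by (intro continuous_on_coordinatewise_then_product continuous_on_mult continuous_on_exp Hc
        continuous_on_product_then_coordinatewise[OF S(1)])
  have Tp: "T z \<in> pset m" "projective_class (T z) = f (projective_class z)" if "z \<in> csphere n" for z
    using S(2,3) that by (auto simp: T_def projective_class_scale intro!: pset_scale)
  have Trot: "T (rot s z) = T z" if "z \<in> csphere n" "s \<in> {0..1}" for s z
    using Hrot[OF that] h(3)[of s z] that by (simp add: T_def exp_diff)
  \<comment> \<open>Every unit scalar is a rotation by a time in [0, 1], namely its argument divided
    by 2 pi.\<close>
  have Tinv: "T (\<lambda>i. c * z i) = T z" if z: "z \<in> csphere n" and c: "cmod c = 1" for c z
  proof -
    have "c = cis (2 * pi * (Arg2pi c / (2 * pi)))"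
      using c complex_norm_eq_1_exp[of c] by (simp add: cis_conv_exp)
    moreover have "Arg2pi c / (2 * pi) \<in> {0..1}"
      using Arg2pi[of c] by (simp add: field_simps)
    ultimately show ?thesis using Trot[OF z] unfolding rot_def by metis
  qed
  have "continuous_map (top_of_set (pset n)) (top_of_set (pset m)) (\<lambda>z. T (nrmlz n z))"
  proof -
    have "continuous_on (pset n) (\<lambda>z. T (nrmlz n z))"
      by (rule continuous_on_compose2[OF Tc continuous_on_nrmlz[OF continuous_on_id]])
        (auto simp: nrmlz_in_csphere)
    then show ?thesis using Tp(1) nrmlz_in_csphere by auto
  qed
  \<comment> \<open>Normalized representatives of the same line differ by a unit scalar, so T
    composed with normalization is constant on the fibres and descends to the quotient.\<close>
  moreover have "T (nrmlz n z) = T (nrmlz n w)"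
    if zw: "z \<in> pset n" "w \<in> pset n" "projective_class z = projective_class w" for z w
  proof -
    obtain c where c: "c \<noteq> 0" "z = (\<lambda>i. c * w i)" using projective_class_eqD[OF zw(3)] by blast
    have "nrmlz n z = (\<lambda>i. (c / of_real (cmod c)) * nrmlz n w i)"
      using c(1) unfolding c(2) nrmlz_def nrm2_scale by (simp add: real_sqrt_mult fun_eq_iff)
    then show ?thesis
      using Tinv[of "nrmlz n w" "c / of_real (cmod c)"] nrmlz_in_csphere[OF zw(2)] c(1)
      by (simp add: norm_divide)
  qed
  ultimately obtain g where g: "continuous_map (complex_projective_space n) (top_of_set (pset m)) g"
    "\<And>z. z \<in> pset n \<Longrightarrow> g (projective_class z) = T (nrmlz n z)"
    using quotient_map_lift_exists[OF quotient_map_CP, of n "top_of_set (pset m)" "\<lambda>z. T (nrmlz n z)"]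
    by (metis topspace_euclidean_subtopology)
  show thesis
  proof (rule that[OF g(1)])
    fix L assume "L \<in> topspace (complex_projective_space n)"
    then obtain z where z: "z \<in> pset n" "L = projective_class z" by (auto simp: topspace_CP)
    then show "projective_class (g L) = f L"
      using g(2) Tp(2)[OF nrmlz_in_csphere[OF z(1)]] projective_class_nrmlz[OF z(1)] by simp
  qed
qed

section \<open>Rational chains\<close>

text \<open>The linear extension of a function on simplices. The scalar multiplication s of the
  target is a parameter, so that chain maps, rational cochains and complex-valued cochains are all
  instances.\<close>

definition chain_ext :: "(rat \<Rightarrow> 'v \<Rightarrow> 'v) \<Rightarrow> ('b \<Rightarrow> 'v) \<Rightarrow> ('b \<Rightarrow>\<^sub>0 rat) \<Rightarrow> 'v::ab_group_add"
  where "chain_ext s \<phi> c = (\<Sum>\<sigma>\<in>Poly_Mapping.keys c. s (Poly_Mapping.lookup c \<sigma>) (\<phi> \<sigma>))"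

definition rscale :: "rat \<Rightarrow> ('b \<Rightarrow>\<^sub>0 rat) \<Rightarrow> ('b \<Rightarrow>\<^sub>0 rat)"
  where "rscale q = Poly_Mapping.map (\<lambda>r. q * r)"

lemma lookup_rscale [simp]: "Poly_Mapping.lookup (rscale q c) \<sigma> = q * Poly_Mapping.lookup c \<sigma>"
  by (simp add: rscale_def Poly_Mapping.map.rep_eq when_def)

lemma vector_space_rscale: "vector_space rscale"
  by unfold_locales (auto intro!: poly_mapping_eqI simp: lookup_add algebra_simps)

interpretation rc: vector_space rscale by (rule vector_space_rscale)

lemma rscale_single [simp]: "rscale q (Poly_Mapping.single x r) = Poly_Mapping.single x (q * r)"
  by (rule poly_mapping_eqI) (simp add: lookup_single when_def)

lemma keys_rscale: "Poly_Mapping.keys (rscale q c) \<subseteq> Poly_Mapping.keys c"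
  by (auto simp: in_keys_iff)

lemma chain_ext_superset:
  assumes "vector_space s" "finite A" "Poly_Mapping.keys c \<subseteq> A"
  shows "chain_ext s \<phi> c = (\<Sum>\<sigma>\<in>A. s (Poly_Mapping.lookup c \<sigma>) (\<phi> \<sigma>))"
proof -
  interpret vector_space s by (rule assms)
  show ?thesis
    unfolding chain_ext_def
    by (rule sum.mono_neutral_left) (use assms in \<open>auto simp: in_keys_iff\<close>)
qed

lemma linear_chain_ext:
  assumes "vector_space s" shows "Vector_Spaces.linear rscale s (chain_ext s \<phi>)"
proof -
  interpret vector_space s by (rule assms)
  show ?thesis
  proof unfold_locales
    fix c d :: "'b \<Rightarrow>\<^sub>0 rat"
    let ?A = "Poly_Mapping.keys c \<union> Poly_Mapping.keys d"
    have "chain_ext s \<phi> (c + d) = (\<Sum>\<sigma>\<in>?A. s (Poly_Mapping.lookup (c + d) \<sigma>) (\<phi> \<sigma>))"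
      using keys_add[of c d] by (intro chain_ext_superset[OF assms]) auto
    also have "\<dots> = chain_ext s \<phi> c + chain_ext s \<phi> d"
      using chain_ext_superset[OF assms, of ?A c \<phi>] chain_ext_superset[OF assms, of ?A d \<phi>]
      by (simp add: lookup_add scale_left_distrib sum.distrib)
    finally show "chain_ext s \<phi> (c + d) = chain_ext s \<phi> c + chain_ext s \<phi> d" .
  next
    fix q and c :: "'b \<Rightarrow>\<^sub>0 rat"
    show "chain_ext s \<phi> (rscale q c) = s q (chain_ext s \<phi> c)"
      using chain_ext_superset[OF assms, of "Poly_Mapping.keys c" "rscale q c" \<phi>] keys_rscale[of q c]
      by (simp add: chain_ext_def scale_sum_right)
  qed
qed

lemma chain_ext_single:
  assumes "vector_space s" shows "chain_ext s \<phi> (Poly_Mapping.single \<sigma> r) = s r (\<phi> \<sigma>)"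
proof -
  interpret vector_space s by (rule assms)
  show ?thesis by (subst chain_ext_superset[OF assms, of "{\<sigma>}"]) auto
qed

lemma linear_eq_chain_ext:
  assumes "Vector_Spaces.linear rscale s L"
  shows "L c = chain_ext s (\<lambda>\<sigma>. L (Poly_Mapping.single \<sigma> 1)) c"
proof -
  interpret L: Vector_Spaces.linear rscale s L by (rule assms)
  have "c = (\<Sum>\<sigma>\<in>Poly_Mapping.keys c. rscale (Poly_Mapping.lookup c \<sigma>) (Poly_Mapping.single \<sigma> 1))"
    by (rule poly_mapping_eqI)
      (simp add: lookup_sum lookup_single when_def in_keys_iff)
  then have "L c = (\<Sum>\<sigma>\<in>Poly_Mapping.keys c. L (rscale (Poly_Mapping.lookup c \<sigma>) (Poly_Mapping.single \<sigma> 1)))"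
    by (metis (no_types, lifting) L.sum sum.cong)
  then show ?thesis by (simp only: chain_ext_def L.scale)
qed

text \<open>The test runs over the simplices occurring in c, so properties of simplices of a fixed
  space can be used although the linear maps are defined on all formal chains.\<close>

lemma linear_eq_on_chains:
  assumes "Vector_Spaces.linear rscale s L" "Vector_Spaces.linear rscale s M"
    and "\<And>\<sigma>. \<sigma> \<in> Poly_Mapping.keys c \<Longrightarrow> L (Poly_Mapping.single \<sigma> 1) = M (Poly_Mapping.single \<sigma> 1)"
  shows "L c = M c"
proof -
  have "L c = chain_ext s (\<lambda>\<sigma>. L (Poly_Mapping.single \<sigma> 1)) c"
    by (rule linear_eq_chain_ext[OF assms(1)])
  also have "\<dots> = chain_ext s (\<lambda>\<sigma>. M (Poly_Mapping.single \<sigma> 1)) c"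
    unfolding chain_ext_def by (rule sum.cong) (simp_all add: assms(3))
  also have "\<dots> = M c"
    by (rule linear_eq_chain_ext[OF assms(2), symmetric])
  finally show ?thesis .
qed

section \<open>Rational singular chains, boundaries and induced maps\<close>

abbreviation rchains :: "nat \<Rightarrow> 'a topology \<Rightarrow> 'a rat_chain set"
  where "rchains p X \<equiv> carrier (rat_chain_space p X)"

lemma rchains_def: "rchains p X = {c. Poly_Mapping.keys c \<subseteq> singular_simplex_set p X}"
  by (simp add: rat_chain_space_def)

lemma rat_boundary_eq:
  "rat_boundary p = (\<lambda>c. if p = 0 then 0 else
     chain_ext rscale (\<lambda>\<sigma>. \<Sum>k\<le>p. Poly_Mapping.single (singular_face p k \<sigma>) ((-1) ^ k)) c)"
  unfolding rat_boundary_def chain_ext_def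
  by (simp add: fun_eq_iff rc.scale_sum_right mult.commute)

lemma rat_chain_map_eq:
  "rat_chain_map p f = chain_ext rscale (\<lambda>\<sigma>. Poly_Mapping.single (simplex_map p f \<sigma>) 1)"
  unfolding rat_chain_map_def chain_ext_def by (simp add: fun_eq_iff)

lemma linear_rat_boundary: "Vector_Spaces.linear rscale rscale (rat_boundary p)"
proof (cases "p = 0")
  case True
  then show ?thesis by unfold_locales (simp_all add: rat_boundary_eq)
next
  case False
  then show ?thesis unfolding rat_boundary_eq using linear_chain_ext[OF vector_space_rscale] by simp
qed

lemma linear_rat_chain_map: "Vector_Spaces.linear rscale rscale (rat_chain_map p f)"
  unfolding rat_chain_map_eq by (rule linear_chain_ext[OF vector_space_rscale])

interpretation rb: Vector_Spaces.linear rscale rscale "rat_boundary p" for p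
  by (rule linear_rat_boundary)

interpretation rm: Vector_Spaces.linear rscale rscale "rat_chain_map p f" for p f
  by (rule linear_rat_chain_map)

lemma rat_boundary_single:
  "rat_boundary (Suc p) (Poly_Mapping.single \<sigma> 1) =
    (\<Sum>k\<le>Suc p. Poly_Mapping.single (singular_face (Suc p) k \<sigma>) ((-1) ^ k))"
  unfolding rat_boundary_eq by (simp add: chain_ext_single[OF vector_space_rscale] del: sum.atMost_Suc)

lemma rat_chain_map_single [simp]:
  "rat_chain_map p f (Poly_Mapping.single \<sigma> 1) = Poly_Mapping.single (simplex_map p f \<sigma>) 1"
  unfolding rat_chain_map_eq by (simp add: chain_ext_single[OF vector_space_rscale])

lemma subspace_rchains: "rc.subspace (rchains p X)"
  unfolding rc.subspace_def rchains_def
  using keys_add keys_rscale by fastforce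

lemma single_in_rchains: "singular_simplex p X \<sigma> \<Longrightarrow> Poly_Mapping.single \<sigma> r \<in> rchains p X"
  by (simp add: rchains_def)

lemma linear_image_rchains:
  assumes L: "Vector_Spaces.linear rscale rscale L" and c: "c \<in> rchains p X"
    and step: "\<And>\<sigma>. singular_simplex p X \<sigma> \<Longrightarrow> L (Poly_Mapping.single \<sigma> 1) \<in> rchains q Y"
  shows "L c \<in> rchains q Y"
proof -
  have "L c = (\<Sum>\<sigma>\<in>Poly_Mapping.keys c. rscale (Poly_Mapping.lookup c \<sigma>) (L (Poly_Mapping.single \<sigma> 1)))"
    by (rule linear_eq_chain_ext[OF L, unfolded chain_ext_def])
  also have "\<dots> \<in> rchains q Y"
    by (intro rc.subspace_sum[OF subspace_rchains] rc.subspace_scale[OF subspace_rchains] step)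
      (use c in \<open>auto simp: rchains_def\<close>)
  finally show ?thesis .
qed

lemma rat_boundary_rchains:
  assumes "c \<in> rchains (Suc p) X" shows "rat_boundary (Suc p) c \<in> rchains p X"
proof (rule linear_image_rchains[OF linear_rat_boundary assms])
  fix \<sigma> assume "singular_simplex (Suc p) X \<sigma>"
  then show "rat_boundary (Suc p) (Poly_Mapping.single \<sigma> 1) \<in> rchains p X"
    using singular_simplex_singular_face[of "Suc p" X \<sigma>] unfolding rat_boundary_single
    by (intro rc.subspace_sum[OF subspace_rchains] single_in_rchains) auto
qed

lemma rat_chain_map_rchains:
  assumes "continuous_map X Y f" "c \<in> rchains p X" shows "rat_chain_map p f c \<in> rchains p Y"
  by (rule linear_image_rchains[OF linear_rat_chain_map assms(2)])
    (simp add: single_in_rchains singular_simplex_simplex_map[OF _ assms(1)])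

section \<open>Integral chains inside rational chains\<close>

definition rat_of_chain :: "('b \<Rightarrow>\<^sub>0 int) \<Rightarrow> ('b \<Rightarrow>\<^sub>0 rat)"
  where "rat_of_chain = Poly_Mapping.map of_int"

lemma lookup_rat_of_chain [simp]:
  "Poly_Mapping.lookup (rat_of_chain c) \<sigma> = of_int (Poly_Mapping.lookup c \<sigma>)"
  by (simp add: rat_of_chain_def Poly_Mapping.map.rep_eq when_def)

lemma keys_rat_of_chain [simp]: "Poly_Mapping.keys (rat_of_chain c) = Poly_Mapping.keys c"
  by (auto simp: in_keys_iff)

lemma rat_of_chain_0 [simp]: "rat_of_chain 0 = 0"
  by (rule poly_mapping_eqI) simp

lemma rat_of_chain_add: "rat_of_chain (c + d) = rat_of_chain c + rat_of_chain d"
  by (rule poly_mapping_eqI) (simp add: lookup_add)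

lemma rat_of_chain_diff: "rat_of_chain (c - d) = rat_of_chain c - rat_of_chain d"
  by (rule poly_mapping_eqI) (simp add: lookup_minus)

lemma rat_of_chain_cmul: "rat_of_chain (frag_cmul k c) = rscale (of_int k) (rat_of_chain c)"
  by (rule poly_mapping_eqI) simp

lemma rat_of_chain_of [simp]: "rat_of_chain (frag_of \<sigma>) = Poly_Mapping.single \<sigma> 1"
  by (rule poly_mapping_eqI) (simp add: lookup_single when_def)

lemma rat_of_chain_sum: "rat_of_chain (sum f I) = (\<Sum>i\<in>I. rat_of_chain (f i))"
  by (induction I rule: infinite_finite_induct) (auto simp: rat_of_chain_add)

lemma rat_of_chain_extend:
  "rat_of_chain (frag_extend f c) = chain_ext rscale (\<lambda>\<sigma>. rat_of_chain (f \<sigma>)) (rat_of_chain c)"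
  unfolding frag_extend_def chain_ext_def by (simp add: rat_of_chain_sum rat_of_chain_cmul)

lemma rat_of_chain_boundary: "rat_of_chain (chain_boundary p c) = rat_boundary p (rat_of_chain c)"
proof (cases "p = 0")
  case False
  have "rat_of_chain (\<Sum>k\<le>p. frag_cmul ((-1) ^ k) (frag_of (singular_face p k \<sigma>)))
      = (\<Sum>k\<le>p. Poly_Mapping.single (singular_face p k \<sigma>) ((-1) ^ k))" for \<sigma> :: "(nat \<Rightarrow> real) \<Rightarrow> 'a"
    by (simp add: rat_of_chain_sum rat_of_chain_cmul)
  with False show ?thesis
    unfolding chain_boundary_def rat_boundary_eq by (simp add: rat_of_chain_extend)
qed (simp add: chain_boundary_def rat_boundary_eq)

lemma rat_of_chain_map: "rat_of_chain (chain_map p f c) = rat_chain_map p f (rat_of_chain c)"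
  unfolding chain_map_def rat_chain_map_eq by (simp add: rat_of_chain_extend comp_def)

lemma rat_of_chain_in_rchains [simp]: "rat_of_chain c \<in> rchains p X \<longleftrightarrow> singular_chain p X c"
  by (simp add: rchains_def singular_chain_def)

lemma common_denominator:
  assumes "finite (Q :: rat set)" obtains N :: int where "N > 0" "\<And>q. q \<in> Q \<Longrightarrow> of_int N * q \<in> \<int>"
proof -
  have "\<exists>N::int. N > 0 \<and> (\<forall>q\<in>Q. of_int N * q \<in> \<int>)"
    using assms
  proof induction
    case (insert q Q)
    then obtain N where N: "N > 0" "\<forall>q\<in>Q. of_int N * q \<in> \<int>" by blast
    obtain a b where "quotient_of q = (a, b)" by fastforce
    then have ab: "q = of_int a / of_int b" "b > 0"
      by (rule quotient_of_div, rule quotient_of_denom_pos)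
    have "of_int (b * N) * r \<in> \<int>" if "r \<in> insert q Q" for r
    proof (cases "r = q")
      case True
      have "of_int (b * N) * q = of_int (N * a)" using ab by (simp add: field_simps)
      then show ?thesis using True by (metis Ints_of_int)
    next
      case False
      then have "of_int N * r \<in> \<int>" using N that by blast
      then have "of_int b * (of_int N * r) \<in> \<int>" by (rule Ints_mult[OF Ints_of_int])
      then show ?thesis by (simp add: mult.assoc)
    qed
    then show ?case using N ab by (intro exI[of _ "b * N"]) auto
  qed (auto intro: exI[of _ 1])
  then show thesis using that by blast
qed

text \<open>The bridge from integral to rational chains: an identity or a boundary relation is taken
  from the integral multiple, and N is cancelled afterwards.\<close>

lemma clear_denominators:
  obtains N :: int and z where "N > 0" "rscale (of_int N) c = rat_of_chain z"
proof -
  obtain N :: int where N: "N > 0" "\<And>q. q \<in> Poly_Mapping.lookup c ` Poly_Mapping.keys c \<Longrightarrow> of_int N * q \<in> \<int>"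
    using common_denominator[of "Poly_Mapping.lookup c ` Poly_Mapping.keys c"] by auto
  let ?z = "Poly_Mapping.map (\<lambda>q. \<lfloor>of_int N * q\<rfloor>) c"
  have "rscale (of_int N) c = rat_of_chain ?z"
  proof (rule poly_mapping_eqI)
    fix \<sigma>
    show "Poly_Mapping.lookup (rscale (of_int N) c) \<sigma> = Poly_Mapping.lookup (rat_of_chain ?z) \<sigma>"
    proof (cases "\<sigma> \<in> Poly_Mapping.keys c")
      case True
      then have "of_int N * Poly_Mapping.lookup c \<sigma> \<in> \<int>" using N by blast
      then show ?thesis by (auto simp: Poly_Mapping.map.rep_eq when_def in_keys_iff elim: Ints_cases)
    qed (simp add: Poly_Mapping.map.rep_eq in_keys_iff when_def)
  qed
  then show thesis using that N(1) by blast
qed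

lemma rat_boundary_boundary:
  assumes "c \<in> rchains (Suc (Suc p)) X"
  shows "rat_boundary (Suc p) (rat_boundary (Suc (Suc p)) c) = 0"
proof -
  obtain N z where N: "N > 0" "rscale (of_int N) c = rat_of_chain z" using clear_denominators by blast
  have "singular_chain (Suc (Suc p)) X z"
    using rc.subspace_scale[OF subspace_rchains assms, of "of_int N"] N by simp
  then have "rat_of_chain (chain_boundary (Suc p) (chain_boundary (Suc (Suc p)) z)) = 0"
    by (simp add: chain_boundary_boundary_alt)
  then have "rscale (of_int N) (rat_boundary (Suc p) (rat_boundary (Suc (Suc p)) c)) = 0"
    by (simp add: rat_of_chain_boundary flip: N(2) rb.scale)
  then show ?thesis using N(1) by (simp only: rc.scale_eq_0_iff) simp
qed

lemma rat_boundary_chain_map: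
  assumes "c \<in> rchains p X"
  shows "rat_boundary p (rat_chain_map p f c) = rat_chain_map (p - 1) f (rat_boundary p c)"
proof -
  obtain N z where N: "N > 0" "rscale (of_int N) c = rat_of_chain z" using clear_denominators by blast
  have "singular_chain p X z"
    using rc.subspace_scale[OF subspace_rchains assms, of "of_int N"] N by simp
  then have "rat_of_chain (chain_boundary p (chain_map p f z)) = rat_of_chain (chain_map (p - 1) f (chain_boundary p z))"
    by (simp add: chain_boundary_chain_map)
  then have "rscale (of_int N) (rat_boundary p (rat_chain_map p f c))
      = rscale (of_int N) (rat_chain_map (p - 1) f (rat_boundary p c))"
    by (simp add: rat_of_chain_boundary rat_of_chain_map flip: N(2) rb.scale rm.scale)
  then show ?thesis using N(1) by (simp only: rc.scale_cancel_left) simp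
qed

lemma rat_chain_map_compose: "rat_chain_map p (g \<circ> f) c = rat_chain_map p g (rat_chain_map p f c)"
proof -
  have "Vector_Spaces.linear rscale rscale (rat_chain_map p g \<circ> rat_chain_map p f)"
    by unfold_locales (simp_all add: rm.add rm.scale)
  then have "rat_chain_map p (g \<circ> f) c = (rat_chain_map p g \<circ> rat_chain_map p f) c"
    by (rule linear_eq_on_chains[OF linear_rat_chain_map]) (simp add: simplex_map_compose)
  then show ?thesis by simp
qed

lemma rat_chain_map_cong:
  assumes "c \<in> rchains p X" "\<And>x. x \<in> topspace X \<Longrightarrow> f x = g x"
  shows "rat_chain_map p f c = rat_chain_map p g c"
proof (rule linear_eq_on_chains[OF linear_rat_chain_map linear_rat_chain_map])
  fix \<sigma> assume "\<sigma> \<in> Poly_Mapping.keys c"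
  then have "simplex_map p f \<sigma> = simplex_map p g \<sigma>"
    using assms by (intro simplex_map_eq[of p X]) (auto simp: rchains_def)
  then show "rat_chain_map p f (Poly_Mapping.single \<sigma> 1) = rat_chain_map p g (Poly_Mapping.single \<sigma> 1)"
    by simp
qed

subsection \<open>Cycles and boundaries\<close>

lemma rchains_empty [simp]: "rchains p (trivial_topology :: 'a topology) = {0}"
proof -
  have "singular_simplex_set p (trivial_topology :: 'a topology) = {}"
    by (auto simp: singular_simplex_empty)
  then show ?thesis unfolding rchains_def by (simp only: subset_empty keys_eq_empty) simp
qed

lemma rchains_mono: "c \<in> rchains p (subtopology X S) \<Longrightarrow> c \<in> rchains p X"
  by (auto simp: rchains_def singular_simplex_subtopology)

lemma mem_rat_relcycles:
  "c \<in> rat_relcycles p X S \<longleftrightarrow> c \<in> rchains p X \<and> rat_boundary p c \<in> rchains (p - 1) (subtopology X S)"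
  by (simp add: rat_relcycles_def)

lemma mem_rat_relboundaries:
  "c \<in> rat_relboundaries p X S \<longleftrightarrow>
    (\<exists>d\<in>rchains (Suc p) X. rat_boundary (Suc p) d - c \<in> rchains p (subtopology X S))"
  by (simp add: rat_relboundaries_def)

lemma subspace_rat_relcycles: "rc.subspace (rat_relcycles p X S)"
  unfolding rc.subspace_def
  using rc.subspace_0[OF subspace_rchains] rc.subspace_add[OF subspace_rchains] rc.subspace_scale[OF subspace_rchains]
  by (auto simp: mem_rat_relcycles rb.add rb.scale rb.zero)

lemma subspace_rat_relboundaries: "rc.subspace (rat_relboundaries p X S)"
proof -
  have "0 \<in> rat_relboundaries p X S"
    unfolding mem_rat_relboundaries
    using rc.subspace_0[OF subspace_rchains] by (intro bexI[of _ 0]) (auto simp: rb.zero)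
  moreover have "c + d \<in> rat_relboundaries p X S"
    if c: "c \<in> rat_relboundaries p X S" and d: "d \<in> rat_relboundaries p X S" for c d
  proof -
    obtain u v where uv: "u \<in> rchains (Suc p) X" "rat_boundary (Suc p) u - c \<in> rchains p (subtopology X S)"
      "v \<in> rchains (Suc p) X" "rat_boundary (Suc p) v - d \<in> rchains p (subtopology X S)"
      using c d unfolding mem_rat_relboundaries by blast
    have "rat_boundary (Suc p) (u + v) - (c + d)
        = (rat_boundary (Suc p) u - c) + (rat_boundary (Suc p) v - d)"
      by (simp add: rb.add algebra_simps)
    then show ?thesis
      unfolding mem_rat_relboundaries using uv rc.subspace_add[OF subspace_rchains] by metis
  qed
  moreover have "rscale q c \<in> rat_relboundaries p X S" if c: "c \<in> rat_relboundaries p X S" for q c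
  proof -
    obtain u where u: "u \<in> rchains (Suc p) X" "rat_boundary (Suc p) u - c \<in> rchains p (subtopology X S)"
      using c unfolding mem_rat_relboundaries by blast
    have "rat_boundary (Suc p) (rscale q u) - rscale q c = rscale q (rat_boundary (Suc p) u - c)"
      by (simp add: rb.scale rc.scale_right_diff_distrib)
    then show ?thesis
      unfolding mem_rat_relboundaries using u rc.subspace_scale[OF subspace_rchains] by metis
  qed
  ultimately show ?thesis unfolding rc.subspace_def by blast
qed

lemma mem_rat_cycles: "c \<in> rat_relcycles p X {} \<longleftrightarrow> c \<in> rchains p X \<and> rat_boundary p c = 0"
  by (simp add: mem_rat_relcycles)

lemma mem_rat_boundaries: "c \<in> rat_relboundaries p X {} \<longleftrightarrow> (\<exists>d\<in>rchains (Suc p) X. c = rat_boundary (Suc p) d)"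
  by (auto simp: mem_rat_relboundaries)

lemma rat_chain_map_relcycles:
  assumes f: "continuous_map X Y f" "f ` S \<subseteq> T" and c: "c \<in> rat_relcycles p X S"
  shows "rat_chain_map p f c \<in> rat_relcycles p Y T"
proof -
  have "continuous_map (subtopology X S) (subtopology Y T) f"
    using f by (auto simp: continuous_map_in_subtopology continuous_map_from_subtopology)
  then show ?thesis
    using c f(1) by (auto simp: mem_rat_relcycles rat_chain_map_rchains rat_boundary_chain_map)
qed

lemma rat_chain_map_relboundaries:
  assumes f: "continuous_map X Y f" "f ` S \<subseteq> T" and c: "c \<in> rat_relboundaries p X S"
  shows "rat_chain_map p f c \<in> rat_relboundaries p Y T"
proof -
  obtain d where d: "d \<in> rchains (Suc p) X" "rat_boundary (Suc p) d - c \<in> rchains p (subtopology X S)"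
    using c unfolding mem_rat_relboundaries by blast
  have "continuous_map (subtopology X S) (subtopology Y T) f"
    using f by (auto simp: continuous_map_in_subtopology continuous_map_from_subtopology)
  then have "rat_chain_map p f (rat_boundary (Suc p) d - c) \<in> rchains p (subtopology Y T)"
    using rat_chain_map_rchains d(2) by blast
  then have "rat_boundary (Suc p) (rat_chain_map (Suc p) f d) - rat_chain_map p f c \<in> rchains p (subtopology Y T)"
    using rat_boundary_chain_map[OF d(1), of f] by (simp add: rm.diff)
  then show ?thesis
    unfolding mem_rat_relboundaries using rat_chain_map_rchains[OF f(1) d(1)] by blast
qed

subsection \<open>Comparison with integral homology\<close>

lemma rat_of_chain_relcycle [simp]:
  "rat_of_chain z \<in> rat_relcycles p X S \<longleftrightarrow> singular_relcycle p X S z"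
  by (simp add: mem_rat_relcycles singular_relcycle_def mod_subset_def flip: rat_of_chain_boundary)

lemma rat_of_chain_relboundary:
  "singular_relboundary p X S z \<Longrightarrow> rat_of_chain z \<in> rat_relboundaries p X S"
  unfolding singular_relboundary_def mod_subset_def mem_rat_relboundaries
  by (metis (mono_tags, lifting) case_prodD mem_Collect_eq rat_of_chain_boundary rat_of_chain_diff rat_of_chain_in_rchains)

text \<open>Dependence of any two elements over the integers is the bound on the torsion-free rank.
  It tolerates torsion and passes to subgroups and quotients.\<close>

definition rank_le_1 :: "('x, 'y) monoid_scheme \<Rightarrow> bool"
  where "rank_le_1 G \<longleftrightarrow> (\<forall>x\<in>carrier G. \<forall>y\<in>carrier G. \<exists>(m::int) (n::int). (m, n) \<noteq> (0, 0) \<and>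
    x [^]\<^bsub>G\<^esub> m \<otimes>\<^bsub>G\<^esub> y [^]\<^bsub>G\<^esub> n = \<one>\<^bsub>G\<^esub>)"

text \<open>Integral homology groups are multiplicative factor groups. This and
  \<open>homology_class_pow\<close> turn a multiplicative relation between classes into a linear
  combination of cycles.\<close>

lemma homology_class_mult:
  assumes "singular_relcycle p X S a" "singular_relcycle p X S b"
  shows "homologous_rel_set p X S a \<otimes>\<^bsub>relative_homology_group (int p) X S\<^esub> homologous_rel_set p X S b
    = homologous_rel_set p X S (a + b)"
proof -
  let ?R = "relcycle_group p X S"
  interpret N: normal "singular_relboundary_set p X S" ?R
    by (rule normal_subgroup_singular_relboundary_relcycle)
  have "r_coset ?R (singular_relboundary_set p X S) a <#>\<^bsub>?R\<^esub> r_coset ?R (singular_relboundary_set p X S) b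
      = r_coset ?R (singular_relboundary_set p X S) (a \<otimes>\<^bsub>?R\<^esub> b)"
    by (rule N.rcos_sum) (use assms in auto)
  then show ?thesis
    by (simp add: right_coset_singular_relboundary nontrivial_relative_homology_group FactGroup_def)
qed

lemma homology_class_pow:
  assumes "singular_relcycle p X S a"
  shows "homologous_rel_set p X S a [^]\<^bsub>relative_homology_group (int p) X S\<^esub> (k::int)
    = homologous_rel_set p X S (frag_cmul k a)"
proof -
  let ?G = "relative_homology_group (int p) X S"
  interpret group ?G by simp
  have mem: "homologous_rel_set p X S a \<in> carrier ?G"
    using assms by (auto simp: carrier_relative_homology_group)
  have nat: "homologous_rel_set p X S a [^]\<^bsub>?G\<^esub> n = homologous_rel_set p X S (frag_cmul (int n) a)" for n :: nat
  proof (induction n)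
    case 0
    have "homologous_rel_set p X S 0 = singular_relboundary_set p X S"
      by (simp add: homologous_rel_set_eq_relboundary)
    then show ?case by simp
  next
    case (Suc n)
    then show ?case
      using homology_class_mult[OF singular_relcycle_cmul[OF assms] assms, of "int n"]
      by (simp add: frag_cmul_distrib add.commute)
  qed
  show ?thesis
  proof (cases "k \<ge> 0")
    case True
    then show ?thesis using nat[of "nat k"] by (metis int_nat_eq int_pow_int)
  next
    case False
    let ?u = "homologous_rel_set p X S (frag_cmul (- k) a)" and ?v = "homologous_rel_set p X S (frag_cmul k a)"
    have uv: "?u \<in> carrier ?G" "?v \<in> carrier ?G"
      using singular_relcycle_cmul[OF assms] by (auto simp: carrier_relative_homology_group)
    have "?v \<otimes>\<^bsub>?G\<^esub> ?u = homologous_rel_set p X S (frag_cmul k a + frag_cmul (- k) a)"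
      by (intro homology_class_mult singular_relcycle_cmul assms)
    also have "frag_cmul k a + frag_cmul (- k) a = 0"
      by (simp flip: frag_cmul_distrib)
    also have "homologous_rel_set p X S 0 = \<one>\<^bsub>?G\<^esub>"
      by (simp add: homologous_rel_set_eq_relboundary)
    finally have "inv\<^bsub>?G\<^esub> ?u = ?v" using uv inv_equality by blast
    moreover have "homologous_rel_set p X S a [^]\<^bsub>?G\<^esub> (- k) = ?u"
      using nat[of "nat (- k)"] False by (metis int_nat_eq int_pow_int le_minus_iff minus_zero nle_le)
    ultimately show ?thesis using int_pow_neg[OF mem, of "- k"] by simp
  qed
qed

lemma rat_relcycle_clear_denominators:
  assumes "c \<in> rat_relcycles p X S"
  obtains N :: int and z where "N > 0" "rscale (of_int N) c = rat_of_chain z" "singular_relcycle p X S z"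
proof -
  obtain N z where N: "N > 0" "rscale (of_int N) c = rat_of_chain z" using clear_denominators by blast
  then show thesis
    using that[of N z] rc.subspace_scale[OF subspace_rat_relcycles assms, of "of_int N"]
    by (simp only: rat_of_chain_relcycle)
qed

text \<open>An integral multiple of the rational cycle is an integral cycle, hence bounds, and the
  bounding chain is divided by N. Vanishing is phrased as an inclusion so that chains can be used
  directly.\<close>

lemma rat_relcycles_subset_if_trivial:
  assumes "trivial_group (relative_homology_group (int p) X S)"
  shows "rat_relcycles p X S \<subseteq> rat_relboundaries p X S"
proof
  fix c assume "c \<in> rat_relcycles p X S"
  then obtain N z where N: "N > 0" "rscale (of_int N) c = rat_of_chain z" "singular_relcycle p X S z"
    by (rule rat_relcycle_clear_denominators)
  have "homologous_rel_set p X S z = singular_relboundary_set p X S"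
  proof -
    have "homologous_rel_set p X S ` singular_relcycle_set p X S = {singular_relboundary_set p X S}"
      using assms unfolding trivial_group_def by (simp add: carrier_relative_homology_group)
    moreover have "homologous_rel_set p X S z \<in> homologous_rel_set p X S ` singular_relcycle_set p X S"
      using N(3) by (intro imageI) simp
    ultimately show ?thesis by simp
  qed
  then have "rat_of_chain z \<in> rat_relboundaries p X S"
    by (simp add: homologous_rel_set_eq_relboundary rat_of_chain_relboundary)
  then have "rscale (1 / of_int N) (rscale (of_int N) c) \<in> rat_relboundaries p X S"
    unfolding N(2) by (rule rc.subspace_scale[OF subspace_rat_relboundaries])
  then show "c \<in> rat_relboundaries p X S" using N(1) by simp
qed

definition rat_rank_le_1 :: "nat \<Rightarrow> 'a topology \<Rightarrow> 'a set \<Rightarrow> bool"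
  where "rat_rank_le_1 p X S \<longleftrightarrow> (\<forall>c\<in>rat_relcycles p X S. \<forall>d\<in>rat_relcycles p X S.
    \<exists>q r. (q, r) \<noteq> (0, 0) \<and> rscale q c + rscale r d \<in> rat_relboundaries p X S)"

text \<open>Denominators of both cycles are cleared separately. An integral relation (m, n) between
  the multiples becomes (m M, n N), still nonzero because M and N are positive.\<close>

lemma rat_rank_le_1_if_rank_le_1:
  assumes "rank_le_1 (relative_homology_group (int p) X S)"
  shows "rat_rank_le_1 p X S"
  unfolding rat_rank_le_1_def
proof (intro ballI)
  fix c d assume c: "c \<in> rat_relcycles p X S" and d: "d \<in> rat_relcycles p X S"
  obtain M y where M: "M > 0" "rscale (of_int M) c = rat_of_chain y" "singular_relcycle p X S y"
    using c by (rule rat_relcycle_clear_denominators)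
  obtain N z where N: "N > 0" "rscale (of_int N) d = rat_of_chain z" "singular_relcycle p X S z"
    using d by (rule rat_relcycle_clear_denominators)
  let ?G = "relative_homology_group (int p) X S"
  have "homologous_rel_set p X S y \<in> carrier ?G" "homologous_rel_set p X S z \<in> carrier ?G"
    using M(3) N(3) by (auto simp: carrier_relative_homology_group)
  then obtain m n :: int where mn: "(m, n) \<noteq> (0, 0)"
    "homologous_rel_set p X S y [^]\<^bsub>?G\<^esub> m \<otimes>\<^bsub>?G\<^esub> homologous_rel_set p X S z [^]\<^bsub>?G\<^esub> n = \<one>\<^bsub>?G\<^esub>"
    using assms unfolding rank_le_1_def by blast
  then have "homologous_rel_set p X S (frag_cmul m y + frag_cmul n z) = singular_relboundary_set p X S"
    using M(3) N(3) by (simp add: homology_class_pow homology_class_mult singular_relcycle_cmul)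
  then have "rat_of_chain (frag_cmul m y + frag_cmul n z) \<in> rat_relboundaries p X S"
    by (simp add: homologous_rel_set_eq_relboundary rat_of_chain_relboundary)
  then have "rscale (of_int m * of_int M) c + rscale (of_int n * of_int N) d \<in> rat_relboundaries p X S"
    by (simp add: rat_of_chain_add rat_of_chain_cmul flip: M(2) N(2))
  moreover have "(of_int m * of_int M, of_int n * of_int N) \<noteq> (0 :: rat, 0 :: rat)"
    using mn(1) M(1) N(1) by auto
  ultimately show "\<exists>q r. (q, r) \<noteq> (0, 0) \<and> rscale q c + rscale r d \<in> rat_relboundaries p X S" by blast
qed

section \<open>Degree two detects the lifting obstruction\<close>

lemma subtopology_standard_simplex:
  "subtopology (powertop_real UNIV) (standard_simplex p) = top_of_set (standard_simplex p)"
  by (simp add: euclidean_product_topology)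

lemma singular_simplex_top_of_set:
  "singular_simplex p (top_of_set A) \<tau> \<longleftrightarrow>
    continuous_on (standard_simplex p) \<tau> \<and> \<tau> ` standard_simplex p \<subseteq> A \<and> \<tau> \<in> extensional (standard_simplex p)"
  unfolding singular_simplex_def subtopology_standard_simplex
  by (auto simp: image_subset_iff_funcset)

lemma compact_standard_simplex: "compact (standard_simplex p)"
  using compactin_standard_simplex[of p] by (simp add: euclidean_product_topology)

lemma contractible_standard_simplex: "contractible_space (top_of_set (standard_simplex p))"
proof -
  define v :: "nat \<Rightarrow> real" where "v = (\<lambda>j. if j = 0 then 1 else 0)"
  have v: "v \<in> standard_simplex p" unfolding v_def by simp
  let ?H = "\<lambda>q i. (1 - fst q) * snd q i + fst q * v i"
  show ?thesis
  proof (rule contractible_setI[where a = v])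
    show "continuous_on ({0..1} \<times> standard_simplex p) ?H"
      by (intro continuous_on_coordinatewise_then_product continuous_on_add continuous_on_mult
          continuous_on_diff continuous_on_const continuous_on_fst continuous_on_id
          continuous_on_product_then_coordinatewise[OF continuous_on_snd[OF continuous_on_id]])
    show "?H ` ({0..1} \<times> standard_simplex p) \<subseteq> standard_simplex p"
      using convex_standard_simplex[OF _ v] by auto
  qed auto
qed

section \<open>Logarithmic phases of lifted simplices\<close>

definition phase_rel :: "nat \<Rightarrow> ((nat \<Rightarrow> real) \<Rightarrow> complex) \<Rightarrow> ((nat \<Rightarrow> real) \<Rightarrow> nat \<Rightarrow> complex)
    \<Rightarrow> ((nat \<Rightarrow> real) \<Rightarrow> nat \<Rightarrow> complex) \<Rightarrow> bool"
  where "phase_rel p h \<tau> \<tau>' \<longleftrightarrow> continuous_on (standard_simplex p) h \<and>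
    (\<forall>x\<in>standard_simplex p. \<tau>' x = (\<lambda>i. exp (h x) * \<tau> x i))"

lemma phase_rel_lifts:
  assumes "singular_simplex p (top_of_set (pset n)) \<tau>" "singular_simplex p (top_of_set (pset n)) \<tau>'"
    and "simplex_map p projective_class \<tau> = simplex_map p projective_class \<tau>'"
  obtains h where "phase_rel p h \<tau> \<tau>'"
proof -
  show thesis
  proof (rule lifts_differ[OF loggable_contractible[OF compact_standard_simplex contractible_standard_simplex],
        of p \<tau> n \<tau>'])
    show "projective_class (\<tau>' x) = projective_class (\<tau> x)" if "x \<in> standard_simplex p" for x
      using fun_cong[OF assms(3), of x] that by (simp add: simplex_map_def)
    show thesis if "continuous_on (standard_simplex p) h"
      "\<And>x. x \<in> standard_simplex p \<Longrightarrow> \<tau>' x = (\<lambda>i. exp (h x) * \<tau> x i)" for h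
      using that by (intro \<open>\<And>h. phase_rel p h \<tau> \<tau>' \<Longrightarrow> thesis\<close>[of h]) (simp add: phase_rel_def)
  qed (use assms(1,2) in \<open>auto simp: singular_simplex_top_of_set\<close>)
qed

definition vertex :: "nat \<Rightarrow> nat \<Rightarrow> real"
  where "vertex k = (\<lambda>j. if j = k then 1 else 0)"

lemma vertex_in_simplex: "vertex k \<in> standard_simplex p \<longleftrightarrow> k \<le> p"
  unfolding vertex_def by (rule basis_in_standard_simplex)

text \<open>The chosen lift depends only on the projected simplex. All lifts of the same path are
  therefore measured against one common reference.\<close>

definition simplex_lift :: "nat \<Rightarrow> nat \<Rightarrow> ((nat \<Rightarrow> real) \<Rightarrow> (nat \<Rightarrow> complex) set) \<Rightarrow> (nat \<Rightarrow> real) \<Rightarrow> nat \<Rightarrow> complex"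
  where "simplex_lift n p \<kappa> =
    (SOME \<tau>. singular_simplex p (top_of_set (pset n)) \<tau> \<and> simplex_map p projective_class \<tau> = \<kappa>)"

lemma simplex_lift:
  assumes "singular_simplex p (top_of_set (pset n)) \<tau>"
  shows "singular_simplex p (top_of_set (pset n)) (simplex_lift n p (simplex_map p projective_class \<tau>))"
    "simplex_map p projective_class (simplex_lift n p (simplex_map p projective_class \<tau>))
      = simplex_map p projective_class \<tau>"
  unfolding simplex_lift_def
  by (rule someI2[of _ \<tau>]; use assms in simp)+

text \<open>The change of the logarithmic phase of a path relative to the chosen lift of its projection.\<close>

definition phase_change :: "nat \<Rightarrow> ((nat \<Rightarrow> real) \<Rightarrow> nat \<Rightarrow> complex) \<Rightarrow> complex"
  where "phase_change n \<tau> =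
    (let h = (SOME h. phase_rel 1 h (simplex_lift n 1 (simplex_map 1 projective_class \<tau>)) \<tau>)
     in h (vertex 1) - h (vertex 0))"

text \<open>The logarithm selected for the second path and the sum of k with the one selected for
  the first describe the same factor over the reference lift. They differ by a constant on the
  connected simplex, which cancels between the two endpoints.\<close>

lemma phase_change_rel:
  assumes \<tau>: "singular_simplex 1 (top_of_set (pset n)) \<tau>" and \<tau>': "singular_simplex 1 (top_of_set (pset n)) \<tau>'"
    and k: "phase_rel 1 k \<tau> \<tau>'"
  shows "phase_change n \<tau>' = phase_change n \<tau> + (k (vertex 1) - k (vertex 0))"
proof -
  define s where "s = simplex_lift n 1 (simplex_map 1 projective_class \<tau>)"
  have eq: "simplex_map 1 projective_class \<tau>' = simplex_map 1 projective_class \<tau>"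
    unfolding simplex_map_def
    by (rule restrict_ext) (use k in \<open>simp add: phase_rel_def projective_class_scale\<close>)
  have s: "singular_simplex 1 (top_of_set (pset n)) s"
    "simplex_map 1 projective_class s = simplex_map 1 projective_class \<tau>"
    unfolding s_def by (rule simplex_lift[OF \<tau>])+
  define h where "h = (SOME h. phase_rel 1 h s \<tau>)"
  define h' where "h' = (SOME h. phase_rel 1 h s \<tau>')"
  obtain g where "phase_rel 1 g s \<tau>" by (rule phase_rel_lifts[OF s(1) \<tau> s(2)])
  then have h: "phase_rel 1 h s \<tau>" unfolding h_def by (rule someI[of "\<lambda>h. phase_rel 1 h s \<tau>"])
  obtain g' where "phase_rel 1 g' s \<tau>'" by (rule phase_rel_lifts[OF s(1) \<tau>']) (simp only: eq s(2))
  then have h': "phase_rel 1 h' s \<tau>'" unfolding h'_def by (rule someI[of "\<lambda>h. phase_rel 1 h s \<tau>'"])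
  obtain c where "exp c = 1" and c: "\<And>x. x \<in> standard_simplex 1 \<Longrightarrow> h' x = (k x + h x) + c"
  proof (rule exp_eq_imp_diff_const[of "standard_simplex 1" h' "\<lambda>x. k x + h x"])
    show "connected (standard_simplex 1)"
      using connectedin_standard_simplex[of 1] by (simp add: euclidean_product_topology)
    show "continuous_on (standard_simplex 1) h'" "continuous_on (standard_simplex 1) (\<lambda>x. k x + h x)"
      using h h' k unfolding phase_rel_def by (auto intro: continuous_on_add)
    show "exp (h' x) = exp (k x + h x)" if x: "x \<in> standard_simplex 1" for x
    proof -
      have "s x \<in> pset n" using s(1) x unfolding singular_simplex_top_of_set by blast
      then obtain i where i: "s x i \<noteq> 0" by (auto simp: pset_def fun_eq_iff)
      have "\<tau>' x = (\<lambda>i. exp (h' x) * s x i)" "\<tau>' x = (\<lambda>i. exp (k x) * \<tau> x i)" "\<tau> x = (\<lambda>i. exp (h x) * s x i)"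
        using h h' k x unfolding phase_rel_def by blast+
      from this[THEN fun_cong, of i]
      have "exp (h' x) * s x i = exp (k x + h x) * s x i" by (auto simp: exp_add)
      then show ?thesis using i by (simp only: mult_cancel_right) simp
    qed
  qed blast
  have "phase_change n \<tau>' = h' (vertex 1) - h' (vertex 0)" "phase_change n \<tau> = h (vertex 1) - h (vertex 0)"
    unfolding phase_change_def Let_def eq by (simp_all add: s_def h_def h'_def)
  then show ?thesis
    using c[of "vertex 0"] c[of "vertex 1"] by (simp add: vertex_in_simplex)
qed

definition qscale :: "rat \<Rightarrow> complex \<Rightarrow> complex"
  where "qscale q x = of_rat q * x"

lemma vector_space_qscale: "vector_space qscale"
  by unfold_locales (simp_all add: qscale_def algebra_simps of_rat_add of_rat_mult)

definition phase_cochain :: "nat \<Rightarrow> (nat \<Rightarrow> complex) rat_chain \<Rightarrow> complex"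
  where "phase_cochain n = chain_ext qscale (phase_change n)"

lemma linear_phase_cochain: "Vector_Spaces.linear rscale qscale (phase_cochain n)"
  unfolding phase_cochain_def by (rule linear_chain_ext[OF vector_space_qscale])

interpretation pc: Vector_Spaces.linear rscale qscale "phase_cochain n" for n
  by (rule linear_phase_cochain)

lemma phase_cochain_single: "phase_cochain n (Poly_Mapping.single \<tau> r) = of_rat r * phase_change n \<tau>"
  unfolding phase_cochain_def chain_ext_single[OF vector_space_qscale] qscale_def ..

lemma phase_cochain_boundary:
  "phase_cochain n (rat_boundary 2 (Poly_Mapping.single \<rho> 1)) = phase_change n (singular_face 2 0 \<rho>)
    - phase_change n (singular_face 2 1 \<rho>) + phase_change n (singular_face 2 2 \<rho>)"
proof -
  have "{..Suc 1} = {0, 1, 2::nat}" by auto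
  then show ?thesis
    using rat_boundary_single[of 1 \<rho>]
    by (simp add: numeral_2_eq_2[symmetric] pc.add pc.diff phase_cochain_single of_rat_minus
        del: sum.atMost_Suc)
qed

text \<open>Changing the lift by exp k adds to each edge the difference of k at its endpoints, and
  these differences telescope around the triangle. This is the independence of the lift on which
  \<open>obstruction\<close> rests.\<close>

lemma phase_cochain_boundary_lift:
  assumes \<rho>: "singular_simplex 2 (top_of_set (pset n)) \<rho>" "singular_simplex 2 (top_of_set (pset n)) \<rho>'"
    and k: "phase_rel 2 k \<rho> \<rho>'"
  shows "phase_cochain n (rat_boundary 2 (Poly_Mapping.single \<rho>' 1))
    = phase_cochain n (rat_boundary 2 (Poly_Mapping.single \<rho> 1))"
proof -
  have sf: "simplical_face j ` standard_simplex 1 \<subseteq> standard_simplex 2" if "j \<le> 2" for j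
    using simplical_face_in_standard_simplex[of 2 j] that by auto
  have face: "phase_change n (singular_face 2 j \<rho>') = phase_change n (singular_face 2 j \<rho>)
      + (k (simplical_face j (vertex 1)) - k (simplical_face j (vertex 0)))" if j: "j \<le> 2" for j
  proof (rule phase_change_rel[of n "singular_face 2 j \<rho>" _ "\<lambda>x. k (simplical_face j x)"])
    show "singular_simplex 1 (top_of_set (pset n)) (singular_face 2 j \<rho>)"
      "singular_simplex 1 (top_of_set (pset n)) (singular_face 2 j \<rho>')"
      using singular_simplex_singular_face[of 2 _ \<rho> j] singular_simplex_singular_face[of 2 _ \<rho>' j] \<rho> j
      by auto
    have "continuous_on (standard_simplex 1) (simplical_face j :: (nat \<Rightarrow> real) \<Rightarrow> _)"
    proof (rule continuous_on_coordinatewise_then_product)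
      fix i
      show "continuous_on (standard_simplex 1) (\<lambda>x :: nat \<Rightarrow> real. simplical_face j x i)"
        unfolding simplical_face_def
        using continuous_on_product_then_coordinatewise[OF continuous_on_id]
        by (cases "i < j"; cases "i = j") simp_all
    qed
    then have "continuous_on (standard_simplex 1) (\<lambda>x. k (simplical_face j x))"
      by (rule continuous_on_compose2[of "standard_simplex 2" k, rotated])
        (use k sf[OF j] in \<open>auto simp: phase_rel_def\<close>)
    then show "phase_rel 1 (\<lambda>x. k (simplical_face j x)) (singular_face 2 j \<rho>) (singular_face 2 j \<rho>')"
      using k sf[OF j] unfolding phase_rel_def singular_face_def by auto
  qed
  have v: "simplical_face 0 (vertex 0) = vertex 1" "simplical_face 0 (vertex 1) = vertex 2"
    "simplical_face 1 (vertex 0) = vertex 0" "simplical_face 1 (vertex 1) = vertex 2"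
    "simplical_face 2 (vertex 0) = vertex 0" "simplical_face 2 (vertex 1) = vertex 1"
    by (auto simp: simplical_face_def vertex_def fun_eq_iff)
  show ?thesis
    unfolding phase_cochain_boundary using face[of 0] face[of 1] face[of 2] by (simp only: v) simp
qed

text \<open>The obstruction cocycle of the circle bundle; it does not depend on the lift of the simplex.\<close>

definition obstruction :: "nat \<Rightarrow> (nat \<Rightarrow> complex) set rat_chain \<Rightarrow> complex"
  where "obstruction n = chain_ext qscale
    (\<lambda>\<sigma>. phase_cochain n (rat_boundary 2 (Poly_Mapping.single (simplex_lift n 2 \<sigma>) 1)))"

lemma linear_obstruction: "Vector_Spaces.linear rscale qscale (obstruction n)"
  unfolding obstruction_def by (rule linear_chain_ext[OF vector_space_qscale])

interpretation ob: Vector_Spaces.linear rscale qscale "obstruction n" for n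
  by (rule linear_obstruction)

text \<open>Pulled back to the total space, the obstruction cocycle becomes the coboundary of
  \<open>phase_cochain\<close>, because a simplex upstairs may replace the chosen lift of its
  projection. This transgression lets a path in a fibre measure the obstruction.\<close>

lemma obstruction_projection:
  assumes "c \<in> rchains 2 (top_of_set (pset n))"
  shows "obstruction n (rat_chain_map 2 projective_class c) = phase_cochain n (rat_boundary 2 c)"
proof -
  have L: "Vector_Spaces.linear rscale qscale (\<lambda>c. obstruction n (rat_chain_map 2 projective_class c))"
    by unfold_locales (simp_all add: rm.add rm.scale ob.add ob.scale)
  have M: "Vector_Spaces.linear rscale qscale (\<lambda>c. phase_cochain n (rat_boundary 2 c))"
    by unfold_locales (simp_all add: rb.add rb.scale pc.add pc.scale)
  show ?thesis
  proof (rule linear_eq_on_chains[OF L M])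
    fix \<rho> assume "\<rho> \<in> Poly_Mapping.keys c"
    then have \<rho>: "singular_simplex 2 (top_of_set (pset n)) \<rho>" using assms by (auto simp: rchains_def)
    let ?\<rho>' = "simplex_lift n 2 (simplex_map 2 projective_class \<rho>)"
    note l = simplex_lift[OF \<rho>]
    obtain k where k: "phase_rel 2 k \<rho> ?\<rho>'" by (rule phase_rel_lifts[OF \<rho> l(1) l(2)[symmetric]])
    show "obstruction n (rat_chain_map 2 projective_class (Poly_Mapping.single \<rho> 1))
        = phase_cochain n (rat_boundary 2 (Poly_Mapping.single \<rho> 1))"
      using phase_cochain_boundary_lift[OF \<rho> l(1) k]
      unfolding rat_chain_map_single obstruction_def chain_ext_single[OF vector_space_qscale]
      by (simp add: qscale_def)
  qed
qed

text \<open>A three-simplex is contractible and lifts as a whole, so its boundary is the projection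
  of a boundary. Upstairs the obstruction is the phase of a double boundary, which is zero.\<close>

lemma obstruction_boundary:
  assumes "e \<in> rchains 3 (complex_projective_space n)"
  shows "obstruction n (rat_boundary 3 e) = 0"
proof -
  have L: "Vector_Spaces.linear rscale qscale (\<lambda>c. obstruction n (rat_boundary 3 c))"
    by unfold_locales (simp_all add: rb.add rb.scale ob.add ob.scale)
  have M: "Vector_Spaces.linear rscale qscale (\<lambda>c. 0)"
    using vector_space_rscale vector_space_qscale
    by unfold_locales (simp_all add: qscale_def)
  show ?thesis
  proof (rule linear_eq_on_chains[OF L M])
    fix \<sigma> assume "\<sigma> \<in> Poly_Mapping.keys e"
    then have \<sigma>: "singular_simplex 3 (complex_projective_space n) \<sigma>" using assms by (auto simp: rchains_def)
    have F: "continuous_map (top_of_set (standard_simplex 3)) (complex_projective_space n) \<sigma>"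
      using \<sigma> unfolding singular_simplex_def subtopology_standard_simplex by blast
    have "liftable n (standard_simplex 3)"
      by (rule liftable_contractible[OF compact_standard_simplex contractible_standard_simplex])
    then obtain s where s: "continuous_on (standard_simplex 3) s" "s ` standard_simplex 3 \<subseteq> pset n"
      "\<And>x. x \<in> standard_simplex 3 \<Longrightarrow> projective_class (s x) = \<sigma> x"
      using F unfolding liftable_def by metis
    define \<rho> where "\<rho> = restrict s (standard_simplex 3)"
    have \<rho>: "singular_simplex 3 (top_of_set (pset n)) \<rho>"
      unfolding singular_simplex_top_of_set \<rho>_def using s by (auto cong: continuous_on_cong)
    have "simplex_map 3 projective_class \<rho> = \<sigma>"
      using s(3) \<sigma> unfolding simplex_map_def \<rho>_def singular_simplex_def
      by (auto simp: fun_eq_iff restrict_def extensional_def)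
    then have eq: "Poly_Mapping.single \<sigma> 1 = rat_chain_map 3 projective_class (Poly_Mapping.single \<rho> 1)"
      by simp
    have mem: "Poly_Mapping.single \<rho> 1 \<in> rchains 3 (top_of_set (pset n))"
      using \<rho> by (rule single_in_rchains)
    have "obstruction n (rat_boundary 3 (Poly_Mapping.single \<sigma> 1))
        = obstruction n (rat_chain_map 2 projective_class (rat_boundary 3 (Poly_Mapping.single \<rho> 1)))"
      unfolding eq using rat_boundary_chain_map[OF mem, of projective_class] by simp
    also have "\<dots> = phase_cochain n (rat_boundary 2 (rat_boundary 3 (Poly_Mapping.single \<rho> 1)))"
      using rat_boundary_rchains[of _ 2] mem by (intro obstruction_projection) simp
    also have "\<dots> = 0"
      using rat_boundary_boundary[of "Poly_Mapping.single \<rho> 1" 1] mem by (simp add: numeral_3_eq_3 numeral_2_eq_2 pc.zero)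
    finally show "obstruction n (rat_boundary 3 (Poly_Mapping.single \<sigma> 1)) = 0" .
  qed
qed

text \<open>The orbit of z bounds upstairs and projects to a constant path. Its bounding chain,
  corrected by a constant simplex, therefore projects to a two-cycle. The image of this cycle under
  f bounds, so its obstruction is zero; computed upstairs through S, the obstruction is the phase
  gained along the orbit, h (1, z) - h (0, z).\<close>

lemma orbit_log_periodic:
  assumes f: "continuous_map (complex_projective_space n) (complex_projective_space n) f"
    and S: "continuous_on (csphere n) S" "S ` csphere n \<subseteq> pset n"
      "\<And>z. z \<in> csphere n \<Longrightarrow> projective_class (S z) = f (projective_class z)"
    and h: "continuous_on ({0..2} \<times> csphere n) h" "\<And>z. z \<in> csphere n \<Longrightarrow> h (0, z) = 0"
      "\<And>t z. t \<in> {0..2} \<Longrightarrow> z \<in> csphere n \<Longrightarrow> S (rot t z) = (\<lambda>i. exp (h (t, z)) * S z i)"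
    and H1: "rat_relcycles 1 (top_of_set (pset n)) {} \<subseteq> rat_relboundaries 1 (top_of_set (pset n)) {}"
    and f2: "\<And>c. c \<in> rat_relcycles 2 (complex_projective_space n) {} \<Longrightarrow>
      rat_chain_map 2 f c \<in> rat_relboundaries 2 (complex_projective_space n) {}"
    and z: "z \<in> csphere n"
  shows "h (1, z) = 0"
proof -
  let ?P = "top_of_set (pset n)"
  let ?X = "complex_projective_space n"
  let ?p = "projective_class"
  have zp: "z \<in> pset n" using z csphere_subset_pset by blast
  \<comment> \<open>The path l runs once around the orbit of z, with the barycentric coordinate x 1
    as time, and \<kappa> p is the constant simplex at z in dimension p.\<close>
  define l where "l = restrict (\<lambda>x :: nat \<Rightarrow> real. rot (x 1) z) (standard_simplex 1)"
  define \<kappa> where "\<kappa> = (\<lambda>p. restrict (\<lambda>_ :: nat \<Rightarrow> real. z) (standard_simplex p))"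
  have coord: "continuous_on (standard_simplex p) (\<lambda>x :: nat \<Rightarrow> real. x i)" for p i
    by (rule continuous_on_product_then_coordinatewise[OF continuous_on_id])
  have "continuous_on (standard_simplex 1) (\<lambda>x :: nat \<Rightarrow> real. rot (x 1) z)"
    by (rule continuous_on_rot[OF coord continuous_on_const])
  then have l: "singular_simplex 1 ?P l"
    unfolding singular_simplex_top_of_set l_def using z csphere_subset_pset
    by (auto cong: continuous_on_cong simp: subset_iff)
  have \<kappa>: "singular_simplex p ?P (\<kappa> p)" for p
    unfolding singular_simplex_top_of_set \<kappa>_def using zp by (auto cong: continuous_on_cong)
  have face\<kappa>: "singular_face (Suc p) j (\<kappa> (Suc p)) = \<kappa> p" if "j \<le> Suc p" for p j
    using simplical_face_in_standard_simplex[of "Suc p" j] that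
    by (auto simp: singular_face_def \<kappa>_def fun_eq_iff restrict_def)
  have v0: "standard_simplex 0 = {vertex 0}" unfolding vertex_def by (rule standard_simplex_0)
  have sv: "simplical_face 0 (vertex 0) = vertex 1" "simplical_face 1 (vertex 0) = vertex 0"
    by (auto simp: simplical_face_def vertex_def fun_eq_iff)
  have facel: "singular_face 1 j l = \<kappa> 0" if "j \<le> 1" for j
  proof -
    have "j = 0 \<or> j = 1" using that by auto
    moreover have "l (vertex 1) = z" "l (vertex 0) = z"
      unfolding l_def using vertex_in_simplex[of _ 1] by (auto simp: vertex_def)
    ultimately have "l (simplical_face j (vertex 0)) = z" using sv by auto
    then show ?thesis by (intro ext) (simp add: singular_face_def \<kappa>_def v0 restrict_def)
  qed
  let ?l = "Poly_Mapping.single l 1" and ?k = "\<lambda>p. Poly_Mapping.single (\<kappa> p) 1"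
  have "rat_boundary 1 ?l = 0"
  proof -
    have "rat_boundary (Suc 0) ?l = (\<Sum>j\<le>Suc 0. Poly_Mapping.single (\<kappa> 0) ((-1) ^ j))"
      unfolding rat_boundary_single by (rule sum.cong) (use facel in auto)
    then show ?thesis by (simp flip: single_add)
  qed
  then have "?l \<in> rat_relcycles 1 ?P {}"
    using single_in_rchains[OF l] by (simp add: mem_rat_cycles)
  then obtain d where d: "d \<in> rchains 2 ?P" "?l = rat_boundary 2 d"
    using H1 unfolding mem_rat_boundaries by (auto simp: numeral_2_eq_2 subset_iff mem_rat_boundaries)
  \<comment> \<open>The three equal faces have signs 1, -1, 1, so one copy of the constant path
    remains. Subtracting the constant triangle from d thus leaves the difference of l and the
    constant path as boundary.\<close>
  have bk: "rat_boundary 2 (?k 2) = ?k 1"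
  proof -
    have "rat_boundary (Suc 1) (?k (Suc 1)) = (\<Sum>j\<le>Suc 1. Poly_Mapping.single (\<kappa> 1) ((-1) ^ j))"
      unfolding rat_boundary_single by (rule sum.cong) (use face\<kappa>[of _ 1] in auto)
    then show ?thesis by (simp add: numeral_2_eq_2 flip: single_add)
  qed
  define b where "b = d - ?k 2"
  have b: "b \<in> rchains 2 ?P"
    unfolding b_def by (intro rc.subspace_diff[OF subspace_rchains] d single_in_rchains \<kappa>)
  have bb: "rat_boundary 2 b = ?l - ?k 1"
    unfolding b_def rb.diff bk d(2) ..
  \<comment> \<open>The orbit stays in one fibre, so both edges of the boundary of b have the same
    projection and cancel there: the projected chain is a cycle.\<close>
  have pl: "simplex_map 1 ?p l = simplex_map 1 ?p (\<kappa> 1)"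
    by (auto simp: simplex_map_def l_def \<kappa>_def fun_eq_iff)
  have "rat_boundary 2 (rat_chain_map 2 ?p b) = 0"
    using rat_boundary_chain_map[OF b, of ?p] pl by (simp add: bb rm.diff)
  then have "rat_chain_map 2 ?p b \<in> rat_relcycles 2 ?X {}"
    using rat_chain_map_rchains[OF continuous_map_projective_class b] by (simp add: mem_rat_cycles)
  then obtain e where e: "e \<in> rchains 3 ?X" "rat_chain_map 2 f (rat_chain_map 2 ?p b) = rat_boundary 3 e"
    using f2 unfolding mem_rat_boundaries by (auto simp: numeral_3_eq_3)
  \<comment> \<open>S is extended from the sphere by normalization because the bounding chain b
    lives in all of \<open>pset n\<close>. The extension still covers f.\<close>
  define T where "T = (\<lambda>z. S (nrmlz n z))"
  have T: "continuous_map ?P ?P T"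
  proof -
    have "continuous_on (pset n) T"
      unfolding T_def by (rule continuous_on_compose2[OF S(1) continuous_on_nrmlz[OF continuous_on_id]])
        (auto simp: nrmlz_in_csphere)
    then show ?thesis using S(2) nrmlz_in_csphere unfolding T_def by auto
  qed
  have Tb: "rat_chain_map 2 T b \<in> rchains 2 ?P" by (rule rat_chain_map_rchains[OF T b])
  have "rat_chain_map 2 f (rat_chain_map 2 ?p b) = rat_chain_map 2 (?p \<circ> T) b"
    unfolding rat_chain_map_compose[symmetric]
  proof (rule rat_chain_map_cong[OF b])
    fix w assume "w \<in> topspace ?P"
    then have w: "w \<in> pset n" by simp
    show "(f \<circ> ?p) w = (?p \<circ> T) w"
      using S(3)[OF nrmlz_in_csphere[OF w]] projective_class_nrmlz[OF w] by (simp add: T_def)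
  qed
  then have "obstruction n (rat_chain_map 2 ?p (rat_chain_map 2 T b)) = 0"
    using obstruction_boundary[OF e(1)] e(2) by (simp add: rat_chain_map_compose)
  then have "phase_cochain n (rat_boundary 2 (rat_chain_map 2 T b)) = 0"
    by (simp add: obstruction_projection[OF Tb])
  moreover have "rat_boundary 2 (rat_chain_map 2 T b)
      = Poly_Mapping.single (simplex_map 1 T l) 1 - Poly_Mapping.single (simplex_map 1 T (\<kappa> 1)) 1"
    using rat_boundary_chain_map[OF b, of T] by (simp add: bb rm.diff)
  ultimately have eq: "phase_change n (simplex_map 1 T l) = phase_change n (simplex_map 1 T (\<kappa> 1))"
    by (simp add: pc.diff phase_cochain_single)
  \<comment> \<open>On the orbit, T multiplies its value at z by exp (h (t, z)), so h itself is the
    phase between the image of the orbit and the constant path.\<close>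
  have "phase_change n (simplex_map 1 T l) = phase_change n (simplex_map 1 T (\<kappa> 1))
      + (h (vertex 1 1, z) - h (vertex 0 1, z))"
  proof (rule phase_change_rel[where k = "\<lambda>x. h (x 1, z)"])
    show "singular_simplex 1 ?P (simplex_map 1 T (\<kappa> 1))" "singular_simplex 1 ?P (simplex_map 1 T l)"
      using singular_simplex_simplex_map T l \<kappa> by blast+
    have x01: "x 1 \<in> {0..1}" if "x \<in> standard_simplex 1" for x
      using that by (auto simp: standard_simplex_def)
    have "continuous_on (standard_simplex 1) (\<lambda>x. h (x 1, z))"
      by (rule continuous_on_compose2[OF h(1) continuous_on_Pair[OF coord continuous_on_const]])
        (use x01 z in fastforce)
    moreover have "T (rot t z) = (\<lambda>i. exp (h (t, z)) * T z i)" if "t \<in> {0..1}" for t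
      using h(3)[of t z] that z by (simp add: T_def nrmlz_csphere)
    ultimately show "phase_rel 1 (\<lambda>x. h (x 1, z)) (simplex_map 1 T (\<kappa> 1)) (simplex_map 1 T l)"
      using x01 by (auto simp: phase_rel_def simplex_map_def \<kappa>_def l_def)
  qed
  then show ?thesis using eq h(2)[OF z] by (simp add: vertex_def)
qed

section \<open>Integral homology of projective space\<close>

lemma rank_le_1_inj:
  assumes "group G" "group H" "h \<in> hom G H" "inj_on h (carrier G)" "rank_le_1 H"
  shows "rank_le_1 G"
  unfolding rank_le_1_def
proof (intro ballI)
  interpret h: group_hom G H h using assms by (simp add: group_hom_def group_hom_axioms_def)
  fix x y assume xy: "x \<in> carrier G" "y \<in> carrier G"
  then obtain m n :: int where mn: "(m, n) \<noteq> (0, 0)" "h x [^]\<^bsub>H\<^esub> m \<otimes>\<^bsub>H\<^esub> h y [^]\<^bsub>H\<^esub> n = \<one>\<^bsub>H\<^esub>"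
    using assms(5) h.hom_closed unfolding rank_le_1_def by blast
  then have "h (x [^]\<^bsub>G\<^esub> m \<otimes>\<^bsub>G\<^esub> y [^]\<^bsub>G\<^esub> n) = h \<one>\<^bsub>G\<^esub>"
    using xy by (simp add: h.hom_int_pow)
  then have "x [^]\<^bsub>G\<^esub> m \<otimes>\<^bsub>G\<^esub> y [^]\<^bsub>G\<^esub> n = \<one>\<^bsub>G\<^esub>"
    using assms(4) xy by (simp add: inj_on_eq_iff del: h.hom_one h.hom_mult)
  then show "\<exists>(m::int) (n::int). (m, n) \<noteq> (0, 0) \<and> x [^]\<^bsub>G\<^esub> m \<otimes>\<^bsub>G\<^esub> y [^]\<^bsub>G\<^esub> n = \<one>\<^bsub>G\<^esub>"
    using mn(1) by blast
qed

lemma rank_le_1_surj: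
  assumes "group G" "group H" "h \<in> hom G H" "carrier H = h ` carrier G" "rank_le_1 G"
  shows "rank_le_1 H"
  unfolding rank_le_1_def
proof (intro ballI)
  interpret h: group_hom G H h using assms by (simp add: group_hom_def group_hom_axioms_def)
  fix x y assume "x \<in> carrier H" "y \<in> carrier H"
  then obtain u v where uv: "u \<in> carrier G" "v \<in> carrier G" "x = h u" "y = h v"
    using assms(4) by blast
  then obtain m n :: int where mn: "(m, n) \<noteq> (0, 0)" "u [^]\<^bsub>G\<^esub> m \<otimes>\<^bsub>G\<^esub> v [^]\<^bsub>G\<^esub> n = \<one>\<^bsub>G\<^esub>"
    using assms(5) unfolding rank_le_1_def by blast
  then have "h (u [^]\<^bsub>G\<^esub> m \<otimes>\<^bsub>G\<^esub> v [^]\<^bsub>G\<^esub> n) = \<one>\<^bsub>H\<^esub>"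
    by simp
  then have "x [^]\<^bsub>H\<^esub> m \<otimes>\<^bsub>H\<^esub> y [^]\<^bsub>H\<^esub> n = \<one>\<^bsub>H\<^esub>"
    using uv by (simp add: h.hom_int_pow)
  then show "\<exists>(m::int) (n::int). (m, n) \<noteq> (0, 0) \<and> x [^]\<^bsub>H\<^esub> m \<otimes>\<^bsub>H\<^esub> y [^]\<^bsub>H\<^esub> n = \<one>\<^bsub>H\<^esub>"
    using mn(1) by blast
qed

lemma rank_le_1_integer_group: "rank_le_1 integer_group"
  unfolding rank_le_1_def
proof (intro ballI)
  fix x y :: int
  \<comment> \<open>The relation y x - x y = 0 is nontrivial unless both integers vanish, and in
    that case (1, 0) is a relation.\<close>
  have "(y, - x) \<noteq> (0, 0) \<and> y * x + (- x) * y = 0 \<or> (1, 0) \<noteq> (0 :: int, 0 :: int) \<and> 1 * x + 0 * y = 0"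
    by auto
  then show "\<exists>(m::int) (n::int). (m, n) \<noteq> (0, 0) \<and>
      x [^]\<^bsub>integer_group\<^esub> m \<otimes>\<^bsub>integer_group\<^esub> y [^]\<^bsub>integer_group\<^esub> n = \<one>\<^bsub>integer_group\<^esub>"
    unfolding group_int_pow_integer_group mult_integer_group one_integer_group by blast
qed

lemma rank_le_1_iso:
  assumes "G \<cong> H" "group G" "group H" "rank_le_1 H" shows "rank_le_1 G"
proof -
  obtain h where "h \<in> iso G H" using assms(1) unfolding is_iso_def by blast
  then show ?thesis
    using assms(2-) by (intro rank_le_1_inj[of G H h]) (auto simp: iso_def bij_betw_def)
qed

lemma rank_le_1_trivial:
  assumes "group G" "trivial_group G" shows "rank_le_1 G"
proof -
  interpret group G by (rule assms)
  have "x = \<one>\<^bsub>G\<^esub>" if "x \<in> carrier G" for x using assms(2) that unfolding trivial_group_def by auto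
  then have "x [^]\<^bsub>G\<^esub> (1::int) \<otimes>\<^bsub>G\<^esub> y [^]\<^bsub>G\<^esub> (0::int) = \<one>\<^bsub>G\<^esub>" if "x \<in> carrier G" for x y
    using that by simp
  moreover have "(1, 0) \<noteq> (0 :: int, 0 :: int)" by simp
  ultimately show ?thesis unfolding rank_le_1_def by blast
qed

section \<open>Homology of the punctured complex space as that of an odd-dimensional sphere\<close>

lemma csphere_homeomorphic_nsphere: "top_of_set (csphere n) homeomorphic_space nsphere (2 * n + 1)"
proof -
  let ?u = "\<lambda>z j. if even j then Re (z (j div 2)) else Im (z (j div 2))"
  let ?v = "\<lambda>(x :: nat \<Rightarrow> real) i. Complex (x (2 * i)) (x (2 * i + 1))"
  have sum: "(\<Sum>j\<le>2 * n + 1. g j) = (\<Sum>i\<le>n. g (2 * i) + g (2 * i + 1))" for g :: "nat \<Rightarrow> real"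
    by (induction n) (simp_all add: algebra_simps)
  have N: "nsphere (2 * n + 1) = top_of_set {x. (\<Sum>i\<le>2 * n + 1. (x i)\<^sup>2) = 1 \<and> (\<forall>i>2 * n + 1. x i = 0)}"
    unfolding nsphere by (simp add: euclidean_product_topology)
  have u: "?u z \<in> {x. (\<Sum>i\<le>2 * n + 1. (x i)\<^sup>2) = 1 \<and> (\<forall>i>2 * n + 1. x i = 0)}" if "z \<in> csphere n" for z
  proof -
    have "(\<Sum>i\<le>2 * n + 1. (?u z i)\<^sup>2) = nrm2 n z"
      unfolding sum nrm2_def by (rule sum.cong) (simp_all add: cmod_power2)
    moreover have "?u z i = 0" if "i > 2 * n + 1" for i
    proof -
      have "i div 2 > n" using that by linarith
      then show ?thesis using \<open>z \<in> csphere n\<close> by (simp add: csphere_def)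
    qed
    ultimately show ?thesis using that by (simp add: csphere_def)
  qed
  have v: "?v x \<in> csphere n" if "x \<in> {x. (\<Sum>i\<le>2 * n + 1. (x i)\<^sup>2) = 1 \<and> (\<forall>i>2 * n + 1. x i = 0)}" for x
  proof -
    have "nrm2 n (?v x) = (\<Sum>i\<le>2 * n + 1. (x i)\<^sup>2)"
      unfolding sum nrm2_def by (rule sum.cong) (simp_all add: cmod_power2)
    then show ?thesis using that by (auto simp: csphere_def complex_eq_iff)
  qed
  have "homeomorphic_maps (top_of_set (csphere n)) (nsphere (2 * n + 1)) ?u ?v"
    unfolding N homeomorphic_maps_def
  proof (intro conjI ballI)
    have "continuous_on (csphere n) ?u"
    proof (rule continuous_on_coordinatewise_then_product)
      fix j
      have c: "continuous_on (csphere n) (\<lambda>z :: nat \<Rightarrow> complex. z (j div 2))"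
        by (rule continuous_on_product_then_coordinatewise[OF continuous_on_id])
      show "continuous_on (csphere n) (\<lambda>z. ?u z j)"
        using continuous_on_Re[OF c] continuous_on_Im[OF c] by (cases "even j") auto
    qed
    then show "continuous_map (top_of_set (csphere n))
        (top_of_set {x. (\<Sum>i\<le>2 * n + 1. (x i)\<^sup>2) = 1 \<and> (\<forall>i>2 * n + 1. x i = 0)}) ?u"
      using u by (simp add: Pi_iff)
    have "continuous_on A ?v" for A
      unfolding Complex_eq
      by (intro continuous_on_coordinatewise_then_product continuous_on_add continuous_on_mult
          continuous_on_of_real continuous_on_const continuous_on_product_then_coordinatewise[OF continuous_on_id])
    then show "continuous_map (top_of_set {x. (\<Sum>i\<le>2 * n + 1. (x i)\<^sup>2) = 1 \<and> (\<forall>i>2 * n + 1. x i = 0)})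
        (top_of_set (csphere n)) ?v"
      using v by (simp add: Pi_iff)
    show "?v (?u z) = z" for z by (auto simp: complex_eq_iff fun_eq_iff)
    show "?u (?v x) = x" for x
    proof
      fix j show "?u (?v x) j = x j" by (cases "even j") (auto elim!: evenE oddE)
    qed
  qed
  then show ?thesis unfolding homeomorphic_space_def by blast
qed

lemma pset_homotopy_equivalent_csphere:
  "top_of_set (pset n) homotopy_equivalent_space top_of_set (csphere n)"
proof -
  have r: "continuous_map (top_of_set (pset n)) (top_of_set (csphere n)) (nrmlz n)"
    using continuous_on_nrmlz[OF continuous_on_id] nrmlz_in_csphere by auto
  have i: "continuous_map (top_of_set (csphere n)) (top_of_set (pset n)) id"
    using csphere_subset_pset[of n] by auto
  have "homotopic_with (\<lambda>x. True) (top_of_set (pset n)) (top_of_set (pset n)) (id \<circ> nrmlz n) id"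
  proof -
    \<comment> \<open>The scaling factor is interpolated between 1/|z| at time 0, which gives the
      normalization, and 1 at time 1. It stays positive, so the homotopy avoids the origin.\<close>
    let ?c = "\<lambda>p. (1 - fst p) * (1 / sqrt (nrm2 n (snd p))) + fst p"
    let ?H = "\<lambda>p i. of_real (?c p) * snd p i"
    have pos: "?c p > 0" if "p \<in> {0..1::real} \<times> pset n" for p
    proof -
      have "fst p = 1 \<or> 0 \<le> fst p \<and> fst p < 1" "nrm2 n (snd p) > 0"
        using that nrm2_pos by (auto simp: mem_Times_iff)
      then show ?thesis
      proof (elim disjE)
        assume "0 \<le> fst p \<and> fst p < 1"
        then show ?thesis using \<open>nrm2 n (snd p) > 0\<close> by (intro add_pos_nonneg mult_pos_pos) auto
      qed simp
    qed
    have c1: "continuous_on ({0..1::real} \<times> pset n) ?H"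
    proof (rule continuous_on_coordinatewise_then_product)
      fix i
      have s: "continuous_on ({0..1::real} \<times> pset n) snd" by (rule continuous_on_snd[OF continuous_on_id])
      have nz: "\<forall>p\<in>{0..1::real} \<times> pset n. sqrt (nrm2 n (snd p)) \<noteq> 0"
        using nrm2_pos by fastforce
      show "continuous_on ({0..1::real} \<times> pset n) (\<lambda>p. ?H p i)"
        by (intro continuous_on_mult continuous_on_of_real continuous_on_add continuous_on_diff
            continuous_on_const continuous_on_divide continuous_on_real_sqrt continuous_on_nrm2 s nz
            continuous_on_fst[OF continuous_on_id] continuous_on_product_then_coordinatewise[OF s])
    qed
    have c2: "?H ` ({0..1::real} \<times> pset n) \<subseteq> pset n"
    proof (rule image_subsetI)
      fix p assume p: "p \<in> {0..1::real} \<times> pset n"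
      then have "snd p \<in> pset n" by auto
      moreover have "complex_of_real (?c p) \<noteq> 0" using less_imp_neq[OF pos[OF p], symmetric] by (simp only: of_real_eq_0_iff not_False_eq_True)
      ultimately show "?H p \<in> pset n" by (rule pset_scale)
    qed
    have c3: "?H (0, z) = nrmlz n z" for z by (simp add: nrmlz_def)
    have c4: "?H (1, z) = z" for z by simp
    obtain H where H: "H = ?H" by simp
    have "continuous_on ({0..1} \<times> pset n) H" "H ` ({0..1} \<times> pset n) \<subseteq> pset n"
      "\<And>z. H (0, z) = nrmlz n z" "\<And>z. H (1, z) = z"
      unfolding H using c1 c2 c3 c4 by blast+
    then show ?thesis
      by (subst homotopic_with) (auto intro!: exI[of _ H])
  qed
  moreover have "homotopic_with (\<lambda>x. True) (top_of_set (csphere n)) (top_of_set (csphere n)) (nrmlz n \<circ> id) id"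
    by (rule homotopic_with_equal) (use continuous_map_compose[OF i r] in \<open>auto simp: nrmlz_csphere\<close>)
  ultimately show ?thesis unfolding homotopy_equivalent_space_def using r i by blast
qed

lemma reduced_homology_pset:
  "reduced_homology_group p (top_of_set (pset n)) \<cong> reduced_homology_group p (nsphere (2 * n + 1))"
  by (rule homotopy_equivalent_space_imp_isomorphic_reduced_homology_groups)
    (rule homotopy_eqv_trans[OF pset_homotopy_equivalent_csphere
        homeomorphic_imp_homotopy_equivalent_space[OF csphere_homeomorphic_nsphere]])

lemma trivial_homology_pset:
  assumes "0 < p" "p \<noteq> 2 * n + 1"
  shows "trivial_group (homology_group (int p) (top_of_set (pset n)))"
proof -
  have "trivial_group (reduced_homology_group (int p) (nsphere (2 * n + 1)))"
    using assms by (intro reduced_homology_group_nsphere) linarith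
  then have "trivial_group (reduced_homology_group (int p) (top_of_set (pset n)))"
    using isomorphic_group_triviality[OF reduced_homology_pset[of "int p" n]] by simp
  then show ?thesis using assms by (simp add: un_reduced_homology_group)
qed

subsection \<open>The complement of a point\<close>

lemma continuous_map_complex_mult:
  fixes f g :: "'b \<Rightarrow> complex"
  assumes "continuous_map Z euclidean f" "continuous_map Z euclidean g"
  shows "continuous_map Z euclidean (\<lambda>x. f x * g x)"
proof -
  have "continuous_map Z (euclidean :: (complex \<times> complex) topology) (\<lambda>x. (f x, g x))"
    using continuous_map_pairedI[OF assms] by simp
  moreover have "continuous_map euclidean euclidean (\<lambda>p :: complex \<times> complex. fst p * snd p)"
    by (auto intro!: continuous_intros)
  ultimately show ?thesis
    using continuous_map_compose[of Z euclidean "\<lambda>x. (f x, g x)" euclidean "\<lambda>p. fst p * snd p"]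
    by (simp only: comp_def fst_conv snd_conv)
qed

text \<open>A continuous map into projective space need not have a representative vector depending
  continuously on the whole domain. Continuity is local, so representatives on a neighborhood of
  each point suffice.\<close>

lemma continuous_map_into_CP:
  assumes "\<And>x. x \<in> topspace Z \<Longrightarrow> \<exists>U s. openin Z U \<and> x \<in> U \<and>
      continuous_map (subtopology Z U) (top_of_set (pset m)) s \<and> (\<forall>y\<in>U. G y = projective_class (s y))"
  shows "continuous_map Z (complex_projective_space m) G"
  unfolding continuous_map_def
proof (intro conjI allI impI)
  show "G \<in> topspace Z \<rightarrow> topspace (complex_projective_space m)"
  proof
    fix x assume "x \<in> topspace Z"
    from assms[OF this] obtain U s where U: "openin Z U" "x \<in> U"
      "continuous_map (subtopology Z U) (top_of_set (pset m)) s" "G x = projective_class (s x)"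
      by blast
    then have "s x \<in> pset m"
      using openin_subset[OF U(1)] continuous_map_image_subset_topspace[OF U(3)] by auto
    then show "G x \<in> topspace (complex_projective_space m)" using U(4) by (simp add: topspace_CP)
  qed
next
  fix V assume V: "openin (complex_projective_space m) V"
  show "openin Z {x \<in> topspace Z. G x \<in> V}"
  proof (subst openin_subopen, intro ballI)
    fix x assume x: "x \<in> {x \<in> topspace Z. G x \<in> V}"
    then have "x \<in> topspace Z" by simp
    from assms[OF this] obtain U s where U: "openin Z U" "x \<in> U"
      "continuous_map (subtopology Z U) (top_of_set (pset m)) s" "\<And>y. y \<in> U \<Longrightarrow> G y = projective_class (s y)"
      by blast
    have "continuous_map (subtopology Z U) (complex_projective_space m) (projective_class \<circ> s)"
      by (rule continuous_map_compose[OF U(3) continuous_map_projective_class])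
    then have "openin (subtopology Z U) {y \<in> topspace (subtopology Z U). (projective_class \<circ> s) y \<in> V}"
      using V by (rule openin_continuous_map_preimage)
    then have "openin Z {y \<in> topspace (subtopology Z U). (projective_class \<circ> s) y \<in> V}"
      using U(1) openin_open_subtopology by blast
    moreover have "x \<in> {y \<in> topspace (subtopology Z U). (projective_class \<circ> s) y \<in> V}"
      using x U(2,4) by auto
    moreover have "{y \<in> topspace (subtopology Z U). (projective_class \<circ> s) y \<in> V} \<subseteq> {x \<in> topspace Z. G x \<in> V}"
      using U(4) by auto
    ultimately show "\<exists>T. openin Z T \<and> x \<in> T \<and> T \<subseteq> {x \<in> topspace Z. G x \<in> V}" by blast
  qed
qed

text \<open>Column j of the projection matrix spans the line as soon as the coordinate j does not
  vanish on it. This gives a continuous local choice of representatives.\<close>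

lemma projective_class_entries:
  assumes "z \<in> pset n" "z j \<noteq> 0"
  shows "projective_class (\<lambda>i. proj_entry n i j (projective_class z)) = projective_class z"
proof -
  have "(\<lambda>i. proj_entry n i j (projective_class z)) = (\<lambda>i. (cnj (z j) / of_real (nrm2 n z)) * z i)"
    unfolding proj_entry_class by (simp add: mult.commute)
  then show ?thesis using assms nrm2_pos[OF assms(1)] by (simp only:) (rule projective_class_scale, simp)
qed

lemma pset_mono: "m \<le> n \<Longrightarrow> pset m \<subseteq> pset n"
  unfolding pset_def by auto

text \<open>For m = n + 1 and t from 1 to 0 this deforms the space onto the hyperplane where
  coordinate m vanishes. At t = 0 the point [0:...:0:1] would be sent to the class of the zero
  vector, which is why that point is removed.\<close>

definition squash :: "nat \<Rightarrow> real \<times> (nat \<Rightarrow> complex) set \<Rightarrow> (nat \<Rightarrow> complex) set"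
  where "squash m = (\<lambda>(t, L). let z = SOME z. z \<in> L
    in projective_class (\<lambda>i. if i = m then of_real t * z i else z i))"

lemma squash_class:
  "squash m (t, projective_class z) = projective_class (\<lambda>i. if i = m then of_real t * z i else z i)"
proof -
  define w where "w = (SOME w. w \<in> projective_class z)"
  have "w \<in> projective_class z"
    unfolding w_def by (rule someI[of _ z]) (rule projective_class_self)
  then obtain c where c: "c \<noteq> 0" "w = (\<lambda>i. c * z i)"
    unfolding projective_class_def by auto
  have "(\<lambda>i. if i = m then of_real t * w i else w i) = (\<lambda>i. c * (if i = m then of_real t * z i else z i))"
    unfolding c(2) by auto
  then show ?thesis
    unfolding squash_def Let_def case_prod_conv w_def[symmetric] using projective_class_scale[OF c(1)] by metis
qed

text \<open>The projective space without the point \<open>[0:\<dots>:0:1]\<close>.\<close>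

definition CP_minus :: "nat \<Rightarrow> (nat \<Rightarrow> complex) set set"
  where "CP_minus n = projective_class ` {z \<in> pset (Suc n). \<exists>j\<le>n. z j \<noteq> 0}"

lemma mem_CP_minus:
  assumes "z \<in> pset (Suc n)" shows "projective_class z \<in> CP_minus n \<longleftrightarrow> (\<exists>j\<le>n. z j \<noteq> 0)"
proof
  assume "projective_class z \<in> CP_minus n"
  then obtain w j where w: "projective_class z = projective_class w" "j \<le> n" "w j \<noteq> 0"
    unfolding CP_minus_def by auto
  obtain c where "c \<noteq> 0" "z = (\<lambda>i. c * w i)" using projective_class_eqD[OF w(1)] by blast
  then show "\<exists>j\<le>n. z j \<noteq> 0" using w by auto
qed (use assms in \<open>auto simp: CP_minus_def\<close>)

lemma CP_minus_subset: "CP_minus n \<subseteq> topspace (complex_projective_space (Suc n))"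
  by (auto simp: CP_minus_def topspace_CP)

lemma proj_entry_nonzero:
  assumes "z \<in> pset n" shows "proj_entry n j j (projective_class z) \<noteq> 0 \<longleftrightarrow> z j \<noteq> 0"
  using nrm2_pos[OF assms] by (simp add: proj_entry_class)

lemma openin_entry_nonzero:
  "openin (complex_projective_space n)
    {L \<in> topspace (complex_projective_space n). proj_entry n j j L \<noteq> 0}"
proof -
  have "openin euclidean (- {0 :: complex})" by (simp add: open_Compl)
  from openin_continuous_map_preimage[OF continuous_map_proj_entry this] show ?thesis by simp
qed

lemma openin_CP_minus: "openin (complex_projective_space (Suc n)) (CP_minus n)"
proof -
  let ?X = "complex_projective_space (Suc n)"
  have "CP_minus n = (\<Union>j\<in>{..n}. {L \<in> topspace ?X. proj_entry (Suc n) j j L \<noteq> 0})"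
  proof (intro subset_antisym subsetI)
    fix L assume L: "L \<in> CP_minus n"
    then obtain z j where z: "z \<in> pset (Suc n)" "j \<le> n" "z j \<noteq> 0" "L = projective_class z"
      unfolding CP_minus_def by auto
    then have "proj_entry (Suc n) j j L \<noteq> 0" using proj_entry_nonzero[OF z(1)] by simp
    then show "L \<in> (\<Union>j\<in>{..n}. {L \<in> topspace ?X. proj_entry (Suc n) j j L \<noteq> 0})"
      using z(2) L CP_minus_subset by blast
  next
    fix L assume "L \<in> (\<Union>j\<in>{..n}. {L \<in> topspace ?X. proj_entry (Suc n) j j L \<noteq> 0})"
    then obtain z j where z: "z \<in> pset (Suc n)" "L = projective_class z" "j \<le> n" "proj_entry (Suc n) j j L \<noteq> 0"
      by (auto simp: topspace_CP)
    then have "z j \<noteq> 0" using proj_entry_nonzero[OF z(1)] by simp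
    then show "L \<in> CP_minus n" using z mem_CP_minus[OF z(1)] by blast
  qed
  moreover have "openin ?X (\<Union>j\<in>{..n}. {L \<in> topspace ?X. proj_entry (Suc n) j j L \<noteq> 0})"
    by (intro openin_Union ballI) (use openin_entry_nonzero in blast)
  ultimately show ?thesis by simp
qed

text \<open>The local representative is a column j with j at most n, whose entry j is untouched by
  the scaling and so stays nonzero. The two cases for m serve the homotopy inside the large space
  and the retraction at time 0 onto the hyperplane.\<close>

lemma continuous_map_squash:
  assumes a: "continuous_map Z (top_of_set {0..1::real}) a"
    and b: "continuous_map Z (subtopology (complex_projective_space (Suc n)) (CP_minus n)) b"
    and m: "m = Suc n \<or> (m = n \<and> (\<forall>x\<in>topspace Z. a x = 0))"
  shows "continuous_map Z (complex_projective_space m) (\<lambda>x. squash (Suc n) (a x, b x))"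
proof (rule continuous_map_into_CP)
  let ?X = "complex_projective_space (Suc n)"
  have bX: "continuous_map Z ?X b" and bC: "b ` topspace Z \<subseteq> CP_minus n"
    using b by (auto simp: continuous_map_in_subtopology)
  have entry: "continuous_map Z euclidean (\<lambda>x. proj_entry (Suc n) i j (b x))" for i j
    using continuous_map_compose[OF bX continuous_map_proj_entry] by (simp add: comp_def)
  have a': "continuous_map Z euclidean a" using a by (simp add: continuous_map_in_subtopology)
  fix x assume x: "x \<in> topspace Z"
  have brep: "\<exists>z\<in>pset (Suc n). b y = projective_class z" if "y \<in> topspace Z" for y
  proof -
    have "b y \<in> CP_minus n" using bC that by blast
    then show ?thesis unfolding CP_minus_def by blast
  qed
  obtain z where z: "z \<in> pset (Suc n)" "b x = projective_class z"
    using brep[OF x] by blast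
  then obtain j where j: "j \<le> n" "z j \<noteq> 0"
    using mem_CP_minus[OF z(1)] bC x by (metis image_subset_iff)
  define U where "U = {y \<in> topspace Z. proj_entry (Suc n) j j (b y) \<in> - {0}}"
  have U: "openin Z U"
    unfolding U_def by (rule openin_continuous_map_preimage[OF entry]) (simp add: open_Compl)
  have xU: "x \<in> U" using x z j proj_entry_nonzero[OF z(1)] by (simp add: U_def)
  let ?s = "\<lambda>y i. if i = Suc n then of_real (a y) * proj_entry (Suc n) i j (b y) else proj_entry (Suc n) i j (b y)"
  have rep: "\<exists>w\<in>pset (Suc n). w j \<noteq> 0 \<and> b y = projective_class w" if "y \<in> U" for y
  proof -
    have y: "y \<in> topspace Z" "proj_entry (Suc n) j j (b y) \<noteq> 0" using that by (auto simp: U_def)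
    then obtain w where w: "w \<in> pset (Suc n)" "b y = projective_class w" using brep by blast
    then show ?thesis using y(2) proj_entry_nonzero[OF w(1)] by auto
  qed
  have sp: "?s y \<in> pset m" if yU: "y \<in> U" for y
  proof -
    obtain w where w: "w \<in> pset (Suc n)" "w j \<noteq> 0" "b y = projective_class w" using rep[OF yU] by blast
    have sj: "?s y j \<noteq> 0" using w j proj_entry_nonzero[OF w(1), of j] by auto
    have "?s y \<noteq> (\<lambda>_. 0)"
    proof
      assume e: "?s y = (\<lambda>_. 0)"
      show False using fun_cong[OF e, of j] sj by contradiction
    qed
    moreover have "?s y i = 0" if "i > m" for i
    proof (cases "i = Suc n")
      case True
      then have "m = n" using m that by auto
      then have "a y = 0" using m that \<open>y \<in> U\<close> by (auto simp: U_def)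
      then show ?thesis using True by simp
    next
      case False
      then have "i > Suc n" using m that by auto
      then show ?thesis using w by (simp add: proj_entry_class pset_def)
    qed
    ultimately show ?thesis unfolding pset_def by blast
  qed
  have "continuous_map (subtopology Z U) (top_of_set (pset m)) ?s"
  proof -
    have "continuous_map Z (product_topology (\<lambda>_. euclidean) UNIV) ?s"
    proof (rule continuous_map_coordinatewise_then_product)
      fix i
      have "continuous_map Z euclidean (\<lambda>y. complex_of_real (a y))"
        using continuous_map_compose[OF a', of euclidean complex_of_real]
        by (simp add: comp_def continuous_on_of_real_id)
      then have "continuous_map Z euclidean (\<lambda>y. complex_of_real (a y) * proj_entry (Suc n) i j (b y))"
        using entry by (rule continuous_map_complex_mult)
      then show "continuous_map Z euclidean (\<lambda>y. ?s y i)"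
        using entry[of i j] by (cases "i = Suc n") simp_all
    qed simp
    then have "continuous_map (subtopology Z U) euclidean ?s"
      by (simp add: euclidean_product_topology continuous_map_from_subtopology)
    then show ?thesis using sp by (auto simp: continuous_map_in_subtopology)
  qed
  moreover have "squash (Suc n) (a y, b y) = projective_class (?s y)" if yU: "y \<in> U" for y
  proof -
    obtain w where w: "w \<in> pset (Suc n)" "w j \<noteq> 0" "b y = projective_class w" using rep[OF yU] by blast
    have "b y = projective_class (\<lambda>i. proj_entry (Suc n) i j (b y))"
      using projective_class_entries[OF w(1,2)] w(3) by simp
    then show ?thesis using squash_class by metis
  qed
  ultimately show "\<exists>U s. openin Z U \<and> x \<in> U \<and> continuous_map (subtopology Z U) (top_of_set (pset m)) s \<and>
      (\<forall>y\<in>U. squash (Suc n) (a y, b y) = projective_class (s y))"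
    using U xU by blast
qed

lemma squash_1:
  assumes "L \<in> CP_minus n" shows "squash (Suc n) (1, L) = L"
proof -
  obtain z where z: "L = projective_class z" using assms unfolding CP_minus_def by blast
  have "(\<lambda>i. if i = Suc n then of_real 1 * z i else z i) = z" by auto
  then show ?thesis unfolding z squash_class by simp
qed

lemma squash_mem_CP_minus:
  assumes "L \<in> CP_minus n" shows "squash (Suc n) (t, L) \<in> CP_minus n"
proof -
  obtain z j where z: "z \<in> pset (Suc n)" "j \<le> n" "z j \<noteq> 0" "L = projective_class z"
    using assms unfolding CP_minus_def by auto
  have "(\<lambda>i. if i = Suc n then of_real t * z i else z i) \<in> {z \<in> pset (Suc n). \<exists>j\<le>n. z j \<noteq> 0}"
    using z by (auto simp: pset_def fun_eq_iff intro!: exI[of _ j])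
  then show ?thesis unfolding z(4) squash_class CP_minus_def by blast
qed

lemma CP_subset_CP_minus: "topspace (complex_projective_space n) \<subseteq> CP_minus n"
proof
  fix L assume "L \<in> topspace (complex_projective_space n)"
  then obtain z where z: "z \<in> pset n" "L = projective_class z" by (auto simp: topspace_CP)
  then obtain j where "z j \<noteq> 0" by (auto simp: pset_def fun_eq_iff)
  moreover have "j \<le> n" using z(1) \<open>z j \<noteq> 0\<close> by (metis (mono_tags, lifting) linorder_not_less mem_Collect_eq pset_def)
  ultimately show "L \<in> CP_minus n"
    using z pset_mono[of n "Suc n"] unfolding CP_minus_def by auto
qed

text \<open>Squashing at time 0, followed by the inclusion, is homotopic to the identity, so every
  class comes from the hyperplane. The inclusion is \<open>id\<close> because a projective class
  does not record the dimension in which it is considered.\<close>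

lemma homology_CP_minus_surj:
  "\<exists>h \<in> hom (homology_group p (complex_projective_space n))
      (homology_group p (subtopology (complex_projective_space (Suc n)) (CP_minus n))).
    carrier (homology_group p (subtopology (complex_projective_space (Suc n)) (CP_minus n)))
      = h ` carrier (homology_group p (complex_projective_space n))"
proof -
  let ?N = "complex_projective_space n"
  let ?Y = "subtopology (complex_projective_space (Suc n)) (CP_minus n)"
  have topY: "topspace ?Y = CP_minus n" using CP_minus_subset by auto
  have i: "continuous_map ?N ?Y id"
  proof -
    have "continuous_map (top_of_set (pset n)) (complex_projective_space (Suc n)) projective_class"
      using continuous_map_projective_class[of "Suc n"] pset_mono[of n "Suc n"]
      by (metis continuous_map_from_subtopology_mono le_SucI order_refl)
    then have "continuous_map ?N (complex_projective_space (Suc n)) id"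
      by (intro continuous_compose_quotient_map[OF quotient_map_CP[of n]]) simp
    then show ?thesis using CP_subset_CP_minus[of n] by (auto simp: continuous_map_in_subtopology)
  qed
  define r where "r = (\<lambda>L. squash (Suc n) (0, L))"
  have r: "continuous_map ?Y ?N r"
    unfolding r_def by (rule continuous_map_squash[of ?Y "\<lambda>_. 0" n "\<lambda>L. L" n]) auto
  have "homotopic_with (\<lambda>x. True) ?Y ?Y (id \<circ> r) id"
  proof -
    let ?Z = "prod_topology (top_of_set {0..1::real}) ?Y"
    have fs: "continuous_map ?Z (top_of_set {0..1}) fst" "continuous_map ?Z ?Y snd"
      by (rule continuous_map_fst, rule continuous_map_snd)
    have "continuous_map ?Z (complex_projective_space (Suc n)) (\<lambda>p. squash (Suc n) (fst p, snd p))"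
      by (rule continuous_map_squash[OF fs]) simp
    then have "continuous_map ?Z (complex_projective_space (Suc n)) (squash (Suc n))" by simp
    then have "continuous_map ?Z ?Y (squash (Suc n))"
      using squash_mem_CP_minus topY by (auto simp: continuous_map_in_subtopology)
    then show ?thesis
      using squash_1 topY by (subst homotopic_with) (auto simp: r_def intro!: exI[of _ "squash (Suc n)"])
  qed
  then have hi: "hom_induced p ?Y {} ?Y {} (id \<circ> r) = hom_induced p ?Y {} ?Y {} id"
    by (rule homology_homotopy_empty)
  let ?h = "hom_induced p ?N {} ?Y {} id"
  have "x \<in> ?h ` carrier (homology_group p ?N)" if x: "x \<in> carrier (homology_group p ?Y)" for x
  proof -
    have "x = hom_induced p ?Y {} ?Y {} (id \<circ> r) x" using hi hom_induced_id[OF x] by simp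
    also have "\<dots> = ?h (hom_induced p ?Y {} ?N {} r x)"
      using hom_induced_compose_empty[OF r i, of p] by simp
    finally show ?thesis using hom_induced_carrier by blast
  qed
  moreover have "?h ` carrier (homology_group p ?N) \<subseteq> carrier (homology_group p ?Y)"
    using hom_induced_carrier by blast
  moreover have "?h \<in> hom (homology_group p ?N) (homology_group p ?Y)" by (rule hom_induced_empty_hom)
  ultimately show ?thesis by blast
qed

subsection \<open>The affine chart\<close>

definition chart :: "nat \<Rightarrow> (nat \<Rightarrow> complex) \<Rightarrow> (nat \<Rightarrow> complex) set"
  where "chart n w = projective_class (\<lambda>i. if i = Suc n then 1 else w i)"

text \<open>The quotient of two entries in the last column of the projection matrix is z i / z (n +
  1). Written with entries, the coordinates inherit continuity from
  \<open>proj_entry\<close>.\<close>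

definition affine_coords :: "nat \<Rightarrow> (nat \<Rightarrow> complex) set \<Rightarrow> nat \<Rightarrow> complex"
  where "affine_coords n L = (\<lambda>i. if i \<le> n
    then proj_entry (Suc n) i (Suc n) L / proj_entry (Suc n) (Suc n) (Suc n) L else 0)"

definition complex_space :: "nat \<Rightarrow> (nat \<Rightarrow> complex) set"
  where "complex_space n = {w. \<forall>i>n. w i = 0}"

definition chart_domain :: "nat \<Rightarrow> (nat \<Rightarrow> complex) set set"
  where "chart_domain n = projective_class ` {z \<in> pset (Suc n). z (Suc n) \<noteq> 0}"

lemma affine_coords_class:
  assumes "z \<in> pset (Suc n)" "z (Suc n) \<noteq> 0"
  shows "affine_coords n (projective_class z) = (\<lambda>i. if i \<le> n then z i / z (Suc n) else 0)"
  using nrm2_pos[OF assms(1)] assms(2) by (auto simp: affine_coords_def proj_entry_class fun_eq_iff)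

lemma chart_rep: "w \<in> complex_space n \<Longrightarrow> (\<lambda>i. if i = Suc n then 1 else w i) \<in> {z \<in> pset (Suc n). z (Suc n) \<noteq> 0}"
  by (auto simp: complex_space_def pset_def fun_eq_iff)

lemma mem_chart_domain:
  assumes "z \<in> pset (Suc n)" shows "projective_class z \<in> chart_domain n \<longleftrightarrow> z (Suc n) \<noteq> 0"
proof
  assume "projective_class z \<in> chart_domain n"
  then obtain w where w: "projective_class z = projective_class w" "w (Suc n) \<noteq> 0"
    unfolding chart_domain_def by auto
  obtain c where "c \<noteq> 0" "z = (\<lambda>i. c * w i)" using projective_class_eqD[OF w(1)] by blast
  then show "z (Suc n) \<noteq> 0" using w by auto
qed (use assms in \<open>auto simp: chart_domain_def\<close>)

lemma chart_domain_subset: "chart_domain n \<subseteq> topspace (complex_projective_space (Suc n))"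
  by (auto simp: chart_domain_def topspace_CP)

lemma homeomorphic_maps_chart:
  "homeomorphic_maps (top_of_set (complex_space n))
    (subtopology (complex_projective_space (Suc n)) (chart_domain n)) (chart n) (affine_coords n)"
  unfolding homeomorphic_maps_def
proof (intro conjI ballI)
  let ?X = "complex_projective_space (Suc n)"
  have "continuous_on (complex_space n) (\<lambda>w i. if i = Suc n then 1 else w i)"
  proof (rule continuous_on_coordinatewise_then_product)
    fix i show "continuous_on (complex_space n) (\<lambda>w. if i = Suc n then 1 else w i)"
      using continuous_on_product_then_coordinatewise[OF continuous_on_id, of "complex_space n" i]
      by (cases "i = Suc n") auto
  qed
  then have "continuous_map (top_of_set (complex_space n)) (top_of_set (pset (Suc n))) (\<lambda>w i. if i = Suc n then 1 else w i)"
    using chart_rep by fastforce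
  then have "continuous_map (top_of_set (complex_space n)) ?X (chart n)"
    using continuous_map_compose[OF _ continuous_map_projective_class] unfolding chart_def comp_def by blast
  then show "continuous_map (top_of_set (complex_space n)) (subtopology ?X (chart_domain n)) (chart n)"
    using chart_rep unfolding continuous_map_in_subtopology chart_domain_def chart_def by auto
next
  let ?Y = "subtopology (complex_projective_space (Suc n)) (chart_domain n)"
  have "continuous_map ?Y euclidean (\<lambda>L. affine_coords n L i)" for i
  proof (cases "i \<le> n")
    case True
    have e: "continuous_map ?Y euclidean (proj_entry (Suc n) i j)" for i j
      by (rule continuous_map_from_subtopology[OF continuous_map_proj_entry])
    have "continuous_map ?Y (top_of_set (- {0})) (proj_entry (Suc n) (Suc n) (Suc n))"
      using e mem_chart_domain proj_entry_nonzero
      by (auto simp: continuous_map_in_subtopology chart_domain_def)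
    moreover have "continuous_map (top_of_set (- {0})) euclidean (inverse :: complex \<Rightarrow> complex)"
      by (auto intro!: continuous_intros)
    ultimately have "continuous_map ?Y euclidean (\<lambda>L. inverse (proj_entry (Suc n) (Suc n) (Suc n) L))"
      using continuous_map_compose unfolding comp_def by blast
    then show ?thesis
      using True continuous_map_complex_mult[OF e] by (simp add: affine_coords_def divide_inverse)
  qed (simp add: affine_coords_def)
  then have "continuous_map ?Y (product_topology (\<lambda>_. euclidean) UNIV) (affine_coords n)"
    by (intro continuous_map_coordinatewise_then_product) auto
  then show "continuous_map ?Y (top_of_set (complex_space n)) (affine_coords n)"
    by (auto simp: euclidean_product_topology continuous_map_in_subtopology complex_space_def affine_coords_def)
next
  fix w assume "w \<in> topspace (top_of_set (complex_space n))"
  then have w: "w \<in> complex_space n" by simp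
  then show "affine_coords n (chart n w) = w"
    using affine_coords_class[of "\<lambda>i. if i = Suc n then 1 else w i" n] chart_rep[OF w]
    by (auto simp: chart_def complex_space_def fun_eq_iff)
next
  fix L assume "L \<in> topspace (subtopology (complex_projective_space (Suc n)) (chart_domain n))"
  then obtain z where z: "z \<in> pset (Suc n)" "z (Suc n) \<noteq> 0" "L = projective_class z"
    by (auto simp: chart_domain_def)
  have "(\<lambda>i. if i = Suc n then 1 else affine_coords n L i) = (\<lambda>i. inverse (z (Suc n)) * z i)"
    using z by (auto simp: affine_coords_class pset_def fun_eq_iff divide_inverse not_le le_Suc_eq)
  then show "chart n (affine_coords n L) = L"
    unfolding chart_def z(3) using z(2) projective_class_scale[of "inverse (z (Suc n))" z] by simp
qed

lemma contractible_chart_domain: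
  "contractible_space (subtopology (complex_projective_space (Suc n)) (chart_domain n))"
proof -
  have "contractible_space (top_of_set (complex_space n))"
  proof (rule contractible_setI[where a = "\<lambda>_. 0"])
    let ?H = "\<lambda>p i. of_real (1 - fst p) * snd p i"
    show "continuous_on ({0..1} \<times> complex_space n) ?H"
      by (intro continuous_on_coordinatewise_then_product continuous_on_mult continuous_on_of_real
          continuous_on_diff continuous_on_const continuous_on_fst[OF continuous_on_id]
          continuous_on_product_then_coordinatewise[OF continuous_on_snd[OF continuous_on_id]])
    show "?H ` ({0..1} \<times> complex_space n) \<subseteq> complex_space n"
      by (auto simp: complex_space_def)
  qed auto
  then show ?thesis
    using homeomorphic_maps_chart homeomorphic_space_contractibility unfolding homeomorphic_space_def by blast
qed

text \<open>The chart sends the origin to the removed point [0:...:0:1], so the punctured chart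
  domain is complex space without the origin.\<close>

lemma reduced_homology_punctured_chart:
  "reduced_homology_group p (subtopology (complex_projective_space (Suc n)) (chart_domain n \<inter> CP_minus n))
    \<cong> reduced_homology_group p (top_of_set (pset n))"
proof -
  let ?X = "complex_projective_space (Suc n)"
  have sub: "pset n \<subseteq> complex_space n" by (auto simp: pset_def complex_space_def)
  have aff: "affine_coords n L \<in> pset n" if L: "L \<in> chart_domain n \<inter> CP_minus n" for L
  proof -
    obtain z where z: "z \<in> pset (Suc n)" "z (Suc n) \<noteq> 0" "L = projective_class z"
      using L by (auto simp: chart_domain_def)
    then obtain j where "j \<le> n" "z j \<noteq> 0" using L mem_CP_minus[OF z(1)] by auto
    then have "affine_coords n L j \<noteq> 0" using affine_coords_class[OF z(1,2)] z by simp
    then have "affine_coords n L \<noteq> (\<lambda>_. 0)" by (metis (full_types))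
    then show ?thesis by (simp add: pset_def affine_coords_def)
  qed
  have "chart n ` pset n = chart_domain n \<inter> CP_minus n"
  proof (intro subset_antisym subsetI)
    fix L assume "L \<in> chart n ` pset n"
    then obtain w where w: "w \<in> pset n" "L = chart n w" by blast
    then obtain j where j: "w j \<noteq> 0" by (auto simp: pset_def fun_eq_iff)
    then have "j \<le> n" using w(1) by (metis (mono_tags, lifting) linorder_not_less mem_Collect_eq pset_def)
    then show "L \<in> chart_domain n \<inter> CP_minus n"
      using chart_rep[of w n] sub w j unfolding w(2) chart_def chart_domain_def CP_minus_def
      by (auto intro!: imageI exI[of _ j])
  next
    fix L assume L: "L \<in> chart_domain n \<inter> CP_minus n"
    then have "affine_coords n L \<in> pset n" by (rule aff)
    moreover have "L = chart n (affine_coords n L)"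
    proof -
      have "\<forall>y\<in>topspace (subtopology ?X (chart_domain n)). chart n (affine_coords n y) = y"
        using homeomorphic_maps_chart[of n] unfolding homeomorphic_maps_def by blast
      moreover have "L \<in> topspace (subtopology ?X (chart_domain n))"
        using L chart_domain_subset[of n] by auto
      ultimately show ?thesis by simp
    qed
    ultimately show "L \<in> chart n ` pset n" by blast
  qed
  then have "homeomorphic_maps (subtopology (top_of_set (complex_space n)) (pset n))
      (subtopology (subtopology ?X (chart_domain n)) (chart_domain n \<inter> CP_minus n)) (chart n) (affine_coords n)"
    using chart_domain_subset[of n] sub aff
    by (intro homeomorphic_maps_subtopologies_alt[OF homeomorphic_maps_chart])
      (auto simp: homeomorphic_maps_chart[unfolded homeomorphic_maps_def])
  then have "top_of_set (pset n) homeomorphic_space subtopology ?X (chart_domain n \<inter> CP_minus n)"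
    unfolding homeomorphic_space_def using sub
    by (auto simp: subtopology_subtopology Int_absorb1 Int_absorb2 Int_assoc[symmetric])
  then show ?thesis
    using homeomorphic_space_imp_isomorphic_reduced_homology_groups homeomorphic_space_sym by blast
qed

text \<open>The complement of the chart domain is the hyperplane at infinity. It is closed and
  contained in the open set \<open>CP_minus n\<close>, so excising it leaves a contractible space
  relative to its punctured version, and the boundary map lowers the degree by one.\<close>

lemma relative_homology_CP_minus:
  "relative_homology_group p (complex_projective_space (Suc n)) (CP_minus n)
    \<cong> reduced_homology_group (p - 1) (nsphere (2 * n + 1))"
proof -
  let ?X = "complex_projective_space (Suc n)"
  let ?W = "topspace ?X - chart_domain n"
  have X: "L \<in> topspace ?X \<longleftrightarrow> (\<exists>z\<in>pset (Suc n). L = projective_class z)" for L by (auto simp: topspace_CP)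
  have W: "?W \<subseteq> CP_minus n"
  proof
    fix L assume L: "L \<in> ?W"
    then obtain z where z: "z \<in> pset (Suc n)" "L = projective_class z" using X by blast
    then have "z (Suc n) = 0" using L mem_chart_domain by blast
    obtain j where "z j \<noteq> 0" using z(1) by (auto simp: pset_def fun_eq_iff)
    moreover have "\<not> j > Suc n" using \<open>z j \<noteq> 0\<close> z(1) by (auto simp: pset_def)
    moreover have "j \<noteq> Suc n" using \<open>z j \<noteq> 0\<close> \<open>z (Suc n) = 0\<close> by auto
    ultimately have "\<exists>j\<le>n. z j \<noteq> 0" by (intro exI[of _ j]) auto
    then show "L \<in> CP_minus n" using mem_CP_minus z by blast
  qed
  have "chart_domain n = {L \<in> topspace ?X. proj_entry (Suc n) (Suc n) (Suc n) L \<noteq> 0}"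
  proof (intro subset_antisym subsetI)
    fix L assume L: "L \<in> chart_domain n"
    then obtain z where z: "z \<in> pset (Suc n)" "z (Suc n) \<noteq> 0" "L = projective_class z"
      by (auto simp: chart_domain_def)
    then show "L \<in> {L \<in> topspace ?X. proj_entry (Suc n) (Suc n) (Suc n) L \<noteq> 0}"
      using L chart_domain_subset[of n] proj_entry_nonzero[OF z(1), of "Suc n"] by blast
  next
    fix L assume L: "L \<in> {L \<in> topspace ?X. proj_entry (Suc n) (Suc n) (Suc n) L \<noteq> 0}"
    then obtain z where z: "z \<in> pset (Suc n)" "L = projective_class z" using X by blast
    then show "L \<in> chart_domain n"
      using L proj_entry_nonzero[OF z(1), of "Suc n"] mem_chart_domain[OF z(1)] by simp
  qed
  then have "closedin ?X ?W" using openin_entry_nonzero[of "Suc n" "Suc n"] by (metis closedin_diff closedin_topspace)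
  then have "?X closure_of ?W \<subseteq> ?X interior_of (CP_minus n)"
    using W openin_CP_minus by (simp add: closure_of_closedin interior_of_openin)
  then have "hom_induced p (subtopology ?X (topspace ?X - ?W)) (CP_minus n - ?W) (subtopology ?X (topspace ?X)) (CP_minus n) id
      \<in> iso (relative_homology_group p (subtopology ?X (topspace ?X - ?W)) (CP_minus n - ?W))
          (relative_homology_group p (subtopology ?X (topspace ?X)) (CP_minus n))"
    by (rule homology_excision_axiom[OF _ CP_minus_subset])
  moreover have "topspace ?X - ?W = chart_domain n" using chart_domain_subset by blast
  moreover have "CP_minus n - ?W = chart_domain n \<inter> CP_minus n" using CP_minus_subset by blast
  ultimately have "relative_homology_group p (subtopology ?X (chart_domain n)) (chart_domain n \<inter> CP_minus n)
      \<cong> relative_homology_group p ?X (CP_minus n)"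
    unfolding is_iso_def by auto
  then have 1: "relative_homology_group p ?X (CP_minus n)
      \<cong> relative_homology_group p (subtopology ?X (chart_domain n)) (chart_domain n \<inter> CP_minus n)"
    by (simp add: group.iso_sym)
  have "topspace (subtopology ?X (chart_domain n)) \<inter> (chart_domain n \<inter> CP_minus n) \<noteq> {}"
  proof -
    \<comment> \<open>The point [1:0:...:0:1] lies in the chart domain and differs from the removed
      point.\<close>
    have "(\<lambda>i. if i = 0 \<or> i = Suc n then 1 else 0) \<in> {z \<in> pset (Suc n). z (Suc n) \<noteq> 0 \<and> (\<exists>j\<le>n. z j \<noteq> 0)}"
      by (auto simp: pset_def fun_eq_iff intro!: exI[of _ 0])
    then show ?thesis using mem_CP_minus mem_chart_domain chart_domain_subset by fastforce
  qed
  then have 2: "relative_homology_group p (subtopology ?X (chart_domain n)) (chart_domain n \<inter> CP_minus n)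
      \<cong> reduced_homology_group (p - 1) (subtopology (subtopology ?X (chart_domain n)) (chart_domain n \<inter> CP_minus n))"
    by (rule isomorphic_group_relative_homology_of_contractible[OF contractible_chart_domain])
  have 3: "subtopology (subtopology ?X (chart_domain n)) (chart_domain n \<inter> CP_minus n) = subtopology ?X (chart_domain n \<inter> CP_minus n)"
    by (simp add: subtopology_subtopology Int_assoc[symmetric])
  show ?thesis
    using iso_trans[OF 1 iso_trans[OF 2[unfolded 3] iso_trans[OF reduced_homology_punctured_chart reduced_homology_pset]]] .
qed

text \<open>Induction by the exact sequence of the pair formed by the larger space and the
  complement of a point. Homology of the complement is controlled by the smaller projective space,
  and the relative group is infinite cyclic in degree 2n + 2 and trivial in all others.\<close>

theorem homology_CP:
  "rank_le_1 (homology_group (int p) (complex_projective_space n)) \<and>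
    (odd p \<or> p > 2 * n \<longrightarrow> trivial_group (homology_group (int p) (complex_projective_space n)))"
proof (induction n arbitrary: p)
  case 0
  let ?X = "complex_projective_space 0"
  define e :: "nat \<Rightarrow> complex" where "e = (\<lambda>i. if i = 0 then 1 else 0)"
  have "projective_class z = projective_class e" if "z \<in> pset 0" for z
  proof -
    have "z 0 \<noteq> 0" using that by (auto simp: pset_def fun_eq_iff) (metis neq0_conv)
    moreover have "z = (\<lambda>i. z 0 * e i)" using that by (auto simp: pset_def e_def fun_eq_iff)
    ultimately show ?thesis using projective_class_scale by metis
  qed
  moreover have "e \<in> pset 0" by (auto simp: pset_def e_def fun_eq_iff)
  ultimately have top: "topspace ?X = {projective_class e}"
    unfolding topspace_CP by (intro subset_antisym subsetI; blast)
  have triv: "trivial_group (homology_group (int p) ?X)" if "p \<noteq> 0"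
    using homology_dimension_axiom[OF top] that by simp
  show ?case
  proof (cases "p = 0")
    case True
    then show ?thesis
      using rank_le_1_iso[OF homology_coefficients[OF top] _ _ rank_le_1_integer_group] by simp
  next
    case False
    then show ?thesis using triv rank_le_1_trivial[OF _ triv] by simp
  qed
next
  case (Suc n)
  let ?X = "complex_projective_space (Suc n)"
  let ?Y = "subtopology ?X (CP_minus n)"
  let ?HX = "homology_group (int p) ?X" and ?HY = "homology_group (int p) ?Y"
    and ?HR = "relative_homology_group (int p) ?X (CP_minus n)"
  from homology_CP_minus_surj[of "int p" n]
  obtain h where h: "h \<in> hom (homology_group (int p) (complex_projective_space n)) ?HY"
    and hs: "carrier ?HY = h ` carrier (homology_group (int p) (complex_projective_space n))" ..
  have rY: "rank_le_1 ?HY"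
    by (rule rank_le_1_surj[OF _ _ h hs]) (use Suc.IH in auto)
  have tY: "trivial_group ?HY" if "odd p \<or> p > 2 * n"
  proof -
    have "carrier (homology_group (int p) (complex_projective_space n))
        = {\<one>\<^bsub>homology_group (int p) (complex_projective_space n)\<^esub>}"
      using Suc.IH[of p] that unfolding trivial_group_def by blast
    then show ?thesis
      unfolding trivial_group_def hs using hom_one[OF h] by simp
  qed
  let ?i = "hom_induced p ?Y {} ?X {} id" and ?j = "hom_induced p ?X {} ?X (CP_minus n) id"
  have exact: "?i ` carrier ?HY = kernel ?HX ?HR ?j"
    using homology_exactness_axiom_3[of "int p" ?X "CP_minus n"] by simp
  have i: "?i \<in> hom ?HY ?HX" and j: "?j \<in> hom ?HX ?HR"
    by (rule hom_induced_hom)+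
  have R: "?HR \<cong> reduced_homology_group (int p - 1) (nsphere (2 * n + 1))"
    by (rule relative_homology_CP_minus)
  show ?case
  \<comment> \<open>In the top degree the complement has trivial homology, so the group embeds into
    an infinite cyclic one. In every other degree the relative group is trivial, so the group is a
    quotient of the homology of the complement.\<close>
  proof (cases "p = 2 * Suc n")
    case True
    then have eq: "int p - 1 = int (2 * n + 1)" by simp
    have "rank_le_1 ?HR"
      using rank_le_1_iso[OF iso_trans[OF R[unfolded eq] reduced_homology_group_nsphere(1)]] rank_le_1_integer_group
      by simp
    moreover have "inj_on ?j (carrier ?HX)"
    proof -
      have "carrier ?HY = {\<one>\<^bsub>?HY\<^esub>}" using tY True unfolding trivial_group_def by simp
      then have "kernel ?HX ?HR ?j = {\<one>\<^bsub>?HX\<^esub>}" using exact hom_one[OF i] by simp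
      then show ?thesis
        using group_hom.inj_iff_trivial_ker[of ?HX ?HR ?j] j by (simp add: group_hom_def group_hom_axioms_def)
    qed
    ultimately show ?thesis using rank_le_1_inj[OF _ _ j] True by simp
  next
    case False
    then have "int p - 1 \<noteq> int (2 * n + 1)" by auto
    then have "trivial_group ?HR"
      using isomorphic_group_triviality[OF R] reduced_homology_group_nsphere(2) by simp
    then have "kernel ?HX ?HR ?j = carrier ?HX"
      using group_hom.kernel_to_trivial_group[of ?HX ?HR ?j] j by (simp add: group_hom_def group_hom_axioms_def)
    then have surj: "carrier ?HX = ?i ` carrier ?HY" using exact by simp
    have "rank_le_1 ?HX" by (rule rank_le_1_surj[OF _ _ i surj rY]) auto
    moreover have "trivial_group ?HX" if "odd p \<or> p > 2 * Suc n"
    proof -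
      have "carrier ?HY = {\<one>\<^bsub>?HY\<^esub>}" using tY that unfolding trivial_group_def by auto
      then show ?thesis unfolding trivial_group_def surj using hom_one[OF i] by simp
    qed
    ultimately show ?thesis by blast
  qed
qed

section \<open>Relative cycles modulo an acyclic subspace\<close>

definition augmentation :: "'a rat_chain \<Rightarrow> rat"
  where "augmentation = chain_ext (*) (\<lambda>_. 1)"

lemma vector_space_rat: "vector_space ((*) :: rat \<Rightarrow> rat \<Rightarrow> rat)"
  by unfold_locales (simp_all add: algebra_simps)

lemma linear_augmentation: "Vector_Spaces.linear rscale (*) augmentation"
  unfolding augmentation_def by (rule linear_chain_ext[OF vector_space_rat])

interpretation ag: Vector_Spaces.linear rscale "(*)" augmentation
  by (rule linear_augmentation)

lemma augmentation_single [simp]: "augmentation (Poly_Mapping.single \<sigma> r) = r"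
  unfolding augmentation_def chain_ext_single[OF vector_space_rat] by simp

lemma augmentation_boundary: "augmentation (rat_boundary (Suc 0) c) = 0"
proof (rule linear_eq_on_chains[of "(*)" "\<lambda>c. augmentation (rat_boundary (Suc 0) c)" "\<lambda>_. 0" c])
  show "Vector_Spaces.linear rscale (*) (\<lambda>c. augmentation (rat_boundary (Suc 0) c))"
    by unfold_locales (simp_all add: rb.add rb.scale ag.add ag.scale algebra_simps)
  show "Vector_Spaces.linear rscale (*) (\<lambda>_. 0)"
    by unfold_locales (simp_all add: algebra_simps)
qed (simp add: rat_boundary_single ag.add)

lemma rat_cycles_0: "c \<in> rat_relcycles 0 X S \<longleftrightarrow> c \<in> rchains 0 X"
  using rc.subspace_0[OF subspace_rchains] by (auto simp: mem_rat_relcycles rat_boundary_eq)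

lemma point_simplex:
  assumes "a \<in> topspace X" shows "singular_simplex 0 X (restrict (\<lambda>_. a) (standard_simplex 0))"
  using assms by (simp add: singular_simplex_def)

text \<open>Augmentation kills boundaries. Applied to a relation between c and the point, it gives q
  times the augmentation of c plus r equal to zero, so q is nonzero and the relation can be solved
  for c.\<close>

lemma rank_le_1_dim_0:
  assumes rk: "rat_rank_le_1 0 X {}" and \<sigma>: "singular_simplex 0 X \<sigma>" and c: "c \<in> rchains 0 X"
  shows "c - rscale (augmentation c) (Poly_Mapping.single \<sigma> 1) \<in> rat_relboundaries 0 X {}"
proof -
  let ?s = "Poly_Mapping.single \<sigma> (1::rat)"
  have "c \<in> rat_relcycles 0 X {}" "?s \<in> rat_relcycles 0 X {}"
    using c single_in_rchains[OF \<sigma>] by (simp_all add: rat_cycles_0)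
  then obtain q r where qr: "(q, r) \<noteq> (0, 0)" "rscale q c + rscale r ?s \<in> rat_relboundaries 0 X {}"
    using rk unfolding rat_rank_le_1_def by blast
  then obtain d where "d \<in> rchains (Suc 0) X" "rscale q c + rscale r ?s = rat_boundary (Suc 0) d"
    unfolding mem_rat_boundaries by blast
  then have "augmentation (rscale q c + rscale r ?s) = 0" by (simp only: augmentation_boundary)
  then have eq: "q * augmentation c + r = 0" by (simp add: ag.add ag.scale del: rscale_single)
  then have q: "q \<noteq> 0" using qr(1) by auto
  have "c - rscale (augmentation c) ?s = rscale (1 / q) (rscale q c + rscale r ?s)"
  proof -
    have "r = - (q * augmentation c)" using eq by (simp add: add_eq_0_iff)
    then show ?thesis using q by (simp add: rc.scale_right_diff_distrib del: rscale_single)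
  qed
  then show ?thesis using rc.subspace_scale[OF subspace_rat_relboundaries qr(2)] by metis
qed

lemma rchains_in_relboundaries:
  assumes "c \<in> rchains p (subtopology X S)" shows "c \<in> rat_relboundaries p X S"
  unfolding mem_rat_relboundaries using assms rc.subspace_0[OF subspace_rchains] rc.subspace_neg[OF subspace_rchains assms]
  by (intro bexI[of _ 0]) (auto simp: rb.zero)

lemma boundaries_in_relboundaries: "rat_relboundaries p X {} \<subseteq> rat_relboundaries p X S"
proof
  fix c assume "c \<in> rat_relboundaries p X {}"
  then obtain d where "d \<in> rchains (Suc p) X" "c = rat_boundary (Suc p) d"
    unfolding mem_rat_boundaries by blast
  then show "c \<in> rat_relboundaries p X S"
    unfolding mem_rat_relboundaries using rc.subspace_0[OF subspace_rchains] by (intro bexI[of _ d]) auto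
qed

lemma cycles_in_relcycles: "rat_relcycles p X {} \<subseteq> rat_relcycles p X S"
  unfolding subset_iff using rc.subspace_0[OF subspace_rchains] by (auto simp: mem_rat_relcycles)

text \<open>Acyclicity over the rationals on the level of chains: a point and the rank bound in
  degree zero together say that zero-cycles are classified by their augmentation.\<close>

locale acyclic_subspace =
  fixes X :: "'a topology" and A :: "'a set"
  assumes acyclic_pos: "\<And>p. 0 < p \<Longrightarrow> rat_relcycles p (subtopology X A) {} \<subseteq> rat_relboundaries p (subtopology X A) {}"
    and acyclic_0: "rat_rank_le_1 0 (subtopology X A) {}"
    and nonempty: "topspace X \<inter> A \<noteq> {}"
begin

lemma cycle_bounds:
  assumes "b \<in> rchains p (subtopology X A)" "rat_boundary p b = 0" "p = 0 \<Longrightarrow> augmentation b = 0"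
  obtains d where "d \<in> rchains (Suc p) (subtopology X A)" "b = rat_boundary (Suc p) d"
proof (cases "p = 0")
  case True
  obtain a where "a \<in> topspace (subtopology X A)" using nonempty by auto
  then have "b - rscale (augmentation b) (Poly_Mapping.single (restrict (\<lambda>_. a) (standard_simplex 0)) 1)
      \<in> rat_relboundaries 0 (subtopology X A) {}"
    using assms(1) True by (intro rank_le_1_dim_0[OF acyclic_0] point_simplex) auto
  then have "b \<in> rat_relboundaries 0 (subtopology X A) {}" using assms(3) True by simp
  then show thesis using that True unfolding mem_rat_boundaries by blast
next
  case False
  then have "b \<in> rat_relboundaries p (subtopology X A) {}"
    using acyclic_pos[of p] assms(1,2) by (auto simp: mem_rat_cycles)
  then show thesis using that unfolding mem_rat_boundaries by blast
qed

text \<open>The boundary of c is a cycle in A, with zero augmentation in degree zero, so it bounds a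
  chain d in A, and c - d is an absolute cycle. This is surjectivity of the map from absolute to
  relative homology.\<close>

lemma relcycle_decompose:
  assumes c: "c \<in> rat_relcycles (Suc p) X A"
  obtains z where "z \<in> rat_relcycles (Suc p) X {}" "c - z \<in> rchains (Suc p) (subtopology X A)"
proof -
  have c': "c \<in> rchains (Suc p) X" "rat_boundary (Suc p) c \<in> rchains p (subtopology X A)"
    using c by (auto simp: mem_rat_relcycles)
  have "rat_boundary p (rat_boundary (Suc p) c) = 0"
    using rat_boundary_boundary[of c "p - 1" X] c'(1) by (cases p) (auto simp: rat_boundary_eq)
  moreover have "augmentation (rat_boundary (Suc p) c) = 0" if "p = 0"
    using that augmentation_boundary by simp
  ultimately obtain d where d: "d \<in> rchains (Suc p) (subtopology X A)" "rat_boundary (Suc p) c = rat_boundary (Suc p) d"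
    using cycle_bounds[OF c'(2)] by metis
  have "c - d \<in> rat_relcycles (Suc p) X {}"
    using rc.subspace_diff[OF subspace_rchains c'(1) rchains_mono[OF d(1)]] d(2)
    by (simp add: mem_rat_cycles rb.diff)
  then show thesis using that[of "c - d"] d(1) by simp
qed

text \<open>Injectivity of the same map: the part of the relation that lies in A is a cycle there,
  hence a boundary, and can be absorbed into the bounding chain.\<close>

lemma cycle_relboundary_imp_boundary:
  assumes z: "z \<in> rat_relcycles (Suc p) X {}" "z \<in> rat_relboundaries (Suc p) X A"
  shows "z \<in> rat_relboundaries (Suc p) X {}"
proof -
  obtain d where d: "d \<in> rchains (Suc (Suc p)) X"
    "rat_boundary (Suc (Suc p)) d - z \<in> rchains (Suc p) (subtopology X A)"
    using z(2) unfolding mem_rat_relboundaries by blast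
  have "rat_boundary (Suc p) (rat_boundary (Suc (Suc p)) d - z) = 0"
    using rat_boundary_boundary[OF d(1)] z(1) by (simp add: rb.diff mem_rat_cycles)
  then obtain e where e: "e \<in> rchains (Suc (Suc p)) (subtopology X A)"
    "rat_boundary (Suc (Suc p)) d - z = rat_boundary (Suc (Suc p)) e"
    using cycle_bounds[OF d(2)] by blast
  have "z = rat_boundary (Suc (Suc p)) (d - e)"
    using e(2) by (simp add: rb.diff algebra_simps)
  then show ?thesis
    unfolding mem_rat_boundaries using rc.subspace_diff[OF subspace_rchains d(1) rchains_mono[OF e(1)]] by blast
qed

lemma relcycle_homologous_cycle:
  assumes "c \<in> rat_relcycles (Suc p) X A"
  obtains z where "z \<in> rat_relcycles (Suc p) X {}" "c - z \<in> rat_relboundaries (Suc p) X A"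
  using relcycle_decompose[OF assms] rchains_in_relboundaries by metis

lemma relative_trivial:
  assumes "rat_relcycles (Suc p) X {} \<subseteq> rat_relboundaries (Suc p) X {}"
  shows "rat_relcycles (Suc p) X A \<subseteq> rat_relboundaries (Suc p) X A"
proof
  fix c assume "c \<in> rat_relcycles (Suc p) X A"
  then obtain z where z: "z \<in> rat_relcycles (Suc p) X {}" "c - z \<in> rat_relboundaries (Suc p) X A"
    by (rule relcycle_homologous_cycle)
  have "z \<in> rat_relboundaries (Suc p) X A"
    using z(1) assms boundaries_in_relboundaries by blast
  then have "(c - z) + z \<in> rat_relboundaries (Suc p) X A"
    by (rule rc.subspace_add[OF subspace_rat_relboundaries z(2)])
  then show "c \<in> rat_relboundaries (Suc p) X A" by simp
qed

lemma relative_trivial_0: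
  assumes "rat_rank_le_1 0 X {}"
  shows "rat_relcycles 0 X A \<subseteq> rat_relboundaries 0 X A"
proof
  fix c assume "c \<in> rat_relcycles 0 X A"
  then have c: "c \<in> rchains 0 X" by (simp add: rat_cycles_0)
  \<comment> \<open>The reference point is taken in A, so its multiples vanish relative to
    A.\<close>
  obtain a where a: "a \<in> topspace X" "a \<in> A" using nonempty by blast
  let ?s = "Poly_Mapping.single (restrict (\<lambda>_. a) (standard_simplex 0)) (1 :: rat)"
  have "c - rscale (augmentation c) ?s \<in> rat_relboundaries 0 X A"
    using rank_le_1_dim_0[OF assms point_simplex[OF a(1)] c] boundaries_in_relboundaries by blast
  moreover have "rscale (augmentation c) ?s \<in> rat_relboundaries 0 X A"
    using a by (intro rchains_in_relboundaries rc.subspace_scale[OF subspace_rchains] single_in_rchains point_simplex) simp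
  ultimately have "(c - rscale (augmentation c) ?s) + rscale (augmentation c) ?s \<in> rat_relboundaries 0 X A"
    by (rule rc.subspace_add[OF subspace_rat_relboundaries])
  then show "c \<in> rat_relboundaries 0 X A" by (simp del: rscale_single)
qed

lemma relative_rank_le_1:
  assumes "rat_rank_le_1 (Suc p) X {}"
  shows "rat_rank_le_1 (Suc p) X A"
  unfolding rat_rank_le_1_def
proof (intro ballI)
  fix c d assume c: "c \<in> rat_relcycles (Suc p) X A" and d: "d \<in> rat_relcycles (Suc p) X A"
  obtain y where y: "y \<in> rat_relcycles (Suc p) X {}" "c - y \<in> rat_relboundaries (Suc p) X A"
    using c by (rule relcycle_homologous_cycle)
  obtain z where z: "z \<in> rat_relcycles (Suc p) X {}" "d - z \<in> rat_relboundaries (Suc p) X A"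
    using d by (rule relcycle_homologous_cycle)
  obtain q r where qr: "(q, r) \<noteq> (0, 0)" "rscale q y + rscale r z \<in> rat_relboundaries (Suc p) X {}"
    using assms y(1) z(1) unfolding rat_rank_le_1_def by blast
  have "rscale q c + rscale r d
      = (rscale q (c - y) + rscale r (d - z)) + (rscale q y + rscale r z)"
    by (simp add: rc.scale_right_diff_distrib algebra_simps)
  also have "\<dots> \<in> rat_relboundaries (Suc p) X A"
  proof (rule rc.subspace_add[OF subspace_rat_relboundaries])
    show "rscale q (c - y) + rscale r (d - z) \<in> rat_relboundaries (Suc p) X A"
      by (intro rc.subspace_add[OF subspace_rat_relboundaries] rc.subspace_scale[OF subspace_rat_relboundaries] y(2) z(2))
    show "rscale q y + rscale r z \<in> rat_relboundaries (Suc p) X A"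
      using qr(2) boundaries_in_relboundaries by blast
  qed
  finally show "\<exists>q r. (q, r) \<noteq> (0, 0) \<and> rscale q c + rscale r d \<in> rat_relboundaries (Suc p) X A"
    using qr(1) by blast
qed

lemma relative_map_trivial:
  assumes f: "continuous_map X X f" "f ` A \<subseteq> A"
    and abs: "\<And>z. z \<in> rat_relcycles (Suc p) X {} \<Longrightarrow> rat_chain_map (Suc p) f z \<in> rat_relboundaries (Suc p) X {}"
    and c: "c \<in> rat_relcycles (Suc p) X A"
  shows "rat_chain_map (Suc p) f c \<in> rat_relboundaries (Suc p) X A"
proof -
  obtain z where z: "z \<in> rat_relcycles (Suc p) X {}" "c - z \<in> rat_relboundaries (Suc p) X A"
    using c by (rule relcycle_homologous_cycle)
  have "rat_chain_map (Suc p) f (c - z) + rat_chain_map (Suc p) f z \<in> rat_relboundaries (Suc p) X A"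
    using rat_chain_map_relboundaries[OF f z(2)] abs[OF z(1)] boundaries_in_relboundaries[of "Suc p" X A]
    by (intro rc.subspace_add[OF subspace_rat_relboundaries]) auto
  then show ?thesis by (simp add: rm.diff)
qed

lemma absolute_map_trivial:
  assumes f: "continuous_map X X f"
    and rel: "\<And>c. c \<in> rat_relcycles (Suc p) X A \<Longrightarrow> rat_chain_map (Suc p) f c \<in> rat_relboundaries (Suc p) X A"
    and z: "z \<in> rat_relcycles (Suc p) X {}"
  shows "rat_chain_map (Suc p) f z \<in> rat_relboundaries (Suc p) X {}"
  using z cycles_in_relcycles[of "Suc p" X A] rel rat_chain_map_relcycles[OF f _ z, of "{}"]
  by (intro cycle_relboundary_imp_boundary) auto

end

section \<open>Evaluation of cohomology classes\<close>

definition pairing :: "(((nat \<Rightarrow> real) \<Rightarrow> 'a) \<Rightarrow> rat) \<Rightarrow> 'a rat_chain \<Rightarrow> rat"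
  where "pairing \<phi> = chain_ext (*) \<phi>"

lemma linear_pairing: "Vector_Spaces.linear rscale (*) (pairing \<phi>)"
  unfolding pairing_def by (rule linear_chain_ext[OF vector_space_rat])

interpretation pr: Vector_Spaces.linear rscale "(*)" "pairing \<phi>" for \<phi>
  by (rule linear_pairing)

lemma pairing_single [simp]: "pairing \<phi> (Poly_Mapping.single \<sigma> r) = r * \<phi> \<sigma>"
  unfolding pairing_def chain_ext_single[OF vector_space_rat] by simp

lemma pairing_cong:
  assumes "c \<in> rchains p X" "\<And>\<sigma>. singular_simplex p X \<sigma> \<Longrightarrow> \<phi> \<sigma> = \<psi> \<sigma>"
  shows "pairing \<phi> c = pairing \<psi> c"
  unfolding pairing_def chain_ext_def by (rule sum.cong) (use assms in \<open>auto simp: rchains_def\<close>)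

text \<open>The coboundary formula without restriction to the simplices of a space. It is the exact
  adjoint of the boundary on all formal chains, whereas \<open>rat_coboundary\<close> has to return
  extensional functions.\<close>

definition delta :: "nat \<Rightarrow> (((nat \<Rightarrow> real) \<Rightarrow> 'a) \<Rightarrow> rat) \<Rightarrow> ((nat \<Rightarrow> real) \<Rightarrow> 'a) \<Rightarrow> rat"
  where "delta p \<psi> \<sigma> = (\<Sum>k\<le>Suc p. (-1) ^ k * \<psi> (singular_face (Suc p) k \<sigma>))"

lemma rat_coboundary_eq: "rat_coboundary p X \<psi> = restrict (delta p \<psi>) (singular_simplex_set (Suc p) X)"
  by (simp add: rat_coboundary_def delta_def fun_eq_iff restrict_def del: sum.atMost_Suc)

lemma pairing_boundary: "pairing \<psi> (rat_boundary (Suc p) c) = pairing (delta p \<psi>) c"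
proof (rule linear_eq_on_chains[of "(*)" "\<lambda>c. pairing \<psi> (rat_boundary (Suc p) c)"])
  show "Vector_Spaces.linear rscale (*) (\<lambda>c. pairing \<psi> (rat_boundary (Suc p) c))"
    by unfold_locales (simp_all add: rb.add rb.scale pr.add pr.scale algebra_simps)
  show "Vector_Spaces.linear rscale (*) (pairing (delta p \<psi>))" by (rule linear_pairing)
qed (simp add: rat_boundary_single pr.sum delta_def del: sum.atMost_Suc)

lemma pairing_chain_map: "pairing \<phi> (rat_chain_map p f c) = pairing (\<lambda>\<sigma>. \<phi> (simplex_map p f \<sigma>)) c"
proof (rule linear_eq_on_chains[of "(*)" "\<lambda>c. pairing \<phi> (rat_chain_map p f c)"])
  show "Vector_Spaces.linear rscale (*) (\<lambda>c. pairing \<phi> (rat_chain_map p f c))"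
    by unfold_locales (simp_all add: rm.add rm.scale pr.add pr.scale algebra_simps)
  show "Vector_Spaces.linear rscale (*) (pairing (\<lambda>\<sigma>. \<phi> (simplex_map p f \<sigma>)))" by (rule linear_pairing)
qed simp

text \<open>Over a field, a cochain vanishing on all cycles factors through a linear splitting of the
  boundary map.\<close>

lemma coboundary_if_vanishes_on_cycles:
  assumes van: "\<And>z. z \<in> rat_relcycles (Suc p) X {} \<Longrightarrow> pairing \<phi> z = 0"
  obtains \<psi> where "\<And>\<sigma>. singular_simplex (Suc p) X \<sigma> \<Longrightarrow> \<phi> \<sigma> = delta p \<psi> \<sigma>"
proof -
  interpret vp: vector_space_pair "rscale :: rat \<Rightarrow> 'a rat_chain \<Rightarrow> _" "rscale :: rat \<Rightarrow> 'a rat_chain \<Rightarrow> _" ..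
  from vp.linear_exists_right_inverse_on[OF linear_rat_boundary subspace_rchains]
  obtain g where "range g \<subseteq> rchains (Suc p) X \<and> Vector_Spaces.linear rscale rscale g \<and>
    (\<forall>b\<in>rat_boundary (Suc p) ` rchains (Suc p) X. rat_boundary (Suc p) (g b) = b)" ..
  then have g: "range g \<subseteq> rchains (Suc p) X" "Vector_Spaces.linear rscale rscale g"
    "\<And>b. b \<in> rat_boundary (Suc p) ` rchains (Suc p) X \<Longrightarrow> rat_boundary (Suc p) (g b) = b"
    by auto
  interpret g: Vector_Spaces.linear rscale rscale g by (rule g(2))
  define \<psi> where "\<psi> = (\<lambda>\<tau>. pairing \<phi> (g (Poly_Mapping.single \<tau> 1)))"
  have \<psi>: "pairing \<psi> b = pairing \<phi> (g b)" for b
  proof (rule linear_eq_on_chains[OF linear_pairing, of "\<lambda>b. pairing \<phi> (g b)"])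
    show "Vector_Spaces.linear rscale (*) (\<lambda>b. pairing \<phi> (g b))"
      by unfold_locales (simp_all add: g.add g.scale pr.add pr.scale algebra_simps)
  qed (simp add: \<psi>_def)
  have "\<phi> \<sigma> = delta p \<psi> \<sigma>" if \<sigma>: "singular_simplex (Suc p) X \<sigma>" for \<sigma>
  proof -
    let ?s = "Poly_Mapping.single \<sigma> (1 :: rat)"
    have s: "?s \<in> rchains (Suc p) X" using \<sigma> by (rule single_in_rchains)
    have "rat_boundary (Suc p) (g (rat_boundary (Suc p) ?s)) = rat_boundary (Suc p) ?s"
      using g(3) s by blast
    \<comment> \<open>A simplex and the chosen filling g of its boundary differ by a cycle, on which
      the cochain vanishes. So its value depends only on the boundary.\<close>
    then have "?s - g (rat_boundary (Suc p) ?s) \<in> rat_relcycles (Suc p) X {}"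
      using rc.subspace_diff[OF subspace_rchains s] g(1) by (auto simp: mem_rat_cycles rb.diff)
    then have "pairing \<phi> ?s = pairing \<phi> (g (rat_boundary (Suc p) ?s))"
      using van by (fastforce simp: pr.diff)
    also have "\<dots> = delta p \<psi> \<sigma>"
      unfolding \<psi>[symmetric] pairing_boundary by simp
    finally show ?thesis by simp
  qed
  then show thesis by (rule that)
qed

text \<open>Unpacks an eigenvector in the quotient of extensional cochains to cochains: a cocycle,
  not a coboundary, which pulls back to its multiple by a up to a coboundary.\<close>

lemma cohomology_eigenvector:
  assumes "is_eigenvalue (rat_cohomology (Suc p) X) (rat_cohom_induced (Suc p) X f) a"
  obtains \<phi> \<psi> where "\<And>\<sigma>. singular_simplex (Suc (Suc p)) X \<sigma> \<Longrightarrow> delta (Suc p) \<phi> \<sigma> = 0"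
    "\<not> (\<exists>\<xi>. \<forall>\<sigma>. singular_simplex (Suc p) X \<sigma> \<longrightarrow> \<phi> \<sigma> = delta p \<xi> \<sigma>)"
    "\<And>\<sigma>. singular_simplex (Suc p) X \<sigma> \<Longrightarrow> \<phi> (simplex_map (Suc p) f \<sigma>) = a * \<phi> \<sigma> + delta p \<psi> \<sigma>"
proof -
  let ?q = "Suc p"
  let ?S = "singular_simplex_set ?q X"
  let ?V = "rat_cocycle_space ?q X"
  let ?W = "rat_coboundaries ?q X"
  have fs: "carrier (ring.func_space rat_field U) = U \<rightarrow>\<^sub>E UNIV"
    "\<zero>\<^bsub>ring.func_space rat_field U\<^esub> = restrict (\<lambda>_. 0) U"
    "x \<oplus>\<^bsub>ring.func_space rat_field U\<^esub> y = restrict (\<lambda>v. x v + y v) U"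
    "c \<odot>\<^bsub>ring.func_space rat_field U\<^esub> x = restrict (\<lambda>v. c * x v) U" for U :: "((nat \<Rightarrow> real) \<Rightarrow> 'a) set" and x y c
    by (simp_all add: ring.func_space_def[OF class_ring.ring_axioms])
  have W: "w \<in> ?W \<longleftrightarrow> (\<exists>\<psi>. w = restrict (delta p \<psi>) ?S)" for w
  proof
    assume "w \<in> ?W"
    then show "\<exists>\<psi>. w = restrict (delta p \<psi>) ?S"
      unfolding rat_coboundaries_def rat_coboundary_eq by auto
  next
    assume "\<exists>\<psi>. w = restrict (delta p \<psi>) ?S"
    then obtain \<psi> where \<psi>: "w = restrict (delta p \<psi>) ?S" by blast
    have "delta p \<psi> \<sigma> = delta p (restrict \<psi> (singular_simplex_set p X)) \<sigma>" if "\<sigma> \<in> ?S" for \<sigma>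
      unfolding delta_def using singular_simplex_singular_face[of ?q X \<sigma>] that by (intro sum.cong) auto
    then have "w = rat_coboundary p X (restrict \<psi> (singular_simplex_set p X))"
      unfolding \<psi> rat_coboundary_eq by (intro restrict_ext)
    then show "w \<in> ?W" unfolding rat_coboundaries_def by (auto simp: fs)
  qed
  have delta_add: "delta p (\<lambda>v. x v + y v) \<sigma> = delta p x \<sigma> + delta p y \<sigma>"
    and delta_scale: "delta p (\<lambda>v. c * x v) \<sigma> = c * delta p x \<sigma>" for x y :: "((nat \<Rightarrow> real) \<Rightarrow> 'a) \<Rightarrow> rat" and c \<sigma>
    unfolding delta_def by (simp_all only: distrib_left sum.distrib sum_distrib_left mult_ac)
  have coset: "?W +>\<^bsub>?V\<^esub> x = {restrict (\<lambda>\<sigma>. delta p \<psi> \<sigma> + x \<sigma>) ?S | \<psi>. True}" for x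
  proof -
    have add: "restrict (delta p \<psi>) ?S \<oplus>\<^bsub>?V\<^esub> x = restrict (\<lambda>\<sigma>. delta p \<psi> \<sigma> + x \<sigma>) ?S" for \<psi>
      by (simp add: fs cong: restrict_cong)
    have Weq: "?W = range (\<lambda>\<psi>. restrict (delta p \<psi>) ?S)" using W by blast
    have "?W +>\<^bsub>?V\<^esub> x = (\<lambda>w. w \<oplus>\<^bsub>?V\<^esub> x) ` ?W"
      unfolding a_r_coset_def r_coset_def by auto
    also have "\<dots> = range (\<lambda>\<psi>. restrict (\<lambda>\<sigma>. delta p \<psi> \<sigma> + x \<sigma>) ?S)"
      unfolding Weq image_image add ..
    also have "\<dots> = {restrict (\<lambda>\<sigma>. delta p \<psi> \<sigma> + x \<sigma>) ?S | \<psi>. True}"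
      by blast
    finally show ?thesis .
  qed
  obtain v where v: "v \<in> carrier (rat_cohomology ?q X)" "v \<noteq> \<zero>\<^bsub>rat_cohomology ?q X\<^esub>"
    "rat_cohom_induced ?q X f v = a \<odot>\<^bsub>rat_cohomology ?q X\<^esub> v"
    using assms unfolding is_eigenvalue_def by blast
  then obtain \<phi> where \<phi>: "\<phi> \<in> rat_cocycles ?q X" "v = ?W +>\<^bsub>?V\<^esub> \<phi>"
    unfolding rat_cohomology_def quotient_space_def A_RCOSETS_def RCOSETS_def a_r_coset_def by auto
  have ext: "restrict \<phi> ?S = \<phi>"
    using \<phi>(1) by (auto simp: rat_cocycles_def fs intro: restrict_PiE_iff extensional_restrict)
  have zero: "delta p (\<lambda>_. 0) \<sigma> = 0" for \<sigma> :: "(nat \<Rightarrow> real) \<Rightarrow> 'a" by (simp add: delta_def)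
  have \<phi>v: "\<phi> \<in> v"
    unfolding \<phi>(2) coset using ext by (auto simp: zero intro!: exI[of _ "\<lambda>_. 0"])
  let ?f\<phi> = "rat_cochain_map ?q X f \<phi>"
  \<comment> \<open>Adding the zero coboundary shows that the cochain lies in its own coset; the
    equation between cosets can then be read at this element.\<close>
  have "restrict ?f\<phi> ?S \<in> ?W +>\<^bsub>?V\<^esub> ?f\<phi>"
    unfolding coset by (auto simp: zero intro!: exI[of _ "\<lambda>_. 0"])
  then have "restrict ?f\<phi> ?S \<in> rat_cohom_induced ?q X f v"
    unfolding rat_cohom_induced_def coset_map_def using \<phi>v by blast
  then have "restrict ?f\<phi> ?S \<in> coset_map ?V ?W (\<lambda>x. a \<odot>\<^bsub>?V\<^esub> x) v"
    unfolding v(3) by (simp add: rat_cohomology_def quotient_space_def)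
  then obtain x where x: "x \<in> v" "restrict ?f\<phi> ?S \<in> ?W +>\<^bsub>?V\<^esub> (a \<odot>\<^bsub>?V\<^esub> x)"
    unfolding coset_map_def by blast
  obtain \<psi>1 where \<psi>1: "x = restrict (\<lambda>\<sigma>. delta p \<psi>1 \<sigma> + \<phi> \<sigma>) ?S"
    using x(1) unfolding \<phi>(2) coset by blast
  obtain \<psi>2 where \<psi>2: "restrict ?f\<phi> ?S = restrict (\<lambda>\<sigma>. delta p \<psi>2 \<sigma> + (a \<odot>\<^bsub>?V\<^esub> x) \<sigma>) ?S"
    using x(2) unfolding coset by blast
  show thesis
  \<comment> \<open>The eigenvector equation supplies some x in the class with f*\<phi> = a x +
    \<delta>\<psi>2, while x itself is \<phi> + \<delta>\<psi>1. Substitution collects the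
    correction \<psi>2 + a \<psi>1.\<close>
  proof (rule that[of \<phi> "\<lambda>v. \<psi>2 v + a * \<psi>1 v"])
    show "delta (Suc p) \<phi> \<sigma> = 0" if "singular_simplex (Suc ?q) X \<sigma>" for \<sigma>
    proof -
      have "rat_coboundary ?q X \<phi> = restrict (\<lambda>_. 0) (singular_simplex_set (Suc ?q) X)"
        using \<phi>(1) by (simp add: rat_cocycles_def fs)
      from fun_cong[OF this, of \<sigma>] that show ?thesis by (simp add: rat_coboundary_eq)
    qed
    show "\<phi> (simplex_map ?q f \<sigma>) = a * \<phi> \<sigma> + delta p (\<lambda>v. \<psi>2 v + a * \<psi>1 v) \<sigma>"
      if \<sigma>: "singular_simplex ?q X \<sigma>" for \<sigma>
      using fun_cong[OF \<psi>2, of \<sigma>] \<sigma>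
      by (simp add: rat_cochain_map_def fs \<psi>1 delta_add delta_scale algebra_simps)
    show "\<not> (\<exists>\<xi>. \<forall>\<sigma>. singular_simplex ?q X \<sigma> \<longrightarrow> \<phi> \<sigma> = delta p \<xi> \<sigma>)"
    proof
      assume "\<exists>\<xi>. \<forall>\<sigma>. singular_simplex ?q X \<sigma> \<longrightarrow> \<phi> \<sigma> = delta p \<xi> \<sigma>"
      then obtain \<xi> where \<xi>: "\<And>\<sigma>. \<sigma> \<in> ?S \<Longrightarrow> \<phi> \<sigma> = delta p \<xi> \<sigma>" by blast
      have "v = ?W"
      proof (intro subset_antisym subsetI)
        fix w assume "w \<in> v"
        then obtain \<psi> where "w = restrict (\<lambda>\<sigma>. delta p \<psi> \<sigma> + \<phi> \<sigma>) ?S" unfolding \<phi>(2) coset by blast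
        also have "\<dots> = restrict (delta p (\<lambda>v. \<psi> v + \<xi> v)) ?S"
          by (rule restrict_ext) (simp add: \<xi> delta_add)
        finally show "w \<in> ?W" unfolding W by blast
      next
        fix w assume "w \<in> ?W"
        then obtain \<psi> where "w = restrict (delta p \<psi>) ?S" unfolding W by blast
        also have "\<dots> = restrict (\<lambda>\<sigma>. delta p (\<lambda>v. \<psi> v + (-1) * \<xi> v) \<sigma> + \<phi> \<sigma>) ?S"
          by (rule restrict_ext, subst delta_add, subst delta_scale) (simp add: \<xi>)
        finally show "w \<in> v" unfolding \<phi>(2) coset by blast
      qed
      then show False using v(2) by (simp add: rat_cohomology_def quotient_space_def)
    qed
  qed
qed

text \<open>Evaluation of an eigenclass turns its eigenvalue into the action on cycles.\<close>

lemma eigenvalue_zero_iff: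
  assumes eig: "is_eigenvalue (rat_cohomology (Suc p) X) (rat_cohom_induced (Suc p) X f) a"
    and f: "continuous_map X X f" and rk: "rat_rank_le_1 (Suc p) X {}"
  shows "a = 0 \<longleftrightarrow> (\<forall>z\<in>rat_relcycles (Suc p) X {}. rat_chain_map (Suc p) f z \<in> rat_relboundaries (Suc p) X {})"
proof -
  let ?q = "Suc p"
  obtain \<phi> \<psi> where \<phi>: "\<And>\<sigma>. singular_simplex (Suc ?q) X \<sigma> \<Longrightarrow> delta ?q \<phi> \<sigma> = 0"
    "\<not> (\<exists>\<xi>. \<forall>\<sigma>. singular_simplex ?q X \<sigma> \<longrightarrow> \<phi> \<sigma> = delta p \<xi> \<sigma>)"
    "\<And>\<sigma>. singular_simplex ?q X \<sigma> \<Longrightarrow> \<phi> (simplex_map ?q f \<sigma>) = a * \<phi> \<sigma> + delta p \<psi> \<sigma>"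
    using cohomology_eigenvector[OF eig] by blast
  have bd: "pairing \<phi> b = 0" if b: "b \<in> rat_relboundaries ?q X {}" for b
  proof -
    obtain e where e: "e \<in> rchains (Suc ?q) X" "b = rat_boundary (Suc ?q) e"
      using b unfolding mem_rat_boundaries by blast
    have "pairing \<phi> b = pairing (\<lambda>_. 0) e"
      unfolding e(2) pairing_boundary by (rule pairing_cong[OF e(1)]) (rule \<phi>(1))
    then show ?thesis by (simp add: pairing_def chain_ext_def)
  qed
  have map: "pairing \<phi> (rat_chain_map ?q f z) = a * pairing \<phi> z" if z: "z \<in> rat_relcycles ?q X {}" for z
  proof -
    have "pairing \<phi> (rat_chain_map ?q f z) = pairing (\<lambda>\<sigma>. a * \<phi> \<sigma> + delta p \<psi> \<sigma>) z"
      unfolding pairing_chain_map using z \<phi>(3) by (intro pairing_cong[of _ ?q X]) (auto simp: mem_rat_cycles)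
    also have "\<dots> = a * pairing \<phi> z + pairing (delta p \<psi>) z"
      by (simp add: pairing_def chain_ext_def algebra_simps sum.distrib sum_distrib_left)
    also have "pairing (delta p \<psi>) z = 0"
      using z by (simp add: mem_rat_cycles pr.zero flip: pairing_boundary)
    finally show ?thesis by simp
  qed
  \<comment> \<open>A cocycle that is not a coboundary is nonzero on some cycle. By the rank bound,
    this cycle serves as a generator of the homology.\<close>
  obtain z0 where z0: "z0 \<in> rat_relcycles ?q X {}" "pairing \<phi> z0 \<noteq> 0"
    using coboundary_if_vanishes_on_cycles[of p X \<phi>] \<phi>(2) by metis
  show ?thesis
  proof
    assume a: "a = 0"
    show "\<forall>z\<in>rat_relcycles ?q X {}. rat_chain_map ?q f z \<in> rat_relboundaries ?q X {}"
    proof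
      fix z assume z: "z \<in> rat_relcycles ?q X {}"
      have fz: "rat_chain_map ?q f z \<in> rat_relcycles ?q X {}"
        by (rule rat_chain_map_relcycles[OF f _ z]) simp
      obtain q r where qr: "(q, r) \<noteq> (0, 0)" "rscale q (rat_chain_map ?q f z) + rscale r z0 \<in> rat_relboundaries ?q X {}"
        using rk fz z0(1) unfolding rat_rank_le_1_def by blast
      \<comment> \<open>Evaluating \<phi> on the relation annihilates the boundary and, since a = 0,
        also the image of z. What remains is r times the nonzero value at z0.\<close>
      have "r = 0"
        using bd[OF qr(2)] map[OF z] z0(2) a by (simp add: pr.add pr.scale)
      then have "q \<noteq> 0" "rscale q (rat_chain_map ?q f z) \<in> rat_relboundaries ?q X {}" using qr by auto
      then have "rscale (1 / q) (rscale q (rat_chain_map ?q f z)) \<in> rat_relboundaries ?q X {}"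
        using rc.subspace_scale[OF subspace_rat_relboundaries] by blast
      then show "rat_chain_map ?q f z \<in> rat_relboundaries ?q X {}" using \<open>q \<noteq> 0\<close> by simp
    qed
  next
    assume "\<forall>z\<in>rat_relcycles ?q X {}. rat_chain_map ?q f z \<in> rat_relboundaries ?q X {}"
    then have "a * pairing \<phi> z0 = 0" using map[OF z0(1)] bd z0(1) by metis
    then show "a = 0" using z0(2) by simp
  qed
qed

section \<open>Homology classes and traces\<close>

text \<open>The right side does not mention the carrier Z, so homology classes can be treated as
  plain sets of chains.\<close>

lemma coset_eq:
  "B +>\<^bsub>(rat_chain_space p X)\<lparr>carrier := Z\<rparr>\<^esub> c = {d. d - c \<in> B}"
  unfolding a_r_coset_def r_coset_def
  by (auto simp: rat_chain_space_def intro!: bexI[of _ "_ - c"])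

lemma carrier_rat_homology:
  "carrier (rat_homology p X S) = (\<lambda>c. {d. d - c \<in> rat_relboundaries p X S}) ` rat_relcycles p X S"
  unfolding rat_homology_def quotient_space_def A_RCOSETS_def RCOSETS_def
  using coset_eq[where B = "rat_relboundaries p X S" and Z = "rat_relcycles p X S" and p = p and X = X]
  unfolding a_r_coset_def by auto

lemma zero_rat_homology: "\<zero>\<^bsub>rat_homology p X S\<^esub> = rat_relboundaries p X S"
  by (simp add: rat_homology_def quotient_space_def)

lemma rel_class_eq_iff:
  "{e. e - c \<in> rat_relboundaries p X S} = {e. e - d \<in> rat_relboundaries p X S} \<longleftrightarrow> c - d \<in> rat_relboundaries p X S"
proof
  assume eq: "{e. e - c \<in> rat_relboundaries p X S} = {e. e - d \<in> rat_relboundaries p X S}"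
  have "c \<in> {e. e - c \<in> rat_relboundaries p X S}"
    using rc.subspace_0[OF subspace_rat_relboundaries] by simp
  then show "c - d \<in> rat_relboundaries p X S" unfolding eq by simp
next
  assume cd: "c - d \<in> rat_relboundaries p X S"
  have "e - c \<in> rat_relboundaries p X S \<longleftrightarrow> e - d \<in> rat_relboundaries p X S" for e
    using rc.subspace_add[OF subspace_rat_relboundaries _ cd, of "e - c"]
      rc.subspace_diff[OF subspace_rat_relboundaries _ cd, of "e - d"] by auto
  then show "{e. e - c \<in> rat_relboundaries p X S} = {e. e - d \<in> rat_relboundaries p X S}" by blast
qed

lemma rel_class_zero_iff:
  "{e. e - c \<in> rat_relboundaries p X S} = rat_relboundaries p X S \<longleftrightarrow> c \<in> rat_relboundaries p X S"
  using rel_class_eq_iff[of c p X S 0] by simp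

text \<open>Because h sends boundaries to boundaries, all the cosets united in
  \<open>coset_map\<close> coincide, and the union can be evaluated at the representative c.\<close>

lemma coset_map_class:
  assumes h: "Vector_Spaces.linear rscale rscale h"
    and B: "\<And>b. b \<in> rat_relboundaries p X S \<Longrightarrow> h b \<in> rat_relboundaries q Y T"
  shows "coset_map ((rat_chain_space q Y)\<lparr>carrier := Z\<rparr>) (rat_relboundaries q Y T) h
      {d. d - c \<in> rat_relboundaries p X S} = {d. d - h c \<in> rat_relboundaries q Y T}"
proof -
  interpret h: Vector_Spaces.linear rscale rscale h by (rule h)
  have "{e. e - h d \<in> rat_relboundaries q Y T} = {e. e - h c \<in> rat_relboundaries q Y T}"
    if "d - c \<in> rat_relboundaries p X S" for d
    unfolding rel_class_eq_iff using B[OF that] by (simp add: h.diff)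
  moreover have "c \<in> {d. d - c \<in> rat_relboundaries p X S}"
    using rc.subspace_0[OF subspace_rat_relboundaries] by simp
  ultimately show ?thesis unfolding coset_map_def coset_eq by blast
qed

lemma rat_hom_induced_class:
  assumes "continuous_map X Y f" "f ` S \<subseteq> T"
  shows "rat_hom_induced p X S Y T f {d. d - c \<in> rat_relboundaries p X S}
    = {d. d - rat_chain_map p f c \<in> rat_relboundaries p Y T}"
  unfolding rat_hom_induced_def
  by (rule coset_map_class[OF linear_rat_chain_map rat_chain_map_relboundaries[OF assms]])

lemma smult_rat_homology:
  "q \<odot>\<^bsub>rat_homology p X S\<^esub> {d. d - c \<in> rat_relboundaries p X S}
    = {d. d - rscale q c \<in> rat_relboundaries p X S}"
proof -
  have lin: "Vector_Spaces.linear rscale rscale (rscale q)"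
    by unfold_locales (simp_all add: rc.scale_right_distrib mult.commute)
  have "q \<odot>\<^bsub>rat_homology p X S\<^esub> {d. d - c \<in> rat_relboundaries p X S}
    = coset_map (rat_relcycle_space p X S) (rat_relboundaries p X S) (rscale q) {d. d - c \<in> rat_relboundaries p X S}"
    by (simp add: rat_homology_def quotient_space_def rat_chain_space_def rscale_def[abs_def])
  then show ?thesis
    using coset_map_class[OF lin rc.subspace_scale[OF subspace_rat_relboundaries]] by simp
qed

lemma add_rat_homology:
  "{e. e - c \<in> rat_relboundaries p X S} \<oplus>\<^bsub>rat_homology p X S\<^esub> {e. e - d \<in> rat_relboundaries p X S}
    = {e. e - (c + d) \<in> rat_relboundaries p X S}"
proof -
  let ?B = "rat_relboundaries p X S"
  have "{e. e - c \<in> ?B} \<oplus>\<^bsub>rat_homology p X S\<^esub> {e. e - d \<in> ?B} = {x + y | x y. x - c \<in> ?B \<and> y - d \<in> ?B}"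
    unfolding rat_homology_def quotient_space_def set_add_def set_mult_def
    by (auto simp: rat_chain_space_def)
  also have "\<dots> = {e. e - (c + d) \<in> ?B}"
  proof (intro subset_antisym subsetI)
    fix e assume "e \<in> {x + y | x y. x - c \<in> ?B \<and> y - d \<in> ?B}"
    then obtain x y where xy: "e = x + y" "x - c \<in> ?B" "y - d \<in> ?B" by blast
    have eq: "e - (c + d) = (x - c) + (y - d)" unfolding xy(1) by simp
    have "e - (c + d) \<in> ?B"
      unfolding eq by (rule rc.subspace_add[OF subspace_rat_relboundaries xy(2,3)])
    then show "e \<in> {e. e - (c + d) \<in> ?B}" by (rule CollectI)
  next
    fix e assume "e \<in> {e. e - (c + d) \<in> ?B}"
    moreover have "(e - d) - c = e - (c + d)" by simp
    ultimately have "(e - d) - c \<in> ?B" by (simp only: mem_Collect_eq)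
    moreover have "d - d \<in> ?B" using rc.subspace_0[OF subspace_rat_relboundaries] by simp
    moreover have "e = (e - d) + d" by simp
    ultimately show "e \<in> {x + y | x y. x - c \<in> ?B \<and> y - d \<in> ?B}" by blast
  qed
  finally show ?thesis .
qed

lemma vectorspace_rat_homology: "vectorspace rat_field (rat_homology p X S)"
proof -
  let ?H = "rat_homology p X S" and ?Z = "rat_relcycles p X S"
  let ?c = "\<lambda>c. {d. d - c \<in> rat_relboundaries p X S}"
  note ops = add_rat_homology smult_rat_homology
  have mem: "x \<in> carrier ?H \<longleftrightarrow> (\<exists>c\<in>?Z. x = ?c c)" for x
    unfolding carrier_rat_homology by blast
  have zero: "\<zero>\<^bsub>?H\<^esub> = ?c 0" by (simp add: zero_rat_homology)
  note Z0 = rc.subspace_0[OF subspace_rat_relcycles] and Zadd = rc.subspace_add[OF subspace_rat_relcycles]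
    and Zscale = rc.subspace_scale[OF subspace_rat_relcycles] and Zneg = rc.subspace_neg[OF subspace_rat_relcycles]
  have "abelian_group ?H"
  proof (rule abelian_groupI)
    show "x \<oplus>\<^bsub>?H\<^esub> y \<in> carrier ?H" if "x \<in> carrier ?H" "y \<in> carrier ?H" for x y
      using that Zadd unfolding mem by (metis ops(1))
    show "\<zero>\<^bsub>?H\<^esub> \<in> carrier ?H" unfolding mem zero using Z0 by blast
    show "(x \<oplus>\<^bsub>?H\<^esub> y) \<oplus>\<^bsub>?H\<^esub> z = x \<oplus>\<^bsub>?H\<^esub> (y \<oplus>\<^bsub>?H\<^esub> z)"
      if xyz: "x \<in> carrier ?H" "y \<in> carrier ?H" "z \<in> carrier ?H" for x y z
    proof -
      obtain a b c where "x = ?c a" "y = ?c b" "z = ?c c" using xyz unfolding mem by blast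
      then show ?thesis by (simp only: ops add.assoc)
    qed
    show "x \<oplus>\<^bsub>?H\<^esub> y = y \<oplus>\<^bsub>?H\<^esub> x" if xy: "x \<in> carrier ?H" "y \<in> carrier ?H" for x y
    proof -
      obtain a b where "x = ?c a" "y = ?c b" using xy unfolding mem by blast
      then show ?thesis by (simp only: ops add.commute)
    qed
    show "\<zero>\<^bsub>?H\<^esub> \<oplus>\<^bsub>?H\<^esub> x = x" if x: "x \<in> carrier ?H" for x
    proof -
      obtain a where "x = ?c a" using x unfolding mem by blast
      then show ?thesis unfolding zero by (simp only: ops add_0_left)
    qed
    show "\<exists>y\<in>carrier ?H. y \<oplus>\<^bsub>?H\<^esub> x = \<zero>\<^bsub>?H\<^esub>" if x: "x \<in> carrier ?H" for x
    proof -
      obtain a where a: "a \<in> ?Z" "x = ?c a" using x unfolding mem by blast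
      then have "?c (- a) \<oplus>\<^bsub>?H\<^esub> x = \<zero>\<^bsub>?H\<^esub>" unfolding zero by (simp only: ops add.left_inverse)
      moreover have "?c (- a) \<in> carrier ?H" unfolding mem using Zneg[OF a(1)] by blast
      ultimately show ?thesis by blast
    qed
  qed
  then have "module rat_field ?H"
  proof (intro moduleI class_cring.cring_axioms)
    show "q \<odot>\<^bsub>?H\<^esub> x \<in> carrier ?H" if x: "x \<in> carrier ?H" for q x
      using x Zscale unfolding mem by (metis ops(2))
    show "(q \<oplus>\<^bsub>rat_field\<^esub> r) \<odot>\<^bsub>?H\<^esub> x = q \<odot>\<^bsub>?H\<^esub> x \<oplus>\<^bsub>?H\<^esub> r \<odot>\<^bsub>?H\<^esub> x" if x: "x \<in> carrier ?H" for q r x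
    proof -
      obtain a where "x = ?c a" using x unfolding mem by blast
      then show ?thesis by (simp only: ops monoid.simps ring.simps rc.scale_left_distrib)
    qed
    show "q \<odot>\<^bsub>?H\<^esub> (x \<oplus>\<^bsub>?H\<^esub> y) = q \<odot>\<^bsub>?H\<^esub> x \<oplus>\<^bsub>?H\<^esub> q \<odot>\<^bsub>?H\<^esub> y"
      if xy: "x \<in> carrier ?H" "y \<in> carrier ?H" for q x y
    proof -
      obtain a b where "x = ?c a" "y = ?c b" using xy unfolding mem by blast
      then show ?thesis by (simp only: ops rc.scale_right_distrib)
    qed
    show "(q \<otimes>\<^bsub>rat_field\<^esub> r) \<odot>\<^bsub>?H\<^esub> x = q \<odot>\<^bsub>?H\<^esub> (r \<odot>\<^bsub>?H\<^esub> x)" if x: "x \<in> carrier ?H" for q r x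
    proof -
      obtain a where "x = ?c a" using x unfolding mem by blast
      then show ?thesis by (simp only: ops monoid.simps ring.simps rc.scale_scale)
    qed
    show "\<one>\<^bsub>rat_field\<^esub> \<odot>\<^bsub>?H\<^esub> x = x" if x: "x \<in> carrier ?H" for x
    proof -
      obtain a where "x = ?c a" using x unfolding mem by blast
      then show ?thesis by (simp only: ops monoid.simps ring.simps rc.scale_one)
    qed
  qed
  then show ?thesis
    unfolding vectorspace_def using class_field.field_axioms by blast
qed

section \<open>Traces on one-dimensional homology\<close>

lemma (in module) lincomb_singleton:
  assumes "v \<in> carrier M" "c v \<in> carrier R" shows "lincomb c {v} = c v \<odot>\<^bsub>M\<^esub> v"
  unfolding lincomb_def using assms by simp

text \<open>\<open>trace_on\<close> uses bases and coordinates selected by \<open>SOME\<close>. In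
  dimension one the selected basis is a single nonzero vector, whatever the choice, and a scalar
  operator has the same diagonal entry with respect to each.\<close>

lemma trace_on_line:
  assumes V: "vectorspace rat_field V" and v: "v \<in> carrier V" "v \<noteq> \<zero>\<^bsub>V\<^esub>"
    and span: "\<And>x. x \<in> carrier V \<Longrightarrow> \<exists>q. x = q \<odot>\<^bsub>V\<^esub> v"
    and T: "\<And>x. x \<in> carrier V \<Longrightarrow> T x = l0 \<odot>\<^bsub>V\<^esub> x"
  shows "trace_on V T = l0"
proof -
  interpret vectorspace rat_field V by (rule V)
  have single: "lincomb c {w} = c w \<odot>\<^bsub>V\<^esub> w" if "w \<in> carrier V" for c w
    using that by (intro lincomb_singleton) simp_all
  have gen: "gen_set {v}"
  proof
    show "span {v} \<subseteq> carrier V" using v(1) by (intro span_is_subset2) auto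
    show "carrier V \<subseteq> span {v}"
    proof
      fix x assume "x \<in> carrier V"
      then obtain q where "x = q \<odot>\<^bsub>V\<^esub> v" using span by blast
      then have "x = lincomb (\<lambda>_. q) {v}" using single[OF v(1)] by simp
      then show "x \<in> span {v}" unfolding span_def by fastforce
    qed
  qed
  have fin: "fin_dim" unfolding fin_dim_def using gen v(1) by blast
  have dim: "dim = 1" by (rule dim1I[OF gen v(2,1)])
  define B where "B = (SOME B. finite B \<and> basis B)"
  have B: "finite B \<and> basis B"
    unfolding B_def by (rule someI_ex) (use finite_basis_exists[OF fin] in blast)
  then have "card B = 1" using dim_basis dim by metis
  then obtain b where b: "B = {b}" by (rule card_1_singletonE)
  have bc: "b \<in> carrier V" "b \<noteq> \<zero>\<^bsub>V\<^esub>"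
    using B vs_zero_lin_dep unfolding b basis_def by auto
  have "T b = lincomb (\<lambda>_. l0) {b}" using single[OF bc(1)] T[OF bc(1)] by simp
  then have "T b = lincomb (coordinates V B (T b)) B"
    unfolding coordinates_def b by (rule someI[of "\<lambda>c. T b = lincomb c {b}"])
  then have eq: "coordinates V B (T b) b \<odot>\<^bsub>V\<^esub> b = l0 \<odot>\<^bsub>V\<^esub> b"
    unfolding b using single[OF bc(1)] T[OF bc(1)] by simp
  have "coordinates V B (T b) b = l0"
  \<comment> \<open>Two distinct coefficients giving the same multiple of b would make a nonzero
    multiple of b vanish; dividing by the difference yields b = 0.\<close>
  proof (rule ccontr)
    assume "coordinates V B (T b) b \<noteq> l0"
    then have nz: "coordinates V B (T b) b - l0 \<noteq> 0" by simp
    let ?u = "coordinates V B (T b) b"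
    have "?u \<odot>\<^bsub>V\<^esub> b = (?u - l0) \<odot>\<^bsub>V\<^esub> b \<oplus>\<^bsub>V\<^esub> l0 \<odot>\<^bsub>V\<^esub> b"
      using smult_l_distr[of "?u - l0" l0 b] bc(1) by simp
    then have "(?u - l0) \<odot>\<^bsub>V\<^esub> b = \<zero>\<^bsub>V\<^esub>"
      using eq bc(1) M.add.r_cancel_one[of "l0 \<odot>\<^bsub>V\<^esub> b" "(?u - l0) \<odot>\<^bsub>V\<^esub> b"] by simp
    then have "(1 / (?u - l0)) \<odot>\<^bsub>V\<^esub> ((?u - l0) \<odot>\<^bsub>V\<^esub> b) = \<zero>\<^bsub>V\<^esub>"
      by simp
    moreover have "(1 / (?u - l0)) \<odot>\<^bsub>V\<^esub> ((?u - l0) \<odot>\<^bsub>V\<^esub> b) = b"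
      using smult_assoc1[of "1 / (?u - l0)" "?u - l0" b] smult_one[of b] bc(1) nz by simp
    ultimately show False using bc(2) by simp
  qed
  then show ?thesis
    unfolding trace_on_def using fin by (simp add: B_def[symmetric] b Let_def)
qed

lemma trace_rat_homology:
  assumes f: "continuous_map X X f" "f ` S \<subseteq> S"
    and c0: "c0 \<in> rat_relcycles p X S" "c0 \<notin> rat_relboundaries p X S"
    and span: "\<And>c. c \<in> rat_relcycles p X S \<Longrightarrow> \<exists>q. c - rscale q c0 \<in> rat_relboundaries p X S"
    and T: "\<And>c. c \<in> rat_relcycles p X S \<Longrightarrow> rat_chain_map p f c - rscale l c \<in> rat_relboundaries p X S"
  shows "trace_on (rat_homology p X S) (rat_hom_induced p X S X S f) = l"
proof (rule trace_on_line[OF vectorspace_rat_homology, where v = "{d. d - c0 \<in> rat_relboundaries p X S}"])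
  show "{d. d - c0 \<in> rat_relboundaries p X S} \<in> carrier (rat_homology p X S)"
    unfolding carrier_rat_homology using c0(1) by blast
  show "{d. d - c0 \<in> rat_relboundaries p X S} \<noteq> \<zero>\<^bsub>rat_homology p X S\<^esub>"
    unfolding zero_rat_homology using c0(2) rel_class_zero_iff by blast
  fix x assume "x \<in> carrier (rat_homology p X S)"
  then obtain c where c: "c \<in> rat_relcycles p X S" "x = {d. d - c \<in> rat_relboundaries p X S}"
    unfolding carrier_rat_homology by blast
  obtain q where "c - rscale q c0 \<in> rat_relboundaries p X S" using span[OF c(1)] by blast
  then show "\<exists>q. x = q \<odot>\<^bsub>rat_homology p X S\<^esub> {d. d - c0 \<in> rat_relboundaries p X S}"
    unfolding c(2) smult_rat_homology using rel_class_eq_iff by blast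
  show "rat_hom_induced p X S X S f x = l \<odot>\<^bsub>rat_homology p X S\<^esub> x"
    unfolding c(2) smult_rat_homology rat_hom_induced_class[OF f] using rel_class_eq_iff T[OF c(1)] by blast
qed

lemma rat_homology_nonzero_iff:
  "carrier (rat_homology p X S) \<noteq> {\<zero>\<^bsub>rat_homology p X S\<^esub>} \<longleftrightarrow>
    \<not> rat_relcycles p X S \<subseteq> rat_relboundaries p X S"
proof -
  have "rat_relboundaries p X S \<in> carrier (rat_homology p X S)"
    unfolding carrier_rat_homology
    by (rule image_eqI[of _ _ 0]) (simp_all add: rc.subspace_0[OF subspace_rat_relcycles])
  then have "carrier (rat_homology p X S) = {rat_relboundaries p X S} \<longleftrightarrow>
      (\<forall>x\<in>carrier (rat_homology p X S). x = rat_relboundaries p X S)"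
    by blast
  moreover have "(\<forall>x\<in>carrier (rat_homology p X S). x = rat_relboundaries p X S) \<longleftrightarrow>
      (\<forall>c\<in>rat_relcycles p X S. c \<in> rat_relboundaries p X S)"
    unfolding carrier_rat_homology by (simp add: rel_class_zero_iff)
  ultimately show ?thesis by (simp only: zero_rat_homology subset_eq)
qed

text \<open>With T an isomorphism to the rationals, the combination of c and d with coefficients T d
  and -T c has image zero, hence bounds. If T c = 0, then c itself bounds.\<close>

lemma rat_rank_le_1_if_line:
  assumes "isomorphic_spaces rat_field (rat_homology p X S) rat_line"
  shows "rat_rank_le_1 p X S"
  unfolding rat_rank_le_1_def
proof (intro ballI)
  fix c d assume c: "c \<in> rat_relcycles p X S" and d: "d \<in> rat_relcycles p X S"
  let ?H = "rat_homology p X S"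
  let ?c = "\<lambda>c. {d. d - c \<in> rat_relboundaries p X S}"
  obtain T where T: "linear_map rat_field ?H rat_line T" "bij_betw T (carrier ?H) (carrier rat_line)"
    using assms unfolding isomorphic_spaces_def by blast
  interpret T: linear_map rat_field ?H rat_line T by (rule T(1))
  have mem: "?c e \<in> carrier ?H" if "e \<in> rat_relcycles p X S" for e
    unfolding carrier_rat_homology using that by blast
  have Tlin: "T (?c (rscale q c + rscale r d)) = q * T (?c c) + r * T (?c d)" for q r
  proof -
    have "T (?c (rscale q c + rscale r d)) = T (q \<odot>\<^bsub>?H\<^esub> ?c c \<oplus>\<^bsub>?H\<^esub> r \<odot>\<^bsub>?H\<^esub> ?c d)"
      by (simp only: add_rat_homology smult_rat_homology)
    also have "\<dots> = q * T (?c c) + r * T (?c d)"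
      using mem[OF c] mem[OF d] by (simp add: T.T_add T.T_smult rat_line_def)
    finally show ?thesis .
  qed
  have T0: "T (?c 0) = 0" using T.T0_is_0 by (simp add: zero_rat_homology rat_line_def)
  have key: "rscale q c + rscale r d \<in> rat_relboundaries p X S" if "q * T (?c c) + r * T (?c d) = 0" for q r
  proof -
    have "rscale q c + rscale r d \<in> rat_relcycles p X S"
      by (intro rc.subspace_add[OF subspace_rat_relcycles] rc.subspace_scale[OF subspace_rat_relcycles] c d)
    moreover have "0 \<in> rat_relcycles p X S" by (rule rc.subspace_0[OF subspace_rat_relcycles])
    moreover have "T (?c (rscale q c + rscale r d)) = T (?c 0)" using Tlin T0 that by simp
    ultimately have "?c (rscale q c + rscale r d) = ?c 0"
      using T(2) mem unfolding bij_betw_def inj_on_def by blast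
    then show ?thesis unfolding rel_class_eq_iff by simp
  qed
  show "\<exists>q r. (q, r) \<noteq> (0, 0) \<and> rscale q c + rscale r d \<in> rat_relboundaries p X S"
  proof (cases "T (?c c) = 0")
    case True
    then show ?thesis using key[of 1 0] by (intro exI[of _ 1] exI[of _ 0]) auto
  next
    case False
    then show ?thesis using key[of "T (?c d)" "- T (?c c)"] by (intro exI[of _ "T (?c d)"] exI[of _ "- T (?c c)"]) auto
  qed
qed

section \<open>Relative Lefschetz numbers\<close>

lemma rat_chain_map_funpow:
  fixes f :: "'a \<Rightarrow> 'a"
  assumes c: "c \<in> rchains p X"
  shows "rat_chain_map p (f ^^ m) c = (rat_chain_map p f ^^ m) c"
proof (induction m)
  case 0
  have "rat_chain_map p id c = (\<lambda>c. c) c"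
  proof (rule linear_eq_on_chains[OF linear_rat_chain_map])
    show "Vector_Spaces.linear rscale rscale (\<lambda>c. c)" by unfold_locales simp_all
    fix \<sigma> assume "\<sigma> \<in> Poly_Mapping.keys c"
    then have "simplex_map p id \<sigma> = \<sigma>"
      using c simplex_map_id_gen[of p X \<sigma> id] by (auto simp: rchains_def)
    then show "rat_chain_map p id (Poly_Mapping.single \<sigma> 1) = Poly_Mapping.single \<sigma> 1" by simp
  qed
  moreover have "f ^^ 0 = id" "(rat_chain_map p f ^^ 0) c = c" by simp_all
  ultimately show ?case by (simp only:)
next
  case (Suc m)
  have "f ^^ Suc m = f \<circ> f ^^ m" by simp
  then show ?case using Suc by (simp only: rat_chain_map_compose) simp
qed

text \<open>Every class is a multiple of the class of c0, so f acts as one scalar l and its iterates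
  as the powers of l. The relation for all cycles is kept beside the traces, because it is needed to
  read triviality of f back from l = 0.\<close>

lemma trace_funpow_rank_1:
  assumes f: "continuous_map X X f" "f ` S \<subseteq> S" and rk: "rat_rank_le_1 p X S"
    and c0: "c0 \<in> rat_relcycles p X S" "c0 \<notin> rat_relboundaries p X S"
  obtains l where "\<And>m. trace_on (rat_homology p X S) (rat_hom_induced p X S X S (f ^^ m)) = l ^ m"
    "rat_chain_map p f c0 - rscale l c0 \<in> rat_relboundaries p X S"
    "\<And>c. c \<in> rat_relcycles p X S \<Longrightarrow> rat_chain_map p f c - rscale l c \<in> rat_relboundaries p X S"
proof -
  let ?Z = "rat_relcycles p X S" and ?B = "rat_relboundaries p X S"
  note add = rc.subspace_add[OF subspace_rat_relboundaries] and diff = rc.subspace_diff[OF subspace_rat_relboundaries]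
    and scale = rc.subspace_scale[OF subspace_rat_relboundaries]
  have span: "\<exists>s. c - rscale s c0 \<in> ?B" if c: "c \<in> ?Z" for c
  proof -
    obtain q r where qr: "(q, r) \<noteq> (0, 0)" "rscale q c + rscale r c0 \<in> ?B"
      using rk c c0(1) unfolding rat_rank_le_1_def by blast
    have q: "q \<noteq> 0"
    proof
      assume "q = 0"
      then have "r \<noteq> 0" "rscale r c0 \<in> ?B" using qr by auto
      then have "rscale (1 / r) (rscale r c0) \<in> ?B" using scale by blast
      then show False using \<open>r \<noteq> 0\<close> c0(2) by simp
    qed
    have "rscale (1 / q) (rscale q c + rscale r c0) \<in> ?B" by (rule scale[OF qr(2)])
    then have "c - rscale (- r / q) c0 \<in> ?B"
      using q by (simp add: rc.scale_right_distrib rc.scale_minus_left)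
    then show ?thesis by blast
  qed
  have fZ: "rat_chain_map p f c \<in> ?Z" if "c \<in> ?Z" for c
    by (rule rat_chain_map_relcycles[OF f that])
  have fB: "rat_chain_map p f c \<in> ?B" if "c \<in> ?B" for c
    by (rule rat_chain_map_relboundaries[OF f that])
  obtain l where l: "rat_chain_map p f c0 - rscale l c0 \<in> ?B"
    using span[OF fZ[OF c0(1)]] by blast
  have all: "rat_chain_map p f c - rscale l c \<in> ?B" if c: "c \<in> ?Z" for c
  proof -
    obtain s where s: "c - rscale s c0 \<in> ?B" using span[OF c] by blast
    have "rat_chain_map p f c - rscale l c
        = rat_chain_map p f (c - rscale s c0) - rscale l (c - rscale s c0)
          + rscale s (rat_chain_map p f c0 - rscale l c0)"
      by (simp add: rm.diff rm.scale rc.scale_right_diff_distrib mult.commute)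
    also have "\<dots> \<in> ?B"
      by (intro add diff scale fB s l)
    finally show ?thesis .
  qed
  have pow: "(rat_chain_map p f ^^ m) c \<in> ?Z \<and> (rat_chain_map p f ^^ m) c - rscale (l ^ m) c \<in> ?B"
    if c: "c \<in> ?Z" for c m
  proof (induction m)
    case 0
    then show ?case using c rc.subspace_0[OF subspace_rat_relboundaries] by simp
  next
    case (Suc m)
    let ?d = "(rat_chain_map p f ^^ m) c"
    have "(rat_chain_map p f ^^ Suc m) c - rscale (l ^ Suc m) c
        = (rat_chain_map p f ?d - rscale l ?d) + rscale l (?d - rscale (l ^ m) c)"
      by (simp add: rc.scale_right_diff_distrib)
    also have "\<dots> \<in> ?B" using Suc all scale add by blast
    finally show ?case using Suc fZ by simp
  qed
  have cont: "continuous_map X X (f ^^ m) \<and> (f ^^ m) ` S \<subseteq> S" for m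
  proof (induction m)
    case (Suc m)
    have "continuous_map X X (f \<circ> f ^^ m)"
      using Suc f(1) continuous_map_compose by blast
    moreover have "(f \<circ> f ^^ m) ` S \<subseteq> S" using Suc f(2) by auto
    moreover have "f ^^ Suc m = f \<circ> f ^^ m" by simp
    ultimately show ?case by (simp only: simp_thms)
  qed (auto simp: id_def)
  have "trace_on (rat_homology p X S) (rat_hom_induced p X S X S (f ^^ m)) = l ^ m" for m
  proof (rule trace_rat_homology[OF _ _ c0 span])
    show "rat_chain_map p (f ^^ m) c - rscale (l ^ m) c \<in> ?B" if c: "c \<in> ?Z" for c
      using pow[OF c, of m] rat_chain_map_funpow[where c = c and p = p and X = X and f = f and m = m] c by (simp add: mem_rat_relcycles)
  qed (use cont in auto)
  then show thesis using that[of l] l all by blast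
qed

section \<open>Rational consequences for projective space and for lifts of self-maps\<close>

lemma rat_cycles_CP:
  assumes "odd p \<or> p > 2 * n"
  shows "rat_relcycles p (complex_projective_space n) {} \<subseteq> rat_relboundaries p (complex_projective_space n) {}"
  by (rule rat_relcycles_subset_if_trivial) (use homology_CP assms in blast)

lemma rat_rank_CP: "rat_rank_le_1 p (complex_projective_space n) {}"
  by (rule rat_rank_le_1_if_rank_le_1) (use homology_CP in blast)

lemma rat_cycles_pset:
  assumes "0 < p" "p \<noteq> 2 * n + 1"
  shows "rat_relcycles p (top_of_set (pset n)) {} \<subseteq> rat_relboundaries p (top_of_set (pset n)) {}"
  by (rule rat_relcycles_subset_if_trivial[OF trivial_homology_pset[OF assms]])

text \<open>A self-map acting trivially on second homology lifts to the total space, which has no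
  homology in the relevant degrees.\<close>

lemma chain_map_trivial:
  assumes n: "n \<ge> 1" and f: "continuous_map (complex_projective_space n) (complex_projective_space n) f"
    and f2: "\<And>z. z \<in> rat_relcycles 2 (complex_projective_space n) {} \<Longrightarrow>
      rat_chain_map 2 f z \<in> rat_relboundaries 2 (complex_projective_space n) {}"
    and p: "0 < p" and z: "z \<in> rat_relcycles p (complex_projective_space n) {}"
  shows "rat_chain_map p f z \<in> rat_relboundaries p (complex_projective_space n) {}"
proof -
  let ?X = "complex_projective_space n"
  obtain k where k: "n = Suc k" using n by (cases n) auto
  have pc: "continuous_map (top_of_set (csphere n)) ?X projective_class"
    by (rule continuous_map_from_subtopology_mono[OF continuous_map_projective_class csphere_subset_pset])
  have "continuous_map (top_of_set (csphere n)) ?X (f \<circ> projective_class)"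
    by (rule continuous_map_compose[OF pc f])
  then obtain S where S: "continuous_on (csphere n) S" "S ` csphere n \<subseteq> pset n"
    "\<And>z. z \<in> csphere n \<Longrightarrow> projective_class (S z) = f (projective_class z)"
    using liftable_csphere[of n k] unfolding liftable_def k[symmetric] by (metis comp_apply)
  have "projective_class (S (rot t z)) = projective_class (S z)" if "z \<in> csphere n" for z t
    using S(3)[OF that] S(3)[OF rot_csphere[OF that]] by simp
  then obtain h where h: "continuous_on ({0..2} \<times> csphere n) h" "\<And>z. z \<in> csphere n \<Longrightarrow> h (0, z) = 0"
    "\<And>t z. t \<in> {0..2} \<Longrightarrow> z \<in> csphere n \<Longrightarrow> S (rot t z) = (\<lambda>i. exp (h (t, z)) * S z i)"
    using equivariant_log[OF S(1,2)] by metis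
  \<comment> \<open>Degree one differs from the dimension 2n + 1 of the sphere because n is at least
    1.\<close>
  have H1: "rat_relcycles 1 (top_of_set (pset n)) {} \<subseteq> rat_relboundaries 1 (top_of_set (pset n)) {}"
    using n by (intro rat_cycles_pset) auto
  have per: "h (1, z) = 0" if "z \<in> csphere n" for z
    by (rule orbit_log_periodic[OF f S h H1 f2 that])
  obtain g where g: "continuous_map ?X (top_of_set (pset n)) g"
    "\<And>L. L \<in> topspace ?X \<Longrightarrow> projective_class (g L) = f L"
    using factor_through_pset[OF f S h per] by blast
  show ?thesis
  \<comment> \<open>Above degree 2n the projective space itself has no homology. This covers degree
    2n + 1, the one positive degree in which the total space has a class.\<close>
  proof (cases "p > 2 * n")
    case True
    then show ?thesis
      using rat_cycles_CP[of p n] rat_chain_map_relcycles[OF f _ z, of "{}"] by auto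
  next
    case False
    have "rat_chain_map p g z \<in> rat_relcycles p (top_of_set (pset n)) {}"
      by (rule rat_chain_map_relcycles[OF g(1) _ z]) simp
    then have "rat_chain_map p g z \<in> rat_relboundaries p (top_of_set (pset n)) {}"
      using rat_cycles_pset[OF p, of n] False by auto
    then have "rat_chain_map p projective_class (rat_chain_map p g z) \<in> rat_relboundaries p ?X {}"
      by (rule rat_chain_map_relboundaries[OF continuous_map_projective_class, of "{}", rotated]) simp
    moreover have "rat_chain_map p projective_class (rat_chain_map p g z) = rat_chain_map p f z"
      unfolding rat_chain_map_compose[symmetric]
      using z g(2) by (intro rat_chain_map_cong[of _ p ?X]) (auto simp: mem_rat_cycles)
    ultimately show ?thesis by simp
  qed
qed

lemma acyclic_subspaceI:
  assumes "rat_acyclic (subtopology X A)" and "topspace X \<inter> A \<noteq> {}"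
  shows "acyclic_subspace X A"
proof
  show "rat_relcycles p (subtopology X A) {} \<subseteq> rat_relboundaries p (subtopology X A) {}" if "0 < p" for p
    using assms(1) that rat_homology_nonzero_iff[of p "subtopology X A" "{}"] unfolding rat_acyclic_def by blast
  show "rat_rank_le_1 0 (subtopology X A) {}"
    using assms(1) rat_rank_le_1_if_line unfolding rat_acyclic_def by blast
  show "topspace X \<inter> A \<noteq> {}" by (rule assms(2))
qed

theorem theorem3p3:
  fixes n :: nat
    and A :: "(nat \<Rightarrow> complex) set set"
    and f :: "(nat \<Rightarrow> complex) set \<Rightarrow> (nat \<Rightarrow> complex) set"
    and a :: rat
  assumes "n \<ge> 1"
    and "closedin (complex_projective_space n) A"
    and "complex_projective_space n interior_of A \<noteq> {}"
    and "rat_acyclic (subtopology (complex_projective_space n) A)"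
    and "continuous_map (complex_projective_space n) (complex_projective_space n) f"
    and "f ` A \<subseteq> A"
    and "is_eigenvalue (rat_cohomology 2 (complex_projective_space n))
           (rat_cohom_induced 2 (complex_projective_space n) f) a"
  shows "(\<forall>m\<ge>1. lefschetz_number (complex_projective_space n) A (f ^^ m) = 0) \<longleftrightarrow> a = 0"
proof -
  let ?X = "complex_projective_space n"
  let ?Z = "\<lambda>p. rat_relcycles p ?X A" and ?B = "\<lambda>p. rat_relboundaries p ?X A"
  have "topspace ?X \<inter> A \<noteq> {}"
    using assms(3) interior_of_subset[of ?X A] interior_of_subset_topspace[of ?X A] by blast
  then interpret acyclic_subspace ?X A by (rule acyclic_subspaceI[OF assms(4)])
  \<comment> \<open>The degrees over which \<open>lefschetz_number\<close> sums.\<close>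
  define K where "K = {k. \<not> ?Z k \<subseteq> ?B k}"
  have K: "even k \<and> 0 < k \<and> k \<le> 2 * n" if "k \<in> K" for k
  proof (cases k)
    case 0
    then show ?thesis using that relative_trivial_0[OF rat_rank_CP] by (simp add: K_def)
  next
    case (Suc p)
    have "\<not> (odd k \<or> k > 2 * n)"
    proof
      assume "odd k \<or> k > 2 * n"
      then have "rat_relcycles (Suc p) ?X {} \<subseteq> rat_relboundaries (Suc p) ?X {}"
        unfolding Suc[symmetric] by (rule rat_cycles_CP)
      then have "?Z k \<subseteq> ?B k" unfolding Suc by (rule relative_trivial)
      then show False using that by (simp add: K_def)
    qed
    then show ?thesis using Suc by simp
  qed
  \<comment> \<open>Finiteness makes the sum over K genuine, since sums over infinite sets are 0 by
    default, and so allows the vanishing of each square to be deduced from a vanishing sum.\<close>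
  then have "finite K" by (intro finite_subset[of K "{..2 * n}"]) auto
  have "\<exists>l. (\<forall>m. trace_on (rat_homology k ?X A) (rat_hom_induced k ?X A ?X A (f ^^ m)) = l ^ m) \<and>
      (\<exists>c0\<in>?Z k. c0 \<notin> ?B k \<and> rat_chain_map k f c0 - rscale l c0 \<in> ?B k) \<and>
      (\<forall>c\<in>?Z k. rat_chain_map k f c - rscale l c \<in> ?B k)" if k: "k \<in> K" for k
  proof -
    obtain p where p: "k = Suc p" using K[OF k] by (cases k) auto
    obtain c0 where c0: "c0 \<in> ?Z k" "c0 \<notin> ?B k" using k unfolding K_def by blast
    have rk: "rat_rank_le_1 k ?X A" unfolding p by (rule relative_rank_le_1[OF rat_rank_CP])
    show ?thesis using trace_funpow_rank_1[OF assms(5,6) rk c0] c0 by metis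
  qed
  then obtain l where l: "\<And>k m. k \<in> K \<Longrightarrow> trace_on (rat_homology k ?X A) (rat_hom_induced k ?X A ?X A (f ^^ m)) = l k ^ m"
    "\<And>k. k \<in> K \<Longrightarrow> \<exists>c0\<in>?Z k. c0 \<notin> ?B k \<and> rat_chain_map k f c0 - rscale (l k) c0 \<in> ?B k"
    "\<And>k c. k \<in> K \<Longrightarrow> c \<in> ?Z k \<Longrightarrow> rat_chain_map k f c - rscale (l k) c \<in> ?B k"
    by metis
  have L: "lefschetz_number ?X A (f ^^ m) = (\<Sum>k\<in>K. l k ^ m)" for m
  proof -
    have "lefschetz_number ?X A (f ^^ m)
        = (\<Sum>k\<in>K. (-1) ^ k * trace_on (rat_homology k ?X A) (rat_hom_induced k ?X A ?X A (f ^^ m)))"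
      unfolding lefschetz_number_def rat_homology_nonzero_iff K_def ..
    also have "\<dots> = (\<Sum>k\<in>K. l k ^ m)"
      by (rule sum.cong) (use K l(1) in auto)
    finally show ?thesis .
  qed
  have a: "a = 0 \<longleftrightarrow> (\<forall>z\<in>rat_relcycles 2 ?X {}. rat_chain_map 2 f z \<in> rat_relboundaries 2 ?X {})"
    using eigenvalue_zero_iff[of 1 ?X f a] assms(5,7) rat_rank_CP by (simp add: numeral_2_eq_2)
  show ?thesis
  proof
    assume "a = 0"
    then have f2: "\<And>z. z \<in> rat_relcycles 2 ?X {} \<Longrightarrow> rat_chain_map 2 f z \<in> rat_relboundaries 2 ?X {}"
      using a by blast
    have "l k = 0" if k: "k \<in> K" for k
    proof (rule ccontr)
      assume nz: "l k \<noteq> 0"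
      obtain p where p: "k = Suc p" using K[OF k] by (cases k) auto
      obtain c0 where c0: "c0 \<in> ?Z k" "c0 \<notin> ?B k" "rat_chain_map k f c0 - rscale (l k) c0 \<in> ?B k"
        using l(2)[OF k] by blast
      have "rat_chain_map k f c0 \<in> ?B k"
        using c0(1) chain_map_trivial[OF assms(1,5) f2] unfolding p
        by (intro relative_map_trivial[OF assms(5,6)]) auto
      then have "rat_chain_map k f c0 - (rat_chain_map k f c0 - rscale (l k) c0) \<in> ?B k"
        using c0(3) by (rule rc.subspace_diff[OF subspace_rat_relboundaries])
      then have "rscale (l k) c0 \<in> ?B k" by simp
      then have "rscale (1 / l k) (rscale (l k) c0) \<in> ?B k"
        by (rule rc.subspace_scale[OF subspace_rat_relboundaries])
      then show False using nz c0(2) by simp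
    qed
    then show "\<forall>m\<ge>1. lefschetz_number ?X A (f ^^ m) = 0" unfolding L by simp
  next
    assume "\<forall>m\<ge>1. lefschetz_number ?X A (f ^^ m) = 0"
    then have "(\<Sum>k\<in>K. l k ^ 2) = 0" unfolding L by simp
    then have l0: "\<And>k. k \<in> K \<Longrightarrow> l k = 0"
      using \<open>finite K\<close> by (simp add: sum_nonneg_eq_0_iff)
    \<comment> \<open>If degree two is outside K, every relative two-cycle already bounds relative
      to A, including the image of c; otherwise f acts there by the scalar \<open>l (Suc 1)\<close>,
      which is zero.\<close>
    have "rat_chain_map (Suc 1) f c \<in> ?B (Suc 1)" if c: "c \<in> ?Z (Suc 1)" for c
    proof (cases "Suc 1 \<in> K")
      case True
      then show ?thesis using l(3)[OF True c] l0[OF True] by simp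
    next
      case False
      then show ?thesis using rat_chain_map_relcycles[OF assms(5,6) c] unfolding K_def by blast
    qed
    then show "a = 0"
      unfolding a using absolute_map_trivial[OF assms(5), of 1] by (simp add: numeral_2_eq_2)
  qed
qed

end
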